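(* (Strong Maximum Principle) Let $m\ge1$, $\lambda\ge 1$, and let $\Omega\subset\mathbb{R}^{1+m}$ be a $\Lambda$-connected, bounded open set. Let $u\in H^{1,\lambda}_0(\Omega)$ be a nonnegative function which is a supersolution of $-\Delta_\lambda u=0$, i.e. for every nonnegative $v\in H^{1,\lambda}_0(\Omega)$, $$\int_\Omega\langle A\nabla^*u,\nabla^*v\rangle\,dX\ge 0.$$ If there exists a ball $B_r(X_0)\Subset\Omega$ with $\inf_{B_r(X_0)}u=0$, then $u$ is identically zero in $\Omega$ (i.e. $u=0$ a.e. in $\Omega$).
   Context: Points of $\mathbb{R}^N=\mathbb{R}^{1+m}$ ($N=1+m$) are written $X=(x,y)$ with $x\in\mathbb{R}$, $y\in\mathbb{R}^m$. The Grushin operator is $\Delta_\lambda u=u_{xx}+|x|^{2\lambda}\Delta_y u=\operatorname{div}(A\nabla u)$, where $A(X)=\operatorname{diag}(1,|x|^{2\lambda}I_m)$. $B_r(X_0)$ is the Euclidean ball; $\Subset$ means that the closure is a compact subset; the infimum is the essential infimum. An open set $\Omega$ is $\Lambda$-connected if any two points of $\Omega$ can be joined by a continuous curve lying in $\Omega$ which is piecewise an integral curve of the vector fields $\pm\partial_x,\pm|x|^\lambda\partial_{y_1},\dots,\pm|x|^\lambda\partial_{y_m}$. Function spaces: $C^1_0(\Omega)$ is the space of $C^1$ functions with compact support in $\Omega$. $H^{1,\lambda}_0(\Omega)$ is the completion of $C^1_0(\Omega)$ under $\|u\|_0:=(\int_\Omega\langle A\nabla u,\nabla u\rangle dX)^{1/2}$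 (equivalent on $C^1_0(\Omega)$ to $(\int_\Omega|u|^2dX+\int_\Omega\langle A\nabla u,\nabla u\rangle dX)^{1/2}$ by a Poincaré inequality). An element represented by a Cauchy sequence $\{u_n\}$ is identified with $u=\lim u_n$ in $L^2(\Omega)$; setting $U=\lim\sqrt{A}\nabla u_n$ in $L^2(\Omega)^N$ (which is uniquely determined by $u$), the weak quasi-gradient is $\nabla^*u:=(\sqrt{A})^{-1}U$, defined a.e. in $\Omega$. *)

theory Defs
  imports "HOL-Analysis.Analysis" "HOL-Probability.Essential_Supremum"
begin

text \<open>Points \<open>X = (x, y)\<close> of \<open>\<real>\<^sup>1\<^sup>+\<^sup>m\<close> are elements of \<open>real \<times> (real ^ 'm)\<close> with \<open>m = CARD('m) \<ge> 1\<close>; the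
  norm of this type is the Euclidean one.\<close>

type_synonym 'm point = "real \<times> (real, 'm) vec"


subsection \<open>The Grushin matrix\<close>

text \<open>Matrices are given by their action on vectors.  Since \<open>0 powr a = 0\<close>, the coefficients
  vanish on \<open>x = 0\<close>.\<close>

definition grushin_A :: "real \<Rightarrow> 'm::finite point \<Rightarrow> 'm point \<Rightarrow> 'm point" where
  "grushin_A lam X V = (fst V, (\<bar>fst X\<bar> powr (2 * lam)) *\<^sub>R snd V)"

definition grushin_sqrtA :: "real \<Rightarrow> 'm::finite point \<Rightarrow> 'm point \<Rightarrow> 'm point" where
  "grushin_sqrtA lam X V = (fst V, (\<bar>fst X\<bar> powr lam) *\<^sub>R snd V)"

text \<open>Inverse of the square root off the null set \<open>x = 0\<close>, where the value is immaterial.\<close>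

definition grushin_sqrtA_inv :: "real \<Rightarrow> 'm::finite point \<Rightarrow> 'm point \<Rightarrow> 'm point" where
  "grushin_sqrtA_inv lam X V = (fst V, inverse (\<bar>fst X\<bar> powr lam) *\<^sub>R snd V)"

lemma grushin_sqrtA_sqrtA: "grushin_sqrtA lam X (grushin_sqrtA lam X V) = grushin_A lam X V"
  by (simp add: grushin_sqrtA_def grushin_A_def flip: powr_add)

lemma grushin_sqrtA_inverse:
  assumes "fst X \<noteq> 0"
  shows "grushin_sqrtA lam X (grushin_sqrtA_inv lam X V) = V"
    and "grushin_sqrtA_inv lam X (grushin_sqrtA lam X V) = V"
  using assms by (simp_all add: grushin_sqrtA_def grushin_sqrtA_inv_def)


subsection \<open>Connectedness along the vector fields\<close>

definition grushin_fields :: "real \<Rightarrow> ('m::finite point \<Rightarrow> 'm point) set" where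
  "grushin_fields lam =
     {(\<lambda>X. (1, 0)), (\<lambda>X. - (1, 0))} \<union>
     (\<Union>i. {(\<lambda>X. (0, (\<bar>fst X\<bar> powr lam) *\<^sub>R axis i 1)),
            (\<lambda>X. - (0, (\<bar>fst X\<bar> powr lam) *\<^sub>R axis i 1))})"

definition integral_curve_on ::
    "('a::real_normed_vector \<Rightarrow> 'a) \<Rightarrow> (real \<Rightarrow> 'a) \<Rightarrow> real set \<Rightarrow> bool" where
  "integral_curve_on Z \<gamma> S \<longleftrightarrow> (\<forall>s\<in>S. (\<gamma> has_vector_derivative Z (\<gamma> s)) (at s within S))"

text \<open>The fields fix the speed of the curve, hence the length \<open>T\<close> of the parameter interval is
  left free.\<close>

definition grushin_curve :: "real \<Rightarrow> (real \<Rightarrow> 'm::finite point) \<Rightarrow> real \<Rightarrow> bool" where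
  "grushin_curve lam \<gamma> T \<longleftrightarrow>
     continuous_on {0..T} \<gamma> \<and>
     (\<exists>(k::nat) t. t 0 = 0 \<and> t k = T \<and>
        (\<forall>i<k. t i < t (Suc i) \<and>
           (\<exists>Z\<in>grushin_fields lam. integral_curve_on Z \<gamma> {t i..t (Suc i)})))"

definition Lambda_connected :: "real \<Rightarrow> 'm::finite point set \<Rightarrow> bool" where
  "Lambda_connected lam \<Omega> \<longleftrightarrow>
     (\<forall>X\<in>\<Omega>. \<forall>Y\<in>\<Omega>. \<exists>\<gamma> T. 0 \<le> T \<and> grushin_curve lam \<gamma> T \<and>
        \<gamma> ` {0..T} \<subseteq> \<Omega> \<and> \<gamma> 0 = X \<and> \<gamma> T = Y)"


subsection \<open>Function spaces\<close>

text \<open>Elements of the Lebesgue and Sobolev spaces are represented by functions on the whole space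
  of which only the values almost everywhere in \<open>\<Omega>\<close> matter.\<close>

definition L2_space :: "'a::euclidean_space set \<Rightarrow> ('a \<Rightarrow> 'b::euclidean_space) set" where
  "L2_space \<Omega> = {f. f \<in> borel_measurable (lebesgue_on \<Omega>) \<and>
                     integrable (lebesgue_on \<Omega>) (\<lambda>X. (norm (f X))\<^sup>2)}"

definition L2_norm :: "'a::euclidean_space set \<Rightarrow> ('a \<Rightarrow> 'b::euclidean_space) \<Rightarrow> real" where
  "L2_norm \<Omega> f = sqrt (LINT X|lebesgue_on \<Omega>. (norm (f X))\<^sup>2)"

definition L2_tendsto ::
    "'a::euclidean_space set \<Rightarrow> (nat \<Rightarrow> 'a \<Rightarrow> 'b::euclidean_space) \<Rightarrow> ('a \<Rightarrow> 'b) \<Rightarrow> bool" where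
  "L2_tendsto \<Omega> f g \<longleftrightarrow>
     (\<forall>n. f n \<in> L2_space \<Omega>) \<and> g \<in> L2_space \<Omega> \<and>
     (\<lambda>n. L2_norm \<Omega> (\<lambda>X. f n X - g X)) \<longlonglongrightarrow> 0"

definition grad :: "('a::euclidean_space \<Rightarrow> real) \<Rightarrow> 'a \<Rightarrow> 'a" where
  "grad f X = (\<Sum>b\<in>Basis. frechet_derivative f (at X) b *\<^sub>R b)"

text \<open>Functions with compact support in \<open>\<Omega>\<close> are identified with their extension by zero.\<close>

definition C1_0 :: "'a::euclidean_space set \<Rightarrow> ('a \<Rightarrow> real) set" where
  "C1_0 \<Omega> = {f. (\<forall>X. f differentiable (at X)) \<and> continuous_on UNIV (grad f) \<and>
                 compact (closure {X. f X \<noteq> 0}) \<and> closure {X. f X \<noteq> 0} \<subseteq> \<Omega>}"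

definition energy_norm :: "real \<Rightarrow> 'm::finite point set \<Rightarrow> ('m point \<Rightarrow> real) \<Rightarrow> real" where
  "energy_norm lam \<Omega> f = sqrt (LINT X|lebesgue_on \<Omega>. grushin_A lam X (grad f X) \<bullet> grad f X)"

text \<open>The sequence \<open>\<phi>\<close> represents the element \<open>u\<close> of the completion of \<open>C1_0 \<Omega>\<close>.\<close>

definition represents ::
    "real \<Rightarrow> 'm::finite point set \<Rightarrow> (nat \<Rightarrow> 'm point \<Rightarrow> real) \<Rightarrow> ('m point \<Rightarrow> real) \<Rightarrow> bool" where
  "represents lam \<Omega> \<phi> u \<longleftrightarrow>
     (\<forall>n. \<phi> n \<in> C1_0 \<Omega>) \<and>
     (\<forall>e>0. \<exists>M. \<forall>i\<ge>M. \<forall>j\<ge>M. energy_norm lam \<Omega> (\<lambda>X. \<phi> i X - \<phi> j X) < e) \<and>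
     L2_tendsto \<Omega> \<phi> u"

definition H1_0 :: "real \<Rightarrow> 'm::finite point set \<Rightarrow> ('m point \<Rightarrow> real) set" where
  "H1_0 lam \<Omega> = {u. \<exists>\<phi>. represents lam \<Omega> \<phi> u}"

text \<open>For \<open>u \<in> H1_0 lam \<Omega>\<close> the limit \<open>U\<close> exists and is unique up to a null set, whatever the
  representing sequence; \<open>SOME\<close> picks one of its versions.\<close>

definition quasi_grad :: "real \<Rightarrow> 'm::finite point set \<Rightarrow> ('m point \<Rightarrow> real) \<Rightarrow> 'm point \<Rightarrow> 'm point"
  where
  "quasi_grad lam \<Omega> u =
     (let U = (SOME U. \<exists>\<phi>. represents lam \<Omega> \<phi> u \<and>
                  L2_tendsto \<Omega> (\<lambda>n X. grushin_sqrtA lam X (grad (\<phi> n) X)) U)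
      in (\<lambda>X. grushin_sqrtA_inv lam X (U X)))"

definition supersolution :: "real \<Rightarrow> 'm::finite point set \<Rightarrow> ('m point \<Rightarrow> real) \<Rightarrow> bool" where
  "supersolution lam \<Omega> u \<longleftrightarrow>
     (\<forall>v\<in>H1_0 lam \<Omega>. (AE X in lebesgue_on \<Omega>. 0 \<le> v X) \<longrightarrow>
        0 \<le> (LINT X|lebesgue_on \<Omega>.
               grushin_A lam X (quasi_grad lam \<Omega> u X) \<bullet> quasi_grad lam \<Omega> v X))"


subsection \<open>Essential infimum and compact containment\<close>

definition ess_inf_on :: "'a::euclidean_space set \<Rightarrow> ('a \<Rightarrow> real) \<Rightarrow> ereal" where
  "ess_inf_on S f = - esssup (lebesgue_on S) (\<lambda>X. - ereal (f X))"

definition compactly_contained :: "'a::topological_space set \<Rightarrow> 'a set \<Rightarrow> bool" where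
  "compactly_contained S \<Omega> \<longleftrightarrow> compact (closure S) \<and> closure S \<subseteq> \<Omega>"

end

theory Submission
  imports Defs
begin

text \<open>Call \<open>u\<close> positive near a point if it is essentially bounded below by a positive constant on some ball
  around it.  If \<open>u\<close> is positive on a small ball whose centre \<open>Z\<close> lies off the hyperplane \<open>x = 0\<close>, comparison
  with the barrier \<open>exp (- a |X - Z|\<^sup>2) - exp (- a R\<^sup>2)\<close> makes it positive on every larger concentric ball
  inside \<open>\<Omega>\<close>; such balls cross the hyperplane, so the set of points of positivity is open and closed in
  \<open>\<Omega>\<close>.  If \<open>u\<close> does not vanish almost everywhere, this set is nonempty: off \<open>x = 0\<close> the operator is
  locally uniformly elliptic, and testing with explicit truncations of the fundamental solution of the
  operator frozen at the pole bounds the means of \<open>u\<close> over small balls from below.  Hence \<open>u\<close> is positive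
  near every point of the compact set in which its infimum was assumed to be zero, a contradiction.\<close>

section \<open>Square-integrable functions\<close>

text \<open>The obstacle is the set x = 0, where A degenerates: an exponential barrier centred there
  fails to be a subsolution. The choice of centre avoids this, since a sphere about a point with
  nonzero x-coordinate has a normal with nonzero x-component wherever it meets the hyperplane.

  A barrier needs an initial lower bound. Off the hyperplane the weight |x|^(2 lam) is locally
  Lipschitz; freezing it at the pole makes the fundamental solution explicit, and on a small radius
  the freezing error is smaller than the gain from truncation. This stands in for a weak Harnack
  inequality. Its constants do not depend on the pole, so it bounds averages over arbitrarily small
  balls about all nearby points, and a covering argument turns averages into bounds almost
  everywhere.

  A second obstacle is that u is only an L2 limit and \<open>quasi_grad\<close> is defined by
  choice. The work is therefore done with the limit U of sqrt A grad along a sequence; its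
  independence of the sequence is closability, proved by an integration by parts that never
  differentiates the weight. In limits all second derivatives fall on explicit functions.\<close>

lemma norm_add_square_le:
  fixes a b :: "'a::real_inner"
  shows "(norm (a + b))\<^sup>2 \<le> 2 * (norm a)\<^sup>2 + 2 * (norm b)\<^sup>2"
proof -
  have "0 \<le> (a - b) \<bullet> (a - b)" by simp
  then show ?thesis
    unfolding power2_norm_eq_inner by (simp add: inner_simps inner_commute)
qed

lemma norm_diff_square_le:
  fixes a b :: "'a::real_inner"
  shows "(norm (a - b))\<^sup>2 \<le> 2 * (norm a)\<^sup>2 + 2 * (norm b)\<^sup>2"
  using norm_add_square_le[of a "- b"] by simp

lemma L2_spaceI:
  assumes "f \<in> borel_measurable (lebesgue_on \<Omega>)" "integrable (lebesgue_on \<Omega>) g"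
    and "\<And>X. X \<in> \<Omega> \<Longrightarrow> (norm (f X))\<^sup>2 \<le> g X"
  shows "f \<in> L2_space \<Omega>"
  using assms(1) unfolding L2_space_def
  by (auto intro!: Bochner_Integration.integrable_bound[OF assms(2)] AE_I2 dest!: assms(3))

lemma L2_space_measurable: "f \<in> L2_space \<Omega> \<Longrightarrow> f \<in> borel_measurable (lebesgue_on \<Omega>)"
  and L2_space_integrable: "f \<in> L2_space \<Omega> \<Longrightarrow> integrable (lebesgue_on \<Omega>) (\<lambda>X. (norm (f X))\<^sup>2)"
  by (auto simp: L2_space_def)

lemma L2_space_diff:
  assumes "f \<in> L2_space \<Omega>" "g \<in> L2_space \<Omega>"
  shows "(\<lambda>X. f X - g X) \<in> L2_space \<Omega>"
  using assms
  by (intro L2_spaceI[where g = "\<lambda>X. 2 * (norm (f X))\<^sup>2 + 2 * (norm (g X))\<^sup>2"])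
     (auto simp: L2_space_def norm_diff_square_le)

lemma L2_inner_integrable:
  assumes "f \<in> L2_space \<Omega>" "g \<in> L2_space \<Omega>"
  shows "integrable (lebesgue_on \<Omega>) (\<lambda>X. f X \<bullet> g X)"
proof (rule Bochner_Integration.integrable_bound)
  show "integrable (lebesgue_on \<Omega>) (\<lambda>X. (norm (f X))\<^sup>2 + (norm (g X))\<^sup>2)"
    using assms by (auto simp: L2_space_def)
  show "(\<lambda>X. f X \<bullet> g X) \<in> borel_measurable (lebesgue_on \<Omega>)"
    using assms by (auto simp: L2_space_def)
  have "\<bar>f X \<bullet> g X\<bar> \<le> (norm (f X))\<^sup>2 + (norm (g X))\<^sup>2" for X
    using Cauchy_Schwarz_ineq2[of "f X" "g X"] sum_squares_bound[of "norm (f X)" "norm (g X)"]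
      mult_nonneg_nonneg[OF norm_ge_zero norm_ge_zero, of "f X" "g X"] by linarith
  then show "AE X in lebesgue_on \<Omega>. norm (f X \<bullet> g X) \<le> norm ((norm (f X))\<^sup>2 + (norm (g X))\<^sup>2)"
    by simp
qed

lemma L2_space_imp_integrable:
  assumes "f \<in> L2_space \<Omega>" "\<Omega> \<in> lmeasurable"
  shows "integrable (lebesgue_on \<Omega>) f"
proof (rule Bochner_Integration.integrable_bound)
  show "integrable (lebesgue_on \<Omega>) (\<lambda>X. (norm (f X))\<^sup>2 + 1)"
    by (intro Bochner_Integration.integrable_add L2_space_integrable[OF assms(1)]
        finite_measure.integrable_const[OF finite_measure_lebesgue_on[OF assms(2)]])
  have "norm (f X) \<le> (norm (f X))\<^sup>2 + 1" for X
    using zero_le_power2[of "norm (f X) - 1 / 2"] by (simp add: power2_eq_square algebra_simps)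
  then show "AE X in lebesgue_on \<Omega>. norm (f X) \<le> norm ((norm (f X))\<^sup>2 + 1)"
    by simp
qed (use assms in \<open>auto simp: L2_space_def\<close>)

lemma bounded_measurable_L2_space:
  assumes "\<Omega> \<in> lmeasurable" "f \<in> borel_measurable (lebesgue_on \<Omega>)"
    and "\<And>X. X \<in> \<Omega> \<Longrightarrow> norm (f X) \<le> B"
  shows "f \<in> L2_space \<Omega>"
proof (rule L2_spaceI[where g = "\<lambda>_. B\<^sup>2"])
  show "integrable (lebesgue_on \<Omega>) (\<lambda>_. B\<^sup>2)"
    using finite_measure_lebesgue_on[OF assms(1)] by (rule finite_measure.integrable_const)
qed (use assms in \<open>auto intro: power_mono\<close>)

lemma continuous_L2_space:
  fixes f :: "'a::euclidean_space \<Rightarrow> 'b::euclidean_space"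
  assumes "open \<Omega>" "bounded \<Omega>" "continuous_on UNIV f"
  shows "f \<in> L2_space \<Omega>"
proof -
  have "compact (closure \<Omega>)" using assms by simp
  then have "bounded (f ` closure \<Omega>)"
    using assms(3) by (meson compact_continuous_image compact_imp_bounded continuous_on_subset subset_UNIV)
  then obtain B where "\<And>X. X \<in> \<Omega> \<Longrightarrow> norm (f X) \<le> B"
    using closure_subset unfolding bounded_iff by blast
  moreover have "f \<in> borel_measurable (lebesgue_on \<Omega>)"
    using assms by (intro continuous_imp_measurable_on_sets_lebesgue) (auto intro: continuous_on_subset)
  ultimately show ?thesis
    using assms by (intro bounded_measurable_L2_space lmeasurable_open) auto
qed

section \<open>Convergence and completeness in L2\<close>

lemma L2_tendsto_iff:
  "L2_tendsto \<Omega> f g \<longleftrightarrow> (\<forall>n. f n \<in> L2_space \<Omega>) \<and> g \<in> L2_space \<Omega> \<and>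
     (\<lambda>n. LINT X|lebesgue_on \<Omega>. (norm (f n X - g X))\<^sup>2) \<longlonglongrightarrow> 0"
proof -
  have "(\<lambda>n. sqrt (a n)) \<longlonglongrightarrow> 0 \<longleftrightarrow> a \<longlonglongrightarrow> 0" if "\<And>n. 0 \<le> a n" for a :: "nat \<Rightarrow> real"
    using tendsto_real_sqrt[of a 0 sequentially] tendsto_power[of "\<lambda>n. sqrt (a n)" 0 sequentially 2] that
    by auto
  then show ?thesis
    unfolding L2_tendsto_def L2_norm_def by (auto simp: integral_nonneg_AE)
qed

text \<open>The pointwise bound |ab| <= t b^2 + a^2 / t takes the place of the integral
  Cauchy-Schwarz inequality: first t is made small, then n large.\<close>

lemma L2_tendsto_inner:
  assumes f: "L2_tendsto \<Omega> f F" and g: "g \<in> L2_space \<Omega>"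
  shows "(\<lambda>n. LINT X|lebesgue_on \<Omega>. f n X \<bullet> g X) \<longlonglongrightarrow> (LINT X|lebesgue_on \<Omega>. F X \<bullet> g X)"
proof -
  let ?M = "lebesgue_on \<Omega>"
  define G where "G = (LINT X|?M. (norm (g X))\<^sup>2)"
  define d where "d n = (LINT X|?M. (norm (f n X - F X))\<^sup>2)" for n
  have [simp]: "0 \<le> G" "0 \<le> d n" for n by (auto simp: G_def d_def)
  have d0: "d \<longlonglongrightarrow> 0" and fL: "\<And>n. f n \<in> L2_space \<Omega>" and FL: "F \<in> L2_space \<Omega>"
    using f by (auto simp: L2_tendsto_iff d_def[abs_def])
  have key: "\<bar>(LINT X|?M. f n X \<bullet> g X) - (LINT X|?M. F X \<bullet> g X)\<bar> \<le> t * G + d n / t" if "0 < t" for n t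
  proof -
    have df: "(\<lambda>X. f n X - F X) \<in> L2_space \<Omega>" by (intro L2_space_diff fL FL)
    have "(LINT X|?M. f n X \<bullet> g X) - (LINT X|?M. F X \<bullet> g X) = (LINT X|?M. (f n X - F X) \<bullet> g X)"
      using L2_inner_integrable[OF fL g] L2_inner_integrable[OF FL g] by (simp add: inner_diff_left)
    also have "\<bar>\<dots>\<bar> \<le> (LINT X|?M. \<bar>(f n X - F X) \<bullet> g X\<bar>)"
      by (rule integral_abs_bound)
    also have "\<dots> \<le> (LINT X|?M. t * (norm (g X))\<^sup>2 + (norm (f n X - F X))\<^sup>2 / t)"
    proof (rule integral_mono)
      show "integrable ?M (\<lambda>X. \<bar>(f n X - F X) \<bullet> g X\<bar>)"
        using L2_inner_integrable[OF df g] by simp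
      show "integrable ?M (\<lambda>X. t * (norm (g X))\<^sup>2 + (norm (f n X - F X))\<^sup>2 / t)"
        using L2_space_integrable[OF g] L2_space_integrable[OF df] by simp
      fix X
      have *: "a * b \<le> t * b\<^sup>2 + a\<^sup>2 / t" if "0 \<le> a" "0 \<le> b" for a b :: real
      proof -
        have "0 \<le> (t * b - a)\<^sup>2 / t + a * b" using \<open>0 < t\<close> that by simp
        also have "\<dots> = t * b\<^sup>2 + a\<^sup>2 / t - a * b"
          using \<open>0 < t\<close> by (simp add: field_simps power2_eq_square)
        finally show ?thesis by simp
      qed
      show "\<bar>(f n X - F X) \<bullet> g X\<bar> \<le> t * (norm (g X))\<^sup>2 + (norm (f n X - F X))\<^sup>2 / t"
        using order_trans[OF Cauchy_Schwarz_ineq2 *] by simp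
    qed
    also have "\<dots> = t * G + d n / t"
      using L2_space_integrable[OF g] L2_space_integrable[OF df] by (simp add: G_def d_def)
    finally show ?thesis .
  qed
  show ?thesis
  proof (rule LIMSEQ_I)
    fix e :: real assume e: "0 < e"
    \<comment> \<open>The 1 added to G covers G = 0; the choice gives t G <= e / 2 and leaves room
      for d n / t.\<close>
    define t where "t = e / (2 * (G + 1))"
    have t: "0 < t" "t * G < e / 2 + e / 4"
      using e by (auto simp: t_def field_simps add_pos_nonneg add_nonneg_pos)
    obtain N where N: "\<And>n. N \<le> n \<Longrightarrow> d n < t * (e / 4)"
      using LIMSEQ_D[OF d0, of "t * (e / 4)"] t e by auto
    show "\<exists>N. \<forall>n\<ge>N. norm ((LINT X|?M. f n X \<bullet> g X) - (LINT X|?M. F X \<bullet> g X)) < e"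
    proof (intro exI allI impI)
      fix n assume "N \<le> n"
      then have "d n / t < e / 4" using N[of n] t by (simp add: field_simps)
      then show "norm ((LINT X|?M. f n X \<bullet> g X) - (LINT X|?M. F X \<bullet> g X)) < e"
        unfolding real_norm_def using key[OF t(1), of n] t(2) by linarith
    qed
  qed
qed

lemma L2_tendsto_AE_subseq:
  assumes "L2_tendsto \<Omega> f F"
  obtains k :: "nat \<Rightarrow> nat" where "strict_mono k"
    "AE X in lebesgue_on \<Omega>. (\<lambda>n. f (k n) X) \<longlonglongrightarrow> F X"
proof -
  let ?M = "lebesgue_on \<Omega>"
  have fL: "\<And>n. f n \<in> L2_space \<Omega>" and FL: "F \<in> L2_space \<Omega>"
    and lim: "(\<lambda>n. LINT X|?M. (norm (f n X - F X))\<^sup>2) \<longlonglongrightarrow> 0"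
    using assms by (auto simp: L2_tendsto_iff)
  obtain k where k: "strict_mono k" "AE X in ?M. (\<lambda>n. (norm (f (k n) X - F X))\<^sup>2) \<longlonglongrightarrow> 0"
    using tendsto_L1_AE_subseq[of ?M "\<lambda>n X. (norm (f n X - F X))\<^sup>2"] lim
      L2_space_integrable[OF L2_space_diff[OF fL FL]] by auto
  have "a \<longlonglongrightarrow> b" if "(\<lambda>n. (norm (a n - b))\<^sup>2) \<longlonglongrightarrow> 0" for a :: "nat \<Rightarrow> 'b" and b
    using tendsto_real_sqrt[OF that] by (simp add: LIM_zero_iff tendsto_norm_zero_iff)
  with k show thesis by (intro that[OF k(1)]) auto
qed

lemma L2_tendsto_subseq:
  assumes "L2_tendsto \<Omega> f F" "strict_mono (k :: nat \<Rightarrow> nat)"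
  shows "L2_tendsto \<Omega> (\<lambda>n. f (k n)) F"
  using assms LIMSEQ_subseq_LIMSEQ[of "\<lambda>n. L2_norm \<Omega> (\<lambda>X. f n X - F X)" 0 k]
  by (auto simp: L2_tendsto_def o_def)

lemma L2_tendsto_const: "f \<in> L2_space \<Omega> \<Longrightarrow> L2_tendsto \<Omega> (\<lambda>n. f) f"
  by (simp add: L2_tendsto_iff)

lemma L2_tendsto_diff:
  assumes "L2_tendsto \<Omega> f F" "L2_tendsto \<Omega> g G"
  shows "L2_tendsto \<Omega> (\<lambda>n X. f n X - g n X) (\<lambda>X. F X - G X)"
proof -
  let ?M = "lebesgue_on \<Omega>"
  have m: "\<And>n. f n \<in> L2_space \<Omega>" "F \<in> L2_space \<Omega>" "\<And>n. g n \<in> L2_space \<Omega>" "G \<in> L2_space \<Omega>"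
    and lim: "(\<lambda>n. LINT X|?M. (norm (f n X - F X))\<^sup>2) \<longlonglongrightarrow> 0" "(\<lambda>n. LINT X|?M. (norm (g n X - G X))\<^sup>2) \<longlonglongrightarrow> 0"
    using assms by (auto simp: L2_tendsto_iff)
  note i = L2_space_integrable[OF L2_space_diff[OF m(1,2)]] L2_space_integrable[OF L2_space_diff[OF m(3,4)]]
  have "(\<lambda>n. LINT X|?M. (norm (f n X - g n X - (F X - G X)))\<^sup>2) \<longlonglongrightarrow> 0"
  proof (rule tendsto_sandwich[OF _ _ tendsto_const])
    show "\<forall>\<^sub>F n in sequentially. (LINT X|?M. (norm (f n X - g n X - (F X - G X)))\<^sup>2)
      \<le> 2 * (LINT X|?M. (norm (f n X - F X))\<^sup>2) + 2 * (LINT X|?M. (norm (g n X - G X))\<^sup>2)"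
    proof (rule always_eventually, rule allI)
      fix n
      have "(LINT X|?M. (norm (f n X - g n X - (F X - G X)))\<^sup>2)
        \<le> (LINT X|?M. 2 * (norm (f n X - F X))\<^sup>2 + 2 * (norm (g n X - G X))\<^sup>2)"
      proof (rule integral_mono)
        show "integrable ?M (\<lambda>X. (norm (f n X - g n X - (F X - G X)))\<^sup>2)"
          by (intro L2_space_integrable L2_space_diff m)
        show "integrable ?M (\<lambda>X. 2 * (norm (f n X - F X))\<^sup>2 + 2 * (norm (g n X - G X))\<^sup>2)"
          using i by simp
        show "(norm (f n X - g n X - (F X - G X)))\<^sup>2
          \<le> 2 * (norm (f n X - F X))\<^sup>2 + 2 * (norm (g n X - G X))\<^sup>2" for X
          using norm_diff_square_le[of "f n X - F X" "g n X - G X"] by (simp add: algebra_simps)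
      qed
      also have "\<dots> = 2 * (LINT X|?M. (norm (f n X - F X))\<^sup>2) + 2 * (LINT X|?M. (norm (g n X - G X))\<^sup>2)"
        using i by simp
      finally show "(LINT X|?M. (norm (f n X - g n X - (F X - G X)))\<^sup>2) \<le> \<dots>" .
    qed
    show "(\<lambda>n. 2 * (LINT X|?M. (norm (f n X - F X))\<^sup>2) + 2 * (LINT X|?M. (norm (g n X - G X))\<^sup>2)) \<longlonglongrightarrow> 0"
      using lim by (auto intro!: tendsto_eq_intros)
  qed (simp add: integral_nonneg_AE)
  then show ?thesis
    using m by (simp add: L2_tendsto_iff L2_space_diff)
qed

lemma L2_tendsto_imp_Cauchy:
  assumes "L2_tendsto \<Omega> f F" "0 < e"
  shows "\<exists>M. \<forall>i\<ge>M. \<forall>j\<ge>M. L2_norm \<Omega> (\<lambda>X. f i X - f j X) < e"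
proof -
  let ?M = "lebesgue_on \<Omega>"
  have m: "\<And>n. f n \<in> L2_space \<Omega>" "F \<in> L2_space \<Omega>"
    and lim: "(\<lambda>n. LINT X|?M. (norm (f n X - F X))\<^sup>2) \<longlonglongrightarrow> 0"
    using assms by (auto simp: L2_tendsto_iff)
  obtain M where M: "\<And>n. M \<le> n \<Longrightarrow> (LINT X|?M. (norm (f n X - F X))\<^sup>2) < e\<^sup>2 / 4"
    using LIMSEQ_D[OF lim, of "e\<^sup>2 / 4"] \<open>0 < e\<close> by auto
  have "L2_norm \<Omega> (\<lambda>X. f i X - f j X) < e" if "M \<le> i" "M \<le> j" for i j
  proof -
    have "(LINT X|?M. (norm (f i X - f j X))\<^sup>2)
      \<le> (LINT X|?M. 2 * (norm (f i X - F X))\<^sup>2 + 2 * (norm (f j X - F X))\<^sup>2)"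
    proof (rule integral_mono)
      show "(norm (f i X - f j X))\<^sup>2 \<le> 2 * (norm (f i X - F X))\<^sup>2 + 2 * (norm (f j X - F X))\<^sup>2" for X
        using norm_diff_square_le[of "f i X - F X" "f j X - F X"] by simp
    qed (use L2_space_integrable[OF L2_space_diff[OF m(1,2)]]
          L2_space_integrable[OF L2_space_diff[OF m(1) m(1)]] in auto)
    also have "\<dots> = 2 * (LINT X|?M. (norm (f i X - F X))\<^sup>2) + 2 * (LINT X|?M. (norm (f j X - F X))\<^sup>2)"
      using L2_space_integrable[OF L2_space_diff[OF m]] by simp
    also have "\<dots> < e\<^sup>2" using M[OF that(1)] M[OF that(2)] by simp
    finally show ?thesis
      unfolding L2_norm_def using \<open>0 < e\<close> by (simp add: real_less_lsqrt)
  qed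
  then show ?thesis by blast
qed

text \<open>Riesz-Fischer: along a fast subsequence the increments are summable almost everywhere,
  because \<Omega> has finite measure and L1 norms are controlled by L2 norms; Fatou's lemma then
  identifies the limit of the whole sequence.\<close>

lemma L2_complete:
  fixes f :: "nat \<Rightarrow> 'a::euclidean_space \<Rightarrow> 'b::euclidean_space"
  assumes \<Omega>: "\<Omega> \<in> lmeasurable" and f: "\<And>n. f n \<in> L2_space \<Omega>"
    and Cauchy: "\<And>e. 0 < e \<Longrightarrow> \<exists>M. \<forall>i\<ge>M. \<forall>j\<ge>M. L2_norm \<Omega> (\<lambda>X. f i X - f j X) < e"
  shows "\<exists>F. L2_tendsto \<Omega> f F"
proof -
  let ?M = "lebesgue_on \<Omega>"
  define N where "N i j = (LINT X|?M. (norm (f i X - f j X))\<^sup>2)" for i j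
  have N0: "0 \<le> N i j" for i j by (simp add: N_def)
  have int: "integrable ?M (\<lambda>X. (norm (f i X - f j X))\<^sup>2)" for i j
    by (intro L2_space_integrable L2_space_diff f)
  have fm [measurable]: "f i \<in> borel_measurable ?M" for i
    using f by (rule L2_space_measurable)
  have Cau: "\<exists>M. \<forall>i\<ge>M. \<forall>j\<ge>M. N i j < e" if "0 < e" for e
    using Cauchy[of "sqrt e"] that unfolding L2_norm_def N_def by simp
  define m where "m n = (SOME M. \<forall>i\<ge>M. \<forall>j\<ge>M. N i j < (1 / 4) ^ n)" for n :: nat
  have m: "N i j < (1 / 4) ^ n" if "m n \<le> i" "m n \<le> j" for n i j
    using someI_ex[OF Cau[of "(1 / 4) ^ n"]] that unfolding m_def by auto
  \<comment> \<open>Partial sums put both \<open>k n\<close> and \<open>k (Suc n)\<close> beyond the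
    threshold \<open>m n\<close>; the summand n makes \<open>k\<close> tend to infinity, as Fatou's
    estimate requires.\<close>
  define k where "k n = (\<Sum>i\<le>n. m i) + n" for n
  have km: "m n \<le> k n" "m n \<le> k (Suc n)" for n
    using member_le_sum[of n "{..n}" m] by (simp_all add: k_def)
  have kn: "n \<le> k n" for n by (simp add: k_def)
  have int1: "integrable ?M (\<lambda>X. norm (f (k (Suc n)) X - f (k n) X))" for n
    by (intro integrable_norm L2_space_imp_integrable L2_space_diff f \<Omega>)
  have step: "(LINT X|?M. norm (f (k (Suc n)) X - f (k n) X)) \<le> (measure lebesgue \<Omega> + 1) * (1 / 2) ^ n" for n
  proof -
    have "(LINT X|?M. norm (f (k (Suc n)) X - f (k n) X))
      \<le> (LINT X|?M. (1 / 2) ^ n + 2 ^ n * (norm (f (k (Suc n)) X - f (k n) X))\<^sup>2)"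
    proof (rule integral_mono[OF int1])
      show "integrable ?M (\<lambda>X. (1 / 2) ^ n + 2 ^ n * (norm (f (k (Suc n)) X - f (k n) X))\<^sup>2)"
        by (intro Bochner_Integration.integrable_add integrable_mult_right int
            finite_measure.integrable_const[OF finite_measure_lebesgue_on[OF \<Omega>]])
      \<comment> \<open>Completing the square at 2^-(n+1) trades |a| for a^2 at the price of a
        summable constant.\<close>
      have *: "a \<le> (1 / 2) ^ n + 2 ^ n * a\<^sup>2" for a :: real
      proof -
        have "0 \<le> 2 ^ n * (a - (1 / 2) ^ (n + 1))\<^sup>2" by simp
        also have "\<dots> = 2 ^ n * a\<^sup>2 - a + (1 / 2) ^ n / 4"
          by (simp add: power2_eq_square algebra_simps power_divide)
        also have "\<dots> \<le> 2 ^ n * a\<^sup>2 - a + (1 / 2) ^ n" by simp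
        finally show ?thesis by simp
      qed
      show "norm (f (k (Suc n)) X - f (k n) X)
        \<le> (1 / 2) ^ n + 2 ^ n * (norm (f (k (Suc n)) X - f (k n) X))\<^sup>2" for X
        by (rule *)
    qed
    also have "\<dots> = measure lebesgue \<Omega> * (1 / 2) ^ n + 2 ^ n * N (k (Suc n)) (k n)"
    proof (subst Bochner_Integration.integral_add)
      show "integrable ?M (\<lambda>X. (1 / 2) ^ n)"
        by (rule finite_measure.integrable_const[OF finite_measure_lebesgue_on[OF \<Omega>]])
    qed (use \<Omega> int in \<open>auto simp: N_def measure_restrict_space fmeasurableD\<close>)
    also have "\<dots> \<le> measure lebesgue \<Omega> * (1 / 2) ^ n + 2 ^ n * (1 / 4) ^ n"
      using m[OF km(2) km(1), of n] by (intro add_left_mono mult_left_mono) auto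
    also have "\<dots> = (measure lebesgue \<Omega> + 1) * (1 / 2) ^ n"
      by (simp add: algebra_simps flip: power_mult_distrib)
    finally show ?thesis .
  qed
  have "AE X in ?M. summable (\<lambda>n. norm (f (k (Suc n)) X - f (k n) X))"
  proof -
    have "(\<Sum>n. \<integral>\<^sup>+X. ennreal (norm (f (k (Suc n)) X - f (k n) X)) \<partial>?M)
       \<le> (\<Sum>n. ennreal ((measure lebesgue \<Omega> + 1) * (1 / 2) ^ n))"
      using step by (intro suminf_le) (auto simp: nn_integral_eq_integral[OF int1] ennreal_leI)
    also have "\<dots> < \<infinity>"
      by (subst suminf_ennreal2) (auto intro!: summable_mult)
    finally have "(\<integral>\<^sup>+X. (\<Sum>n. ennreal (norm (f (k (Suc n)) X - f (k n) X))) \<partial>?M) \<noteq> \<infinity>"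
      by (subst nn_integral_suminf) auto
    then have "AE X in ?M. (\<Sum>n. ennreal (norm (f (k (Suc n)) X - f (k n) X))) \<noteq> \<infinity>"
      by (intro nn_integral_PInf_AE) auto
    then show ?thesis
      by eventually_elim (auto intro!: summable_suminf_not_top)
  qed
  then have AEc: "AE X in ?M. convergent (\<lambda>n. f (k n) X)"
  proof eventually_elim
    case (elim X)
    then have "summable (\<lambda>n. f (k (Suc n)) X - f (k n) X)"
      by (rule summable_norm_cancel)
    then have "convergent (\<lambda>n. \<Sum>i<n. f (k (Suc i)) X - f (k i) X)"
      by (simp add: summable_iff_convergent)
    then have "convergent (\<lambda>n. f (k n) X - f (k 0) X)"
      using sum_lessThan_telescope[of "\<lambda>n. f (k n) X"] by simp
    then show ?case
      using convergent_add[OF _ convergent_const[of "f (k 0) X"]] by fastforce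
  qed
  define F where "F X = lim (\<lambda>n. f (k n) X)" for X
  have [measurable]: "F \<in> borel_measurable ?M"
    unfolding F_def by measurable
  have AEl: "AE X in ?M. (\<lambda>n. f (k n) X) \<longlonglongrightarrow> F X"
    using AEc unfolding F_def by eventually_elim (simp add: convergent_LIMSEQ_iff)
  \<comment> \<open>The second index of the Cauchy estimate is sent to infinity along
    \<open>k\<close>. F is not yet known to be square integrable, hence the nonnegative
    integral.\<close>
  have Fatou: "(\<integral>\<^sup>+X. ennreal ((norm (f i X - F X))\<^sup>2) \<partial>?M) \<le> ennreal e"
    if M: "\<And>j. M \<le> j \<Longrightarrow> N i j < e" for i M e
  proof -
    have "(\<integral>\<^sup>+X. ennreal ((norm (f i X - F X))\<^sup>2) \<partial>?M)
      = (\<integral>\<^sup>+X. liminf (\<lambda>n. ennreal ((norm (f i X - f (k n) X))\<^sup>2)) \<partial>?M)"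
    proof (rule nn_integral_cong_AE, use AEl in eventually_elim)
      case (elim X)
      then have "(\<lambda>n. ennreal ((norm (f i X - f (k n) X))\<^sup>2)) \<longlonglongrightarrow> ennreal ((norm (f i X - F X))\<^sup>2)"
        by (intro tendsto_intros tendsto_ennrealI)
      then show ?case
        using lim_imp_Liminf[OF sequentially_bot] by fastforce
    qed
    also have "\<dots> \<le> liminf (\<lambda>n. \<integral>\<^sup>+X. ennreal ((norm (f i X - f (k n) X))\<^sup>2) \<partial>?M)"
      by (rule nn_integral_liminf) auto
    also have "\<dots> \<le> ennreal e"
    proof (rule Liminf_le)
      show "\<forall>\<^sub>F n in sequentially. (\<integral>\<^sup>+X. ennreal ((norm (f i X - f (k n) X))\<^sup>2) \<partial>?M) \<le> ennreal e"
        using eventually_ge_at_top[of M]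
      proof eventually_elim
        case (elim n)
        then have "N i (k n) \<le> e" using M[of "k n"] kn[of n] by simp
        then show ?case
          by (subst nn_integral_eq_integral) (auto simp: int N_def[symmetric] ennreal_leI)
      qed
    qed simp
    finally show ?thesis .
  qed
  have FL: "F \<in> L2_space \<Omega>"
  proof -
    obtain i where i: "\<And>j. i \<le> j \<Longrightarrow> N i j < 1" using Cau[of 1] by auto
    have "integrable ?M (\<lambda>X. (norm (f i X - F X))\<^sup>2)"
      using order_le_less_trans[OF Fatou[of i i 1] ennreal_less_top] i
      by (intro integrableI_bounded) auto
    then have "(\<lambda>X. f i X - F X) \<in> L2_space \<Omega>" by (simp add: L2_space_def)
    from L2_space_diff[OF f[of i] this] show ?thesis by simp
  qed
  have "(\<lambda>i. LINT X|?M. (norm (f i X - F X))\<^sup>2) \<longlonglongrightarrow> 0"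
  proof (rule LIMSEQ_I)
    fix e :: real assume "0 < e"
    obtain M where M: "\<And>i j. M \<le> i \<Longrightarrow> M \<le> j \<Longrightarrow> N i j < e / 2"
      using Cau[of "e / 2"] \<open>0 < e\<close> by auto
    show "\<exists>M. \<forall>i\<ge>M. norm ((LINT X|?M. (norm (f i X - F X))\<^sup>2) - 0) < e"
    proof (intro exI allI impI)
      fix i assume "M \<le> i"
      have "ennreal (LINT X|?M. (norm (f i X - F X))\<^sup>2) \<le> ennreal (e / 2)"
        using Fatou[OF M[OF \<open>M \<le> i\<close>]] L2_space_integrable[OF L2_space_diff[OF f FL]]
        by (simp add: nn_integral_eq_integral)
      then show "norm ((LINT X|?M. (norm (f i X - F X))\<^sup>2) - 0) < e"
        using \<open>0 < e\<close> by (simp add: integral_nonneg_AE)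
    qed
  qed
  then show ?thesis using f FL by (auto simp: L2_tendsto_iff)
qed

section \<open>Averages over small balls\<close>

text \<open>A one-sided differentiation theorem by Vitali covering. A set on which g stays below c
  is filled, up to a null set, by disjoint good balls inside a slightly larger open set; the
  integral of g - c over these balls is nonnegative, which contradicts its sign on the set unless
  the set is null. Good radii need only be arbitrarily small.\<close>

lemma AE_ge_of_ball_averages:
  fixes g :: "'a::euclidean_space \<Rightarrow> real"
  assumes g: "integrable lebesgue g" and S: "S \<in> sets lebesgue"
    and avg: "\<And>X e. X \<in> S \<Longrightarrow> 0 < e \<Longrightarrow>
      \<exists>d. 0 < d \<and> d < e \<and> c * measure lebesgue (ball X d) \<le> (LINT Y:ball X d|lebesgue. g Y)"
  shows "AE X in lebesgue. X \<in> S \<longrightarrow> c \<le> g X"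
proof -
  have gm [measurable]: "g \<in> borel_measurable lebesgue" using g by simp
  \<comment> \<open>The window of radius n makes the measure finite, and the gap 1 / (n + 1) makes
    the integral of g - c over a non-null piece strictly negative.\<close>
  define E where "E n = {X \<in> S \<inter> ball 0 (real n). g X \<le> c - 1 / (real n + 1)}" for n
  have Em [measurable]: "E n \<in> sets lebesgue" for n
  proof -
    have "{X \<in> space lebesgue. g X \<le> c - 1 / (real n + 1)} \<in> sets lebesgue" by measurable
    then have "S \<inter> ball 0 (real n) \<inter> {X. g X \<le> c - 1 / (real n + 1)} \<in> sets lebesgue"
      using S by (intro sets.Int) auto
    then show ?thesis by (simp add: E_def Int_def conj_assoc)
  qed
  have null: "E n \<in> null_sets lebesgue" for n
  proof -
    define D where "D = ball (0::'a) (real n)"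
    define w where "w Y = indicator D Y * (g Y - c)" for Y
    have Dm: "D \<in> lmeasurable" by (simp add: D_def)
    have w: "integrable lebesgue w"
    proof -
      have i: "integrable lebesgue (\<lambda>Y. g Y * indicator D Y)"
        using Dm g by (intro integrable_real_mult_indicator) auto
      have "integrable lebesgue (\<lambda>Y. c * indicator D Y)"
        using Dm by (intro integrable_mult_right integrable_real_indicator) (auto simp: fmeasurable_def)
      from Bochner_Integration.integrable_diff[OF i this] show ?thesis
        by (rule back_subst[where P = "integrable lebesgue"])
           (simp add: w_def[abs_def] fun_eq_iff algebra_simps)
    qed
    \<comment> \<open>A G-delta hull equal to \<open>E n\<close> up to the null set T: the open sets
      \<open>U j\<close> defined below decrease to \<open>E n\<close> modulo T.\<close>
    obtain C T where C: "gdelta C" "T \<in> null_sets lebesgue" "E n \<union> T = C" "disjnt (E n) T"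
      using lebesgue_set_almost_gdelta[OF Em] by blast
    from C(1) obtain F where F: "\<And>i :: nat. open (F i)" "C = \<Inter> (range F)"
      by (cases rule: gdelta.cases) auto
    define U where "U j = D \<inter> (\<Inter>i\<le>j. F i)" for j
    have U: "open (U j)" "E n \<subseteq> U j" "U j \<subseteq> D" for j
      using F C(3) by (auto simp: U_def D_def E_def intro!: open_Int open_INT)
    have EL: "E n \<in> lmeasurable"
      using fmeasurableI2[OF Dm _ Em] U(2,3) by blast
    have wE: "integrable lebesgue (\<lambda>Y. indicator (E n) Y * w Y)"
      and wU: "integrable lebesgue (\<lambda>Y. indicator (U j - E n) Y * \<bar>w Y\<bar>)" for j
    proof -
      have "U j - E n \<in> sets lebesgue" using U(1)[of j] by (intro sets.Diff Em) auto
      then show "integrable lebesgue (\<lambda>Y. indicator (U j - E n) Y * \<bar>w Y\<bar>)"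
        using w integrable_real_mult_indicator[of "U j - E n" lebesgue "\<lambda>Y. \<bar>w Y\<bar>"]
        by (simp add: mult.commute)
    qed (use w integrable_real_mult_indicator[of "E n" lebesgue w] in \<open>auto simp: mult.commute\<close>)
    have claim: "0 \<le> (LINT Y|lebesgue. indicator (E n) Y * w Y)
      + (LINT Y|lebesgue. indicator (U j - E n) Y * \<bar>w Y\<bar>)" for j
    proof -
      define K where "K = {(X, d). X \<in> S \<and> 0 < d \<and> ball X d \<subseteq> U j \<and>
        c * measure lebesgue (ball X d) \<le> (LINT Y:ball X d|lebesgue. g Y)}"
      have "\<exists>i. i \<in> K \<and> X \<in> ball (fst i) (snd i) \<and> snd i < e" if X: "X \<in> E n" and "0 < e" for X e
      proof -
        obtain e' where e': "0 < e'" "ball X e' \<subseteq> U j"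
          using U(1,2)[of j] X by (meson openE subsetD)
        obtain d where d: "0 < d" "d < min e e'"
          "c * measure lebesgue (ball X d) \<le> (LINT Y:ball X d|lebesgue. g Y)"
          using avg[of X "min e e'"] X e' \<open>0 < e\<close> by (auto simp: E_def)
        moreover have "ball X d \<subseteq> U j" using d(2) e'(2) subset_ball[of d e' X] by auto
        ultimately show ?thesis using X by (intro exI[of _ "(X, d)"]) (auto simp: K_def E_def)
      qed
      then obtain I where I: "countable I" "I \<subseteq> K"
        "pairwise (\<lambda>i k. disjnt (ball (fst i) (snd i)) (ball (fst k) (snd k))) I"
        "negligible (E n - (\<Union>i\<in>I. ball (fst i) (snd i)))"
        by (rule Vitali_covering_theorem_balls)
      define V where "V = (\<Union>i\<in>I. ball (fst i) (snd i))"
      have V: "open V" "V \<subseteq> U j"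
      proof -
        show "open V" by (auto simp: V_def)
        show "V \<subseteq> U j"
          unfolding V_def
        proof (rule UN_least)
          fix i assume "i \<in> I"
          with I(2) have "i \<in> K" by blast
          then show "ball (fst i) (snd i) \<subseteq> U j" by (auto simp only: K_def mem_Collect_eq split_beta)
        qed
      qed
      \<comment> \<open>The disjoint balls are listed through an injection of \<open>I\<close> into
        the naturals; \<open>A m\<close> is empty when no ball has number m, so finite and infinite
        families are treated alike.\<close>
      define A where "A m = (\<Union>i\<in>{i \<in> I. to_nat_on I i = m}. ball (fst i) (snd i))" for m
      have VA: "V = (\<Union>m. A m)" by (auto simp: V_def A_def)
      have inj: "inj_on (to_nat_on I) I" using I(1) by (rule inj_on_to_nat_on)
      have Am: "A m = {} \<or> (\<exists>i\<in>I. A m = ball (fst i) (snd i))" for m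
      proof (cases "\<exists>i\<in>I. to_nat_on I i = m")
        case True
        then obtain i where "i \<in> I" "to_nat_on I i = m" by blast
        then have "{i \<in> I. to_nat_on I i = m} = {i}" using inj by (auto dest: inj_onD)
        then show ?thesis using \<open>i \<in> I\<close> by (auto simp: A_def)
      qed (auto simp: A_def)
      have wset: "set_integrable lebesgue T w" if "open T" for T
        unfolding set_integrable_def using w that by (intro integrable_mult_indicator) auto
      have Ao: "open (A m)" for m by (auto simp: A_def)
      have Ad: "A m \<inter> A k = {}" if "m \<noteq> k" for m k
        using I(3) that by (fastforce simp: A_def pairwise_def disjnt_def)
      have A0: "0 \<le> (LINT Y:A m|lebesgue. w Y)" for m
        using Am[of m]
      proof
        assume "\<exists>i\<in>I. A m = ball (fst i) (snd i)"
        then obtain X d where i: "(X, d) \<in> I" "A m = ball X d" by auto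
        then have Xd: "ball X d \<subseteq> D" "c * measure lebesgue (ball X d) \<le> (LINT Y:ball X d|lebesgue. g Y)"
        proof -
          have "(X, d) \<in> K" using i I(2) by blast
          then have "ball X d \<subseteq> U j \<and> c * measure lebesgue (ball X d) \<le> (LINT Y:ball X d|lebesgue. g Y)"
            by (simp only: K_def mem_Collect_eq split_conv)
          with U(3)[of j] show "ball X d \<subseteq> D" "c * measure lebesgue (ball X d) \<le> (LINT Y:ball X d|lebesgue. g Y)"
            by blast+
        qed
        have "(LINT Y:ball X d|lebesgue. w Y) = (LINT Y:ball X d|lebesgue. g Y - c)"
          using Xd(1) by (intro set_lebesgue_integral_cong) (auto simp: w_def)
        also have "\<dots> = (LINT Y:ball X d|lebesgue. g Y) - (LINT Y:ball X d|lebesgue. c)"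
          by (intro set_integral_diff) (auto simp: set_integrable_def
              intro!: integrable_mult_indicator[OF _ g, simplified] integrable_mult_left integrable_real_indicator
              simp: emeasure_bounded_finite[unfolded infinity_ennreal_def])
        also have "(LINT Y:ball X d|lebesgue. c) = c * measure lebesgue (ball X d)"
          by (simp add: set_lebesgue_integral_def)
        finally show ?thesis using Xd(2) i(2) by simp
      qed (simp add: set_lebesgue_integral_def)
      have P0: "0 \<le> (LINT Y:(\<Union>i<m. A i)|lebesgue. w Y)" for m
      proof (induction m)
        case (Suc m)
        have "(LINT Y:(\<Union>i<m. A i) \<union> A m|lebesgue. w Y)
          = (LINT Y:(\<Union>i<m. A i)|lebesgue. w Y) + (LINT Y:A m|lebesgue. w Y)"
        proof (rule set_integral_Un)
          show "(\<Union>i<m. A i) \<inter> A m = {}"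
          proof -
            have "A i \<inter> A m = {}" if "i < m" for i using Ad that by simp
            then show ?thesis by blast
          qed
          show "set_integrable lebesgue (\<Union>i<m. A i) w" by (rule wset) (simp add: Ao open_UN)
          show "set_integrable lebesgue (A m) w" by (rule wset[OF Ao])
        qed
        then show ?case using Suc A0[of m] by (simp add: lessThan_Suc Un_commute)
      qed (simp add: set_lebesgue_integral_def)
      have VP: "V = (\<Union>m. \<Union>i<m. A i)" by (auto simp: VA)
      have "(\<lambda>m. LINT Y:(\<Union>i<m. A i)|lebesgue. w Y) \<longlonglongrightarrow> (LINT Y:V|lebesgue. w Y)"
        unfolding VP using wset[OF V(1)] Ao
        by (intro set_integral_cont_up) (auto simp: VP[symmetric] incseq_def intro: less_le_trans)
      then have "0 \<le> (LINT Y:V|lebesgue. w Y)"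
        using P0 by (intro LIMSEQ_le_const) auto
      also have "\<dots> = (LINT Y|lebesgue. indicator V Y * w Y)"
        by (simp add: set_lebesgue_integral_def)
      \<comment> \<open>V misses only a null part of \<open>E n\<close> and stays in
        \<open>U j\<close>, so its excess costs at most the integral of |w| over
        \<open>U j - E n\<close>, which tends to 0 with j.\<close>
      also have "\<dots> \<le> (LINT Y|lebesgue. indicator (E n) Y * w Y + indicator (U j - E n) Y * \<bar>w Y\<bar>)"
      proof (rule integral_mono_AE)
        show "integrable lebesgue (\<lambda>Y. indicator V Y * w Y)"
          using w V(1) integrable_real_mult_indicator[of V lebesgue w] by (auto simp: mult.commute)
        show "integrable lebesgue (\<lambda>Y. indicator (E n) Y * w Y + indicator (U j - E n) Y * \<bar>w Y\<bar>)"
          using wE wU by simp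
        have "E n - V \<in> null_sets lebesgue" using I(4) by (simp add: V_def negligible_iff_null_sets)
        then have "AE Y in lebesgue. Y \<notin> E n - V" by (rule AE_not_in)
        then show "AE Y in lebesgue. indicator V Y * w Y \<le> indicator (E n) Y * w Y + indicator (U j - E n) Y * \<bar>w Y\<bar>"
          by eventually_elim (use V(2) in \<open>auto simp: indicator_def\<close>)
      qed
      also have "\<dots> = (LINT Y|lebesgue. indicator (E n) Y * w Y) + (LINT Y|lebesgue. indicator (U j - E n) Y * \<bar>w Y\<bar>)"
        using wE wU by simp
      finally show ?thesis .
    qed
    have "(\<lambda>j. LINT Y|lebesgue. indicator (U j - E n) Y * \<bar>w Y\<bar>) \<longlonglongrightarrow> (LINT Y|(lebesgue :: 'a measure). 0)"
    proof (rule integral_dominated_convergence[where w = "\<lambda>Y. \<bar>w Y\<bar>"])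
      show "(\<lambda>Y. indicator (U j - E n) Y * \<bar>w Y\<bar>) \<in> borel_measurable lebesgue" for j
        using wU by simp
      have "AE Y in lebesgue. Y \<notin> T" using C(2) by (rule AE_not_in)
      then show "AE Y in lebesgue. (\<lambda>j. indicator (U j - E n) Y * \<bar>w Y\<bar>) \<longlonglongrightarrow> 0"
      proof eventually_elim
        case (elim Y)
        show ?case
        proof (cases "Y \<in> E n")
          case False
          then obtain i where i: "Y \<notin> F i" using elim C(3) F(2) by auto
          have "\<forall>\<^sub>F j in sequentially. indicator (U j - E n) Y * \<bar>w Y\<bar> = 0"
            using eventually_ge_at_top[of i] by eventually_elim (use i in \<open>auto simp: U_def indicator_def\<close>)
          then show ?thesis by (rule tendsto_eventually)
        qed simp
      qed
    qed (use w in \<open>auto simp: indicator_def\<close>)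
    then have "0 \<le> (LINT Y|lebesgue. indicator (E n) Y * w Y)"
      using tendsto_add[OF tendsto_const[of "LINT Y|lebesgue. indicator (E n) Y * w Y"]] claim
      by (intro LIMSEQ_le_const[where X = "\<lambda>j. (LINT Y|lebesgue. indicator (E n) Y * w Y) +
          (LINT Y|lebesgue. indicator (U j - E n) Y * \<bar>w Y\<bar>)"]) fastforce+
    also have "\<dots> \<le> (LINT Y|lebesgue. indicator (E n) Y * (- (1 / (real n + 1))))"
    proof (rule integral_mono[OF wE])
      show "integrable lebesgue (\<lambda>Y. indicator (E n) Y * (- (1 / (real n + 1))))"
        using EL by (intro integrable_mult_left integrable_real_indicator) (auto simp: fmeasurable_def)
      show "indicator (E n) Y * w Y \<le> indicator (E n) Y * (- (1 / (real n + 1)))" for Y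
        by (auto simp: E_def w_def D_def indicator_def)
    qed
    also have "\<dots> = - (1 / (real n + 1)) * measure lebesgue (E n)" by simp
    finally have "measure lebesgue (E n) \<le> 0" by (simp add: field_simps)
    then have "measure lebesgue (E n) = 0" by (simp add: order_antisym)
    then show ?thesis
      using EL by (simp add: null_sets_def fmeasurable_def emeasure_eq_ennreal_measure)
  qed
  have "AE X in lebesgue. \<forall>n. X \<notin> E n"
    unfolding AE_all_countable using null by (auto intro: AE_not_in)
  then show ?thesis
  proof eventually_elim
    case (elim X)
    show ?case
    proof (rule impI, rule ccontr)
      assume X: "X \<in> S" and "\<not> c \<le> g X"
      obtain n1 where n1: "norm X < real n1" using reals_Archimedean2 by blast
      obtain n2 where n2: "inverse (real (Suc n2)) < c - g X"
        using reals_Archimedean[of "c - g X"] \<open>\<not> c \<le> g X\<close> by auto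
      have "1 / (real (max n1 n2) + 1) \<le> inverse (real (Suc n2))"
        by (simp add: field_simps)
      with n1 n2 X have "X \<in> E (max n1 n2)" by (auto simp: E_def)
      with elim show False by blast
    qed
  qed
qed

section \<open>Integration by parts\<close>

text \<open>By translation invariance each difference quotient has integral zero, and the mean value
  theorem dominates the quotients. Differentiability is asked along b alone, so that functions rough
  in the other directions are covered.\<close>

lemma integral_directional_derivative_zero:
  fixes \<psi> \<psi>' :: "'a::euclidean_space \<Rightarrow> real"
  assumes cont: "continuous_on UNIV \<psi>" "continuous_on UNIV \<psi>'"
    and deriv: "\<And>X. ((\<lambda>t. \<psi> (X + t *\<^sub>R b)) has_real_derivative \<psi>' X) (at 0)"
    and bnd: "bounded {X. \<psi> X \<noteq> 0}"
  shows "(LINT X|lborel. \<psi>' X) = 0"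
proof -
  obtain R where R: "\<And>X. \<psi> X \<noteq> 0 \<Longrightarrow> norm X \<le> R" "0 < R"
    using bnd unfolding bounded_pos by auto
  define K where "K = cball (0::'a) (R + norm b)"
  have deriv_s: "((\<lambda>t. \<psi> (X + t *\<^sub>R b)) has_real_derivative \<psi>' (X + s *\<^sub>R b)) (at s)" for X s
    using deriv[of "X + s *\<^sub>R b"] DERIV_shift[of "\<lambda>t. \<psi> (X + t *\<^sub>R b)" _ 0 s]
    by (simp add: algebra_simps)
  have zero: "\<psi>' X = 0" if "R < norm X" for X
  proof -
    have "\<forall>\<^sub>F t in nhds 0. R < norm (X + t *\<^sub>R b)"
    proof -
      have "((\<lambda>t. norm (X + t *\<^sub>R b)) \<longlongrightarrow> norm (X + 0 *\<^sub>R b)) (nhds 0)"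
        by (intro tendsto_intros filterlim_ident)
      from order_tendstoD(1)[OF this] that show ?thesis by simp
    qed
    then have "\<forall>\<^sub>F t in nhds 0. \<psi> (X + t *\<^sub>R b) = 0"
      by eventually_elim (use R(1) leD in blast)
    then have "((\<lambda>t. \<psi> (X + t *\<^sub>R b)) has_real_derivative 0) (at 0)"
      by (subst DERIV_cong_ev[OF refl _ refl, where g = "\<lambda>_. 0"]) auto
    then show ?thesis using DERIV_unique[OF deriv] by blast
  qed
  have bounded_image: "\<exists>B. \<forall>X. norm X \<le> R \<longrightarrow> \<bar>h X\<bar> \<le> B"
    if "continuous_on UNIV h" for h :: "'a \<Rightarrow> real"
  proof -
    have "bounded (h ` cball 0 R)"
      using that by (intro compact_imp_bounded compact_continuous_image) (auto intro: continuous_on_subset)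
    then obtain B where "\<forall>y\<in>h ` cball 0 R. norm y \<le> B" unfolding bounded_iff by blast
    then show ?thesis by (intro exI[of _ B]) auto
  qed
  obtain B where B1: "\<And>X. norm X \<le> R \<Longrightarrow> \<bar>\<psi>' X\<bar> \<le> B"
    using bounded_image[OF cont(2)] by blast
  have B: "\<bar>\<psi>' X\<bar> \<le> max B 0" for X
    using zero[of X] B1[of X] by (cases "norm X \<le> R") auto
  define g where "g n X = (\<psi> (X + (1 / (real n + 1)) *\<^sub>R b) - \<psi> X) * (real n + 1)" for n X
  have [measurable]: "\<psi> \<in> borel_measurable borel" "\<psi>' \<in> borel_measurable borel"
    using cont by (auto intro: borel_measurable_continuous_onI)
  have gb: "\<bar>g n X\<bar> \<le> indicator K X * max B 0" for n X
  proof (cases "X \<in> K")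
    case True
    define h where "h = 1 / (real n + 1)"
    have h: "0 < h" by (simp add: h_def)
    obtain z where "\<psi> (X + h *\<^sub>R b) - \<psi> (X + 0 *\<^sub>R b) = (h - 0) * \<psi>' (X + z *\<^sub>R b)"
      using MVT2[OF h, of "\<lambda>t. \<psi> (X + t *\<^sub>R b)" "\<lambda>s. \<psi>' (X + s *\<^sub>R b)"] deriv_s by blast
    then have "g n X = \<psi>' (X + z *\<^sub>R b)"
      unfolding g_def h_def by (simp add: field_simps)
    then show ?thesis using B True by simp
  next
    case False
    have "norm ((1 / (real n + 1)) *\<^sub>R b) \<le> norm b"
      by (simp add: field_simps)
    moreover have "R + norm b < norm X" using False by (simp add: K_def)
    moreover have "norm X - norm ((1 / (real n + 1)) *\<^sub>R b) \<le> norm (X + (1 / (real n + 1)) *\<^sub>R b)"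
      by (rule norm_diff_ineq)
    ultimately have "R < norm (X + (1 / (real n + 1)) *\<^sub>R b)" "R < norm X"
      using norm_ge_zero[of b] by linarith+
    then have "g n X = 0" unfolding g_def using R(1) by (metis diff_self leD mult_zero_left)
    then show ?thesis using False by simp
  qed
  have lim: "(\<lambda>n. g n X) \<longlonglongrightarrow> \<psi>' X" for X
  proof -
    have "((\<lambda>t. (\<psi> (X + t *\<^sub>R b) - \<psi> X) / t) \<longlongrightarrow> \<psi>' X) (at 0)"
      using deriv[of X] by (simp add: has_field_derivative_iff)
    moreover have "filterlim (\<lambda>n. 1 / (real n + 1)) (at 0) sequentially"
      unfolding filterlim_at using lim_1_over_n LIMSEQ_inverse_real_of_nat
      by (auto simp: inverse_eq_divide add.commute)
    ultimately have "(\<lambda>n. (\<psi> (X + (1 / (real n + 1)) *\<^sub>R b) - \<psi> X) / (1 / (real n + 1))) \<longlonglongrightarrow> \<psi>' X"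
      by (rule filterlim_compose)
    then show ?thesis by (simp add: g_def)
  qed
  have Kint: "integrable lborel (\<lambda>X. indicator K X * max B 0)"
    unfolding K_def by (intro integrable_mult_left integrable_real_indicator) (auto simp: emeasure_bounded_finite[unfolded infinity_ennreal_def])
  have "(\<lambda>n. LINT X|lborel. g n X) \<longlonglongrightarrow> (LINT X|lborel. \<psi>' X)"
    by (rule integral_dominated_convergence[OF _ _ Kint])
       (use lim gb in \<open>auto simp: g_def[abs_def]\<close>)
  moreover have "(LINT X|lborel. g n X) = 0" for n
  proof -
    obtain B' where B1': "\<And>X. norm X \<le> R \<Longrightarrow> \<bar>\<psi> X\<bar> \<le> B'"
      using bounded_image[OF cont(1)] by blast
    have B': "\<bar>\<psi> X\<bar> \<le> indicator (cball 0 R) X * max B' 0" for X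
      using R(1)[of X] B1'[of X] by (cases "norm X \<le> R") auto
    have "integrable lborel (\<lambda>X. indicator (cball (0::'a) R) X * max B' 0)"
      by (intro integrable_mult_left integrable_real_indicator) (auto simp: emeasure_bounded_finite[unfolded infinity_ennreal_def])
    then have i: "integrable lborel \<psi>"
      by (rule Bochner_Integration.integrable_bound) (use B' in auto)
    define h where "h = (1 / (real n + 1)) *\<^sub>R b"
    have "integrable (distr lborel borel ((+) h)) \<psi>"
      using i by (simp add: lborel_distr_plus)
    then have i2: "integrable lborel (\<lambda>X. \<psi> (X + h))"
      by (subst (asm) integrable_distr_eq) (auto simp: add.commute)
    have "(LINT X|lborel. \<psi> X) = (LINT X|distr lborel borel ((+) h). \<psi> X)"
      by (simp add: lborel_distr_plus)
    also have "\<dots> = (LINT X|lborel. \<psi> (X + h))"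
      by (subst integral_distr) (auto simp: add.commute)
    finally show ?thesis
      using i i2 unfolding g_def h_def[symmetric] by simp
  qed
  ultimately show ?thesis by (simp add: LIMSEQ_const_iff)
qed

section \<open>Gradients of compactly supported C1 functions\<close>

lemma has_derivative_grad:
  fixes f :: "'a::euclidean_space \<Rightarrow> real"
  assumes "f differentiable (at X)"
  shows "(f has_derivative (\<lambda>v. grad f X \<bullet> v)) (at X)"
proof -
  have D: "(f has_derivative frechet_derivative f (at X)) (at X)"
    using assms by (simp add: frechet_derivative_works)
  then interpret bounded_linear "frechet_derivative f (at X)" by (rule has_derivative_bounded_linear)
  have "frechet_derivative f (at X) v = grad f X \<bullet> v" for v
  proof -
    have "frechet_derivative f (at X) v = frechet_derivative f (at X) (\<Sum>b\<in>Basis. (v \<bullet> b) *\<^sub>R b)"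
      by (simp add: euclidean_representation)
    also have "\<dots> = grad f X \<bullet> v"
      by (simp add: sum scaleR grad_def inner_sum_left inner_commute mult.commute inner_sum_right)
    finally show ?thesis .
  qed
  with D show ?thesis by (metis ext)
qed

lemma grad_eqI:
  fixes f :: "'a::euclidean_space \<Rightarrow> real"
  assumes "(f has_derivative (\<lambda>v. w \<bullet> v)) (at X)"
  shows "grad f X = w"
proof -
  have "frechet_derivative f (at X) = (\<lambda>v. w \<bullet> v)"
    using frechet_derivative_at[OF assms] by simp
  then show ?thesis by (simp add: grad_def euclidean_representation)
qed

lemma grad_diff:
  assumes "f differentiable (at X)" "g differentiable (at X)"
  shows "grad (\<lambda>X. f X - g X) X = grad f X - grad g X"
  by (rule grad_eqI)
     (auto intro!: derivative_eq_intros has_derivative_grad assms simp: inner_diff_left)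

lemma C1_0D:
  assumes "f \<in> C1_0 \<Omega>"
  shows "f differentiable (at X)" "continuous_on UNIV (grad f)" "continuous_on UNIV f"
    "bounded {X. f X \<noteq> 0}" "{X. f X \<noteq> 0} \<subseteq> \<Omega>"
proof -
  have d: "f differentiable (at X)" for X using assms by (simp add: C1_0_def)
  then show "f differentiable (at X)" .
  show "continuous_on UNIV f"
    using d by (auto simp: continuous_on_eq_continuous_at intro: differentiable_imp_continuous_within)
qed (use assms closure_subset[of "{X. f X \<noteq> 0}"] in
      \<open>auto simp: C1_0_def dest: compact_imp_bounded intro: bounded_subset\<close>)

lemma C1_0_grad_zero:
  assumes "f \<in> C1_0 \<Omega>" "X \<notin> \<Omega>"
  shows "grad f X = 0"
proof (rule grad_eqI)
  have "X \<in> - closure {X. f X \<noteq> 0}" "open (- closure {X. f X \<noteq> 0})"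
    using assms by (auto simp: C1_0_def)
  moreover have "f Y = 0" if "Y \<in> - closure {X. f X \<noteq> 0}" for Y
    using that closure_subset[of "{X. f X \<noteq> 0}"] by blast
  ultimately have "(f has_derivative (\<lambda>v. 0)) (at X)"
    using has_derivative_transform_within_open[OF has_derivative_const] by metis
  then show "(f has_derivative (\<lambda>v. 0 \<bullet> v)) (at X)" by simp
qed

text \<open>The compact support of f is enough for the boundary term to vanish, and g is
  differentiated along b only. A factor of g that is constant along b, such as |x|^lam for a
  y-direction b, may thus be merely continuous.\<close>

lemma C1_0_by_parts:
  fixes g g' :: "'a::euclidean_space \<Rightarrow> real"
  assumes \<Omega>: "open \<Omega>" and f: "f \<in> C1_0 \<Omega>"
    and g: "continuous_on UNIV g" "continuous_on UNIV g'"
    and deriv: "\<And>X. ((\<lambda>t. g (X + t *\<^sub>R b)) has_real_derivative g' X) (at 0)"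
  shows "(LINT X|lebesgue_on \<Omega>. (grad f X \<bullet> b) * g X) = - (LINT X|lebesgue_on \<Omega>. f X * g' X)"
proof -
  note fD = C1_0D[OF f]
  have fd: "((\<lambda>t. f (X + t *\<^sub>R b)) has_real_derivative (grad f X \<bullet> b)) (at 0)" for X
  proof -
    have "(f has_derivative (\<lambda>v. grad f X \<bullet> v)) (at (X + 0 *\<^sub>R b))"
      using has_derivative_grad[OF fD(1)] by simp
    then have "((\<lambda>t. f (X + t *\<^sub>R b)) has_derivative (\<lambda>t. grad f X \<bullet> (t *\<^sub>R b))) (at 0)"
      by (rule has_derivative_compose[rotated]) (auto intro!: derivative_eq_intros)
    then show ?thesis by (simp add: has_field_derivative_def mult_commute_abs)
  qed
  define p where "p X = (grad f X \<bullet> b) * g X" for X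
  define q where "q X = f X * g' X" for X
  have pc: "continuous_on UNIV p" and qc: "continuous_on UNIV q"
    unfolding p_def q_def using g fD by (auto intro!: continuous_intros)
  have z: "(LINT X|lborel. p X + q X) = 0"
  proof (rule integral_directional_derivative_zero)
    show "continuous_on UNIV (\<lambda>X. f X * g X)" "continuous_on UNIV (\<lambda>X. p X + q X)"
      using pc qc g fD by (auto intro!: continuous_intros)
    show "((\<lambda>t. f (X + t *\<^sub>R b) * g (X + t *\<^sub>R b)) has_real_derivative p X + q X) (at 0)" for X
      using DERIV_mult[OF fd deriv, of X] by (simp add: p_def q_def algebra_simps)
    show "bounded {X. f X * g X \<noteq> 0}"
      using fD(4) by (rule bounded_subset) auto
  qed
  have gen: "integrable lborel h \<and> (LINT X|lebesgue_on \<Omega>. h X) = (LINT X|lborel. h X)"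
    if h: "continuous_on UNIV h" "\<And>X. X \<notin> closure {X. f X \<noteq> 0} \<Longrightarrow> h X = 0" for h :: "'a \<Rightarrow> real"
  proof -
    have K: "compact (closure {X. f X \<noteq> 0})" "closure {X. f X \<noteq> 0} \<subseteq> \<Omega>"
      using f by (auto simp: C1_0_def)
    have hb: "h \<in> borel_measurable borel" using h(1) by (rule borel_measurable_continuous_onI)
    have "(\<lambda>X. indicator (closure {X. f X \<noteq> 0}) X *\<^sub>R h X) = h"
      using h(2) by (intro ext) (simp split: split_indicator)
    moreover have "integrable lborel (\<lambda>X. indicator (closure {X. f X \<noteq> 0}) X *\<^sub>R h X)"
      using borel_integrable_compact[OF K(1), of h] h(1)
      by (auto simp: indicator_def if_distrib cong: if_cong intro: continuous_on_subset)
    ultimately have i: "integrable lborel h" by metis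
    have "(LINT X|lebesgue_on \<Omega>. h X) = (LINT X|lebesgue. indicator \<Omega> X *\<^sub>R h X)"
      using \<Omega> by (intro integral_restrict_space) auto
    also have "\<dots> = (LINT X|lebesgue. h X)"
      using h(2) K(2) by (intro Bochner_Integration.integral_cong) (auto simp: indicator_def)
    also have "\<dots> = (LINT X|lborel. h X)"
      using hb by (intro integral_completion) auto
    finally show ?thesis using i by simp
  qed
  have p0: "p X = 0" and q0: "q X = 0" if "X \<notin> closure {X. f X \<noteq> 0}" for X
  proof -
    have "f \<in> C1_0 (closure {X. f X \<noteq> 0})" using f by (simp add: C1_0_def)
    from C1_0_grad_zero[OF this that] show "p X = 0" by (simp add: p_def)
    show "q X = 0" using that closure_subset[of "{X. f X \<noteq> 0}"] by (auto simp: q_def)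
  qed
  from gen[OF pc p0] gen[OF qc q0] z show ?thesis
    unfolding p_def q_def by simp
qed

section \<open>A smooth truncation\<close>

text \<open>A C1 substitute for the positive part, positive exactly for s > 0. Being C1 it keeps
  test functions in \<open>C1_0\<close>; being bounded with bounded derivative it passes to L2
  limits.\<close>

definition smooth_pos :: "real \<Rightarrow> real" where
  "smooth_pos s = (max s 0)\<^sup>2 / (1 + (max s 0)\<^sup>2)"

definition smooth_pos' :: "real \<Rightarrow> real" where
  "smooth_pos' s = 2 * max s 0 / (1 + (max s 0)\<^sup>2)\<^sup>2"

lemma max_square_deriv: "((\<lambda>s::real. (max s 0)\<^sup>2) has_real_derivative 2 * max s 0) (at s)"
proof -
  consider "0 < s" | "s < 0" | "s = 0" by linarith
  then show ?thesis
  proof cases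
    case 1
    have "((\<lambda>s::real. s\<^sup>2) has_real_derivative 2 * s) (at s)"
      by (auto intro!: derivative_eq_intros)
    then have "((\<lambda>s::real. (max s 0)\<^sup>2) has_real_derivative 2 * s) (at s)"
      by (rule has_field_derivative_transform_within_open[where S = "{0<..}"]) (use 1 in auto)
    with 1 show ?thesis by simp
  next
    case 2
    have "((\<lambda>s::real. 0) has_real_derivative 0) (at s)" by simp
    then have "((\<lambda>s::real. (max s 0)\<^sup>2) has_real_derivative 0) (at s)"
      by (rule has_field_derivative_transform_within_open[where S = "{..<0}"]) (use 2 in auto)
    with 2 show ?thesis by simp
  next
    case 3
    have "((\<lambda>h::real. ((max (0 + h) 0)\<^sup>2 - (max 0 0)\<^sup>2) / h) \<longlongrightarrow> 0) (at 0)"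
    proof (rule Lim_null_comparison)
      show "\<forall>\<^sub>F h in at 0. norm (((max (0 + h) 0)\<^sup>2 - (max 0 0)\<^sup>2) / h) \<le> \<bar>h\<bar>"
        by (rule always_eventually) (auto simp: max_def power2_eq_square)
      show "(abs \<longlongrightarrow> (0::real)) (at 0)"
        using tendsto_rabs[OF tendsto_ident_at, of "0::real" UNIV] by simp
    qed
    then show ?thesis using 3 by (simp add: has_field_derivative_iff)
  qed
qed

lemma smooth_pos_deriv: "(smooth_pos has_real_derivative smooth_pos' s) (at s)"
proof -
  have nz: "1 + (max s 0)\<^sup>2 \<noteq> 0" by (smt (verit) zero_le_power2)
  show ?thesis
    unfolding smooth_pos_def[abs_def] smooth_pos'_def
    by (rule DERIV_cong[OF DERIV_divide[OF max_square_deriv DERIV_add[OF DERIV_const max_square_deriv] nz]])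
       (simp add: power2_eq_square algebra_simps)
qed

lemma smooth_pos_nonneg: "0 \<le> smooth_pos s" and smooth_pos_le_1: "smooth_pos s \<le> 1"
  and smooth_pos_eq_0: "smooth_pos s = 0 \<longleftrightarrow> s \<le> 0" and smooth_pos'_nonneg: "0 \<le> smooth_pos' s" and smooth_pos'_eq_0: "smooth_pos' s = 0 \<longleftrightarrow> s \<le> 0"
proof -
  have p: "0 < 1 + (max s 0)\<^sup>2" by (smt (verit) zero_le_power2)
  show "0 \<le> smooth_pos s" using p by (simp add: smooth_pos_def)
  show "smooth_pos s \<le> 1" using p by (simp add: smooth_pos_def)
  show "smooth_pos s = 0 \<longleftrightarrow> s \<le> 0" using p by (auto simp: smooth_pos_def max_def)
  show "0 \<le> smooth_pos' s" by (simp add: smooth_pos'_def)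
  show "smooth_pos' s = 0 \<longleftrightarrow> s \<le> 0" using p by (auto simp: smooth_pos'_def max_def)
qed

lemma smooth_pos'_le_2: "smooth_pos' s \<le> 2"
proof -
  define m where "m = max s 0"
  have m: "0 \<le> m" by (simp add: m_def)
  have "2 * m \<le> 1 + m\<^sup>2" using zero_le_power2[of "m - 1"] by (simp add: power2_eq_square algebra_simps)
  also have "\<dots> \<le> 2 * (1 + m\<^sup>2)\<^sup>2"
    using self_le_power[of "1 + m\<^sup>2" 2] zero_le_power2[of m] by linarith
  finally have "2 * m \<le> 2 * (1 + m\<^sup>2)\<^sup>2" .
  moreover have "0 < (1 + m\<^sup>2)\<^sup>2" by (intro zero_less_power) (simp add: add_pos_nonneg)
  ultimately show ?thesis
    unfolding smooth_pos'_def m_def[symmetric] by (simp add: divide_le_eq)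
qed

lemma continuous_on_smooth_pos: "continuous_on UNIV smooth_pos"
  using smooth_pos_deriv by (auto intro!: continuous_at_imp_continuous_on DERIV_isCont)

lemma continuous_on_smooth_pos': "continuous_on UNIV smooth_pos'"
proof -
  have "1 + (max s 0)\<^sup>2 \<noteq> 0" for s :: real by (smt (verit) zero_le_power2)
  then show ?thesis
    unfolding smooth_pos'_def[abs_def] by (intro continuous_intros) auto
qed

lemma smooth_pos_Lipschitz: "\<bar>smooth_pos a - smooth_pos b\<bar> \<le> 2 * \<bar>a - b\<bar>"
proof -
  have "\<bar>smooth_pos y - smooth_pos x\<bar> \<le> 2 * \<bar>y - x\<bar>" if xy: "x < y" for x y
  proof -
    obtain z where "smooth_pos y - smooth_pos x = (y - x) * smooth_pos' z"
      using MVT2[OF xy, of smooth_pos smooth_pos'] smooth_pos_deriv by blast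
    then show ?thesis
      using xy mult_right_mono[OF smooth_pos'_le_2[of z], of "y - x"] smooth_pos'_nonneg[of z]
      by (simp add: abs_mult mult.commute)
  qed
  from this[of a b] this[of b a] show ?thesis
    by (cases a b rule: linorder_cases) (simp_all add: abs_minus_commute)
qed


section \<open>The Grushin matrix and quasi-gradients\<close>

definition grushin_weight :: "real \<Rightarrow> 'm::finite point \<Rightarrow> 'm point \<Rightarrow> real" where
  "grushin_weight lam b X = (if fst b = 0 then \<bar>fst X\<bar> powr lam else 1)"

lemma grushin_weight_continuous: "0 < lam \<Longrightarrow> continuous_on UNIV (grushin_weight lam b)"
  by (cases "fst b = 0")
     (auto simp: grushin_weight_def[abs_def] intro!: continuous_intros continuous_on_powr')

text \<open>The weight of a y-derivative depends on x alone and the weight of the x-derivative is 1.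
  Each weighted field is therefore divergence free, and |x|^lam is never differentiated when
  integrating by parts.\<close>

lemma grushin_weight_shift:
  "b \<in> Basis \<Longrightarrow> grushin_weight lam b (X + t *\<^sub>R b) = grushin_weight lam b X"
  by (auto simp: grushin_weight_def)

lemma grushin_sqrtA_inner_Basis:
  "b \<in> Basis \<Longrightarrow> grushin_sqrtA lam X V \<bullet> b = grushin_weight lam b X * (V \<bullet> b)"
  by (auto simp: grushin_sqrtA_def grushin_weight_def Basis_prod_def inner_prod_def)

lemma grushin_sqrtA_diff: "grushin_sqrtA lam X (V - W) = grushin_sqrtA lam X V - grushin_sqrtA lam X W"
  and grushin_sqrtA_scale: "grushin_sqrtA lam X (c *\<^sub>R V) = c *\<^sub>R grushin_sqrtA lam X V"
  by (auto simp: grushin_sqrtA_def algebra_simps)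

lemma grushin_A_inner: "grushin_A lam X V \<bullet> W = grushin_sqrtA lam X V \<bullet> grushin_sqrtA lam X W"
  by (simp add: grushin_A_def grushin_sqrtA_def inner_prod_def flip: powr_add)

lemma continuous_on_grushin_sqrtA:
  assumes "0 < lam" "continuous_on UNIV F"
  shows "continuous_on UNIV (\<lambda>X. grushin_sqrtA lam X (F X))"
  unfolding grushin_sqrtA_def
  using assms by (auto intro!: continuous_intros continuous_on_powr')

text \<open>The squared norm of this vector is the energy density. Limits are taken of it and not of
  the gradient, because the inverse of sqrt A is unbounded near x = 0.\<close>

definition qgrad :: "real \<Rightarrow> ('m::finite point \<Rightarrow> real) \<Rightarrow> 'm point \<Rightarrow> 'm point" where
  "qgrad lam f X = grushin_sqrtA lam X (grad f X)"

lemma energy_norm_eq: "energy_norm lam \<Omega> f = L2_norm \<Omega> (qgrad lam f)"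
  by (simp add: energy_norm_def L2_norm_def grushin_A_inner qgrad_def power2_norm_eq_inner)

lemma qgrad_diff:
  assumes "f \<in> C1_0 \<Omega>" "g \<in> C1_0 \<Omega>"
  shows "qgrad lam (\<lambda>X. f X - g X) X = qgrad lam f X - qgrad lam g X"
  unfolding qgrad_def using grad_diff[OF C1_0D(1)[OF assms(1)] C1_0D(1)[OF assms(2)]]
  by (simp add: grushin_sqrtA_diff)

lemma C1_0_diff:
  assumes "f \<in> C1_0 \<Omega>" "g \<in> C1_0 \<Omega>"
  shows "(\<lambda>X. f X - g X) \<in> C1_0 \<Omega>"
proof -
  let ?F = "{X. f X \<noteq> 0}" and ?G = "{X. g X \<noteq> 0}" and ?H = "{X. f X - g X \<noteq> 0}"
  have s: "closure ?H \<subseteq> closure ?F \<union> closure ?G"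
    unfolding closure_Un[symmetric] by (rule closure_mono) auto
  have c: "compact (closure ?F \<union> closure ?G)" using assms by (auto simp: C1_0_def)
  have "compact (closure ?H)"
    using compact_Int_closed[OF c closed_closure[of ?H]] s by (simp add: inf.absorb2)
  moreover have "closure ?H \<subseteq> \<Omega>" using s assms by (auto simp: C1_0_def)
  moreover have "grad (\<lambda>X. f X - g X) = (\<lambda>X. grad f X - grad g X)"
    using grad_diff[OF C1_0D(1)[OF assms(1)] C1_0D(1)[OF assms(2)]] by auto
  ultimately show ?thesis
    using C1_0D[OF assms(1)] C1_0D[OF assms(2)]
    by (auto simp: C1_0_def intro!: continuous_intros differentiable_diff)
qed

section \<open>The completion and the closability of the quasi-gradient\<close>

locale grushin_domain =
  fixes lam :: real and \<Omega> :: "'m::finite point set"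
  assumes lam: "0 < lam" and open_\<Omega>: "open \<Omega>" and bounded_\<Omega>: "bounded \<Omega>"
begin

lemma lmeasurable_\<Omega>: "\<Omega> \<in> lmeasurable"
  using open_\<Omega> bounded_\<Omega> by (intro lmeasurable_open)

lemma qgrad_continuous: "f \<in> C1_0 \<Omega> \<Longrightarrow> continuous_on UNIV (qgrad lam f)"
  unfolding qgrad_def[abs_def] using lam C1_0D(2) by (intro continuous_on_grushin_sqrtA)

lemma qgrad_L2: "f \<in> C1_0 \<Omega> \<Longrightarrow> qgrad lam f \<in> L2_space \<Omega>"
  using qgrad_continuous by (intro continuous_L2_space open_\<Omega> bounded_\<Omega>)

text \<open>The limit U of the quasi-gradients is carried along explicitly, so that the choice
  hidden in \<open>quasi_grad\<close> has to be resolved only once.\<close>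

definition converges :: "(nat \<Rightarrow> 'm point \<Rightarrow> real) \<Rightarrow> ('m point \<Rightarrow> real) \<Rightarrow> ('m point \<Rightarrow> 'm point) \<Rightarrow> bool" where
  "converges \<phi> u U \<longleftrightarrow> (\<forall>n. \<phi> n \<in> C1_0 \<Omega>) \<and> L2_tendsto \<Omega> \<phi> u \<and> L2_tendsto \<Omega> (\<lambda>n. qgrad lam (\<phi> n)) U"

lemma converges_represents:
  assumes "converges \<phi> u U"
  shows "represents lam \<Omega> \<phi> u"
proof -
  have \<phi>: "\<And>n. \<phi> n \<in> C1_0 \<Omega>" and "L2_tendsto \<Omega> \<phi> u" and U: "L2_tendsto \<Omega> (\<lambda>n. qgrad lam (\<phi> n)) U"
    using assms by (auto simp: converges_def)
  moreover have "energy_norm lam \<Omega> (\<lambda>X. \<phi> i X - \<phi> j X) = L2_norm \<Omega> (\<lambda>X. qgrad lam (\<phi> i) X - qgrad lam (\<phi> j) X)" for i j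
    by (simp add: energy_norm_eq L2_norm_def qgrad_diff[OF \<phi> \<phi>])
  ultimately show ?thesis
    using L2_tendsto_imp_Cauchy[OF U] by (simp add: represents_def)
qed

lemma represents_converges:
  assumes "represents lam \<Omega> \<phi> u"
  shows "\<exists>U. converges \<phi> u U"
proof -
  have \<phi>: "\<And>n. \<phi> n \<in> C1_0 \<Omega>" using assms by (simp add: represents_def)
  have "energy_norm lam \<Omega> (\<lambda>X. \<phi> i X - \<phi> j X) = L2_norm \<Omega> (\<lambda>X. qgrad lam (\<phi> i) X - qgrad lam (\<phi> j) X)" for i j
    by (simp add: energy_norm_eq L2_norm_def qgrad_diff[OF \<phi> \<phi>])
  then have "\<exists>M. \<forall>i\<ge>M. \<forall>j\<ge>M. L2_norm \<Omega> (\<lambda>X. qgrad lam (\<phi> i) X - qgrad lam (\<phi> j) X) < e" if "0 < e" for e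
    using assms that by (simp add: represents_def)
  then have "\<exists>U. L2_tendsto \<Omega> (\<lambda>n. qgrad lam (\<phi> n)) U"
    by (rule L2_complete[OF lmeasurable_\<Omega> qgrad_L2[OF \<phi>]])
  then show ?thesis using assms \<phi> by (auto simp: converges_def represents_def)
qed

lemma qgrad_by_parts:
  assumes f: "f \<in> C1_0 \<Omega>" and b: "b \<in> Basis"
    and g: "continuous_on UNIV g" "continuous_on UNIV g'"
    and deriv: "\<And>X. ((\<lambda>t. g (X + t *\<^sub>R b)) has_real_derivative g' X) (at 0)"
  shows "(LINT X|lebesgue_on \<Omega>. (qgrad lam f X \<bullet> b) * g X)
    = - (LINT X|lebesgue_on \<Omega>. f X * (grushin_weight lam b X * g' X))"
proof -
  let ?w = "grushin_weight lam b"
  have "(LINT X|lebesgue_on \<Omega>. (qgrad lam f X \<bullet> b) * g X) = (LINT X|lebesgue_on \<Omega>. (grad f X \<bullet> b) * (?w X * g X))"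
    by (simp add: qgrad_def grushin_sqrtA_inner_Basis[OF b] mult_ac)
  also have "\<dots> = - (LINT X|lebesgue_on \<Omega>. f X * (?w X * g' X))"
  proof (rule C1_0_by_parts[OF open_\<Omega> f])
    show "continuous_on UNIV (\<lambda>X. ?w X * g X)" "continuous_on UNIV (\<lambda>X. ?w X * g' X)"
      using g lam by (auto intro!: continuous_intros grushin_weight_continuous)
    show "((\<lambda>t. ?w (X + t *\<^sub>R b) * g (X + t *\<^sub>R b)) has_real_derivative ?w X * g' X) (at 0)" for X
      unfolding grushin_weight_shift[OF b] using deriv by (rule DERIV_cmult)
  qed
  finally show ?thesis .
qed

text \<open>Closability. Integration by parts moves the derivative from \<zeta> to a fixed C1
  function, so W is orthogonal to all such functions; letting them tend to indicators of balls,
  every ball average of a component of W vanishes, and averages determine the function almost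
  everywhere.\<close>

lemma qgrad_limit_zero:
  assumes \<zeta>: "converges \<zeta> (\<lambda>_. 0) W"
  shows "AE X in lebesgue_on \<Omega>. W X = 0"
proof -
  have \<zeta>C: "\<And>n. \<zeta> n \<in> C1_0 \<Omega>" and \<zeta>0: "L2_tendsto \<Omega> \<zeta> (\<lambda>_. 0)" and \<zeta>W: "L2_tendsto \<Omega> (\<lambda>n. qgrad lam (\<zeta> n)) W"
    using \<zeta> by (auto simp: converges_def)
  have WL: "W \<in> L2_space \<Omega>" using \<zeta>W by (simp add: L2_tendsto_iff)
  have Wi: "integrable (lebesgue_on \<Omega>) (\<lambda>X. W X \<bullet> b)" for b
    using L2_space_imp_integrable[OF WL lmeasurable_\<Omega>] by (rule integrable_inner_left)
  define g where "g b X = indicator \<Omega> X * (W X \<bullet> b)" for b X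
  have gi: "integrable lebesgue (g b)" for b
    using Wi[of b] open_\<Omega> by (subst (asm) integrable_restrict_space) (auto simp: g_def[abs_def])
  have ball0: "(LINT Y:ball Z d|lebesgue. g b Y) = 0" if b: "b \<in> Basis" and d: "0 < d" for b Z d
  proof -
    \<comment> \<open>The bracket is positive exactly inside the ball; multiplied by n and passed
      through \<open>smooth_pos\<close> it tends pointwise to the indicator of the open
      ball.\<close>
    define s where "s n Y = real n * (d\<^sup>2 - (Y - Z) \<bullet> (Y - Z))" for n and Y :: "'m point"
    define h where "h n Y = smooth_pos (s n Y)" for n Y
    define h' where "h' n Y = smooth_pos' (s n Y) * (- 2 * real n * ((Y - Z) \<bullet> b))" for n Y
    have sc: "continuous_on UNIV (s n)" for n
      unfolding s_def[abs_def] by (intro continuous_intros)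
    have hc: "continuous_on UNIV (h n)" "continuous_on UNIV (h' n)" for n
      unfolding h_def[abs_def] h'_def[abs_def]
      by (intro continuous_intros continuous_on_compose2[OF continuous_on_smooth_pos sc]
          continuous_on_compose2[OF continuous_on_smooth_pos' sc]; simp)+
    have hd: "((\<lambda>t. h n (X + t *\<^sub>R b)) has_real_derivative h' n X) (at 0)" for n X
    proof -
      have "((\<lambda>t. s n (X + t *\<^sub>R b)) has_real_derivative - 2 * real n * ((X - Z) \<bullet> b)) (at 0)"
        unfolding s_def by (auto intro!: derivative_eq_intros simp: has_field_derivative_def inner_simps inner_commute algebra_simps)
      then show ?thesis
        unfolding h_def h'_def using DERIV_chain2[of smooth_pos _ "\<lambda>t. s n (X + t *\<^sub>R b)" 0] smooth_pos_deriv by fastforce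
    qed
    have z: "(LINT X|lebesgue_on \<Omega>. (W X \<bullet> b) * h n X) = 0" for n
    proof -
      have "(\<lambda>X. h n X *\<^sub>R b) \<in> L2_space \<Omega>" "(\<lambda>X. grushin_weight lam b X * h' n X) \<in> L2_space \<Omega>"
        by (intro continuous_L2_space open_\<Omega> bounded_\<Omega> continuous_intros hc grushin_weight_continuous lam)+
      from L2_tendsto_inner[OF \<zeta>W this(1)] L2_tendsto_inner[OF \<zeta>0 this(2)]
      have 1: "(\<lambda>j. LINT X|lebesgue_on \<Omega>. (qgrad lam (\<zeta> j) X \<bullet> b) * h n X) \<longlonglongrightarrow> (LINT X|lebesgue_on \<Omega>. (W X \<bullet> b) * h n X)"
        and 2: "(\<lambda>j. LINT X|lebesgue_on \<Omega>. \<zeta> j X * (grushin_weight lam b X * h' n X)) \<longlonglongrightarrow> 0"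
        by (simp_all add: mult.commute)
      from LIMSEQ_unique[OF 1] tendsto_minus[OF 2] show ?thesis
        unfolding qgrad_by_parts[OF \<zeta>C b hc hd] by simp
    qed
    have hlim: "(\<lambda>n. h n Y) \<longlonglongrightarrow> indicator (ball Z d) Y" for Y
    proof (cases "Y \<in> ball Z d")
      case True
      define e where "e = d\<^sup>2 - (Y - Z) \<bullet> (Y - Z)"
      have "(norm (Y - Z))\<^sup>2 < d\<^sup>2" using True by (intro power_strict_mono) (auto simp: dist_norm norm_minus_commute)
      then have e: "0 < e" by (simp add: e_def power2_norm_eq_inner)
      have "h n Y = 1 - 1 / (1 + (real n * e)\<^sup>2)" for n
      proof -
        have "max (real n * e) 0 = real n * e" using e by simp
        moreover have "1 + (real n * e)\<^sup>2 \<noteq> 0" by (smt (verit) zero_le_power2)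
        ultimately show ?thesis by (simp add: h_def s_def e_def[symmetric] smooth_pos_def field_simps)
      qed
      moreover have "(\<lambda>n. 1 - 1 / (1 + (real n * e)\<^sup>2)) \<longlonglongrightarrow> 1 - 0"
        using e by (intro tendsto_intros real_tendsto_divide_at_top[OF tendsto_const] filterlim_tendsto_add_at_top[OF tendsto_const]
            filterlim_pow_at_top filterlim_at_top_mult_tendsto_pos[OF tendsto_const] filterlim_real_sequentially) auto
      ultimately show ?thesis using True by simp
    next
      case False
      have "d\<^sup>2 \<le> (norm (Y - Z))\<^sup>2" using False d by (intro power_mono) (auto simp: dist_norm norm_minus_commute)
      then have "s n Y \<le> 0" for n by (simp add: s_def power2_norm_eq_inner mult_nonneg_nonpos)
      then show ?thesis using False by (simp add: h_def smooth_pos_eq_0[THEN iffD2])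
    qed
    have "(\<lambda>n. LINT X|lebesgue_on \<Omega>. (W X \<bullet> b) * h n X) \<longlonglongrightarrow> (LINT X|lebesgue_on \<Omega>. (W X \<bullet> b) * indicator (ball Z d) X)"
    proof (rule integral_dominated_convergence[where w = "\<lambda>X. norm (W X \<bullet> b)"])
      have [measurable]: "h n \<in> borel_measurable (lebesgue_on \<Omega>)" for n
        using continuous_L2_space[OF open_\<Omega> bounded_\<Omega> hc(1)] by (rule L2_space_measurable)
      have [measurable]: "(\<lambda>X. W X \<bullet> b) \<in> borel_measurable (lebesgue_on \<Omega>)"
        using Wi by simp
      show "(\<lambda>X. (W X \<bullet> b) * h n X) \<in> borel_measurable (lebesgue_on \<Omega>)" for n by measurable
      show "(\<lambda>X. (W X \<bullet> b) * indicator (ball Z d) X) \<in> borel_measurable (lebesgue_on \<Omega>)"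
        by (intro borel_measurable_times measurable_restrict_space1[OF borel_measurable_indicator]) auto
      show "AE X in lebesgue_on \<Omega>. (\<lambda>n. (W X \<bullet> b) * h n X) \<longlonglongrightarrow> (W X \<bullet> b) * indicator (ball Z d) X"
        using hlim by (intro AE_I2 tendsto_mult_left)
      show "AE X in lebesgue_on \<Omega>. norm ((W X \<bullet> b) * h n X) \<le> norm (W X \<bullet> b)" for n
        by (intro AE_I2) (simp add: abs_mult h_def smooth_pos_nonneg smooth_pos_le_1 mult_left_le)
    qed (use Wi in auto)
    then have "(LINT X|lebesgue_on \<Omega>. (W X \<bullet> b) * indicator (ball Z d) X) = 0"
      unfolding z by (simp add: LIMSEQ_const_iff)
    moreover have "(LINT X|lebesgue_on \<Omega>. (W X \<bullet> b) * indicator (ball Z d) X) = (LINT Y:ball Z d|lebesgue. g b Y)"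
      using open_\<Omega> by (subst integral_restrict_space) (auto simp: set_lebesgue_integral_def g_def mult_ac)
    ultimately show ?thesis by simp
  qed
  have "AE X in lebesgue. g b X = 0" if b: "b \<in> Basis" for b
  proof -
    have ex: "\<exists>d. 0 < d \<and> d < e \<and> P d" if "0 < e" "\<And>d. 0 < d \<Longrightarrow> P d" for e :: real and P
      using that by (intro exI[of _ "e / 2"]) auto
    have "AE X in lebesgue. X \<in> UNIV \<longrightarrow> 0 \<le> g b X"
      by (rule AE_ge_of_ball_averages[OF gi]) (auto intro!: ex simp: ball0[OF b])
    moreover have "AE X in lebesgue. X \<in> UNIV \<longrightarrow> 0 \<le> - g b X"
    proof (rule AE_ge_of_ball_averages)
      have "(LINT Y:ball X d|lebesgue. - g b Y) = 0" if "0 < d" for X d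
        using ball0[OF b that, of X] by (simp add: set_lebesgue_integral_def)
      then show "\<exists>d. 0 < d \<and> d < e \<and> 0 * measure lebesgue (ball X d) \<le> (LINT Y:ball X d|lebesgue. - g b Y)"
        if "0 < e" for X e
        using that by (intro ex) auto
    qed (use gi in auto)
    ultimately show ?thesis by eventually_elim auto
  qed
  then have "AE X in lebesgue. \<forall>b\<in>Basis. g b X = 0"
    by (intro AE_finite_allI) auto
  then have "AE X in lebesgue. X \<in> \<Omega> \<longrightarrow> W X = 0"
    by eventually_elim (auto simp: g_def euclidean_all_zero_iff)
  then show ?thesis
    using open_\<Omega> by (subst AE_restrict_space_iff) auto
qed

end

section \<open>Weak supersolutions\<close>

lemma L2_tendsto_Lipschitz:
  fixes f :: "nat \<Rightarrow> 'a::euclidean_space \<Rightarrow> 'b::euclidean_space" and g :: "nat \<Rightarrow> 'a \<Rightarrow> 'c::euclidean_space"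
  assumes f: "\<And>n. f n \<in> L2_space \<Omega>" "F \<in> L2_space \<Omega>" and g: "L2_tendsto \<Omega> g G"
    and le: "\<And>n X. norm (f n X - F X) \<le> C * norm (g n X - G X)"
  shows "L2_tendsto \<Omega> f F"
proof -
  let ?M = "lebesgue_on \<Omega>"
  have gL: "\<And>n. g n \<in> L2_space \<Omega>" "G \<in> L2_space \<Omega>"
    and lim: "(\<lambda>n. LINT X|?M. (norm (g n X - G X))\<^sup>2) \<longlonglongrightarrow> 0"
    using g by (auto simp: L2_tendsto_iff)
  have "(LINT X|?M. (norm (f n X - F X))\<^sup>2) \<le> C\<^sup>2 * (LINT X|?M. (norm (g n X - G X))\<^sup>2)" for n
  proof -
    have "(norm (f n X - F X))\<^sup>2 \<le> C\<^sup>2 * (norm (g n X - G X))\<^sup>2" for X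
      using power_mono[OF le norm_ge_zero, of n X 2] by (simp add: power_mult_distrib)
    then have "(LINT X|?M. (norm (f n X - F X))\<^sup>2) \<le> (LINT X|?M. C\<^sup>2 * (norm (g n X - G X))\<^sup>2)"
      by (intro integral_mono integrable_mult_right L2_space_integrable L2_space_diff f gL)
    then show ?thesis by simp
  qed
  moreover have "(\<lambda>n. C\<^sup>2 * (LINT X|?M. (norm (g n X - G X))\<^sup>2)) \<longlonglongrightarrow> 0"
    using tendsto_mult_left[OF lim, of "C\<^sup>2"] by simp
  moreover have "0 \<le> (LINT X|?M. (norm (f n X - F X))\<^sup>2)" for n by simp
  ultimately have "(\<lambda>n. LINT X|?M. (norm (f n X - F X))\<^sup>2) \<longlonglongrightarrow> 0"
    by (rule_tac tendsto_sandwich[OF always_eventually always_eventually tendsto_const]) simp_all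
  then show ?thesis using f by (simp add: L2_tendsto_iff)
qed

text \<open>Split c_n F_n - c' G as c_n (F_n - G) + (c_n - c') G: the first part is small because
  the multipliers are bounded, the second by dominated convergence. It serves for the chain-rule
  factor of truncated functions.\<close>

lemma L2_tendsto_scaleR:
  fixes F :: "nat \<Rightarrow> 'a::euclidean_space \<Rightarrow> 'b::euclidean_space" and c :: "nat \<Rightarrow> 'a \<Rightarrow> real"
  assumes F: "L2_tendsto \<Omega> F G"
    and c: "\<And>n. c n \<in> borel_measurable (lebesgue_on \<Omega>)" "c' \<in> borel_measurable (lebesgue_on \<Omega>)"
    and bnd: "\<And>n X. \<bar>c n X\<bar> \<le> B" "\<And>X. \<bar>c' X\<bar> \<le> B"
    and lim: "AE X in lebesgue_on \<Omega>. (\<lambda>n. c n X) \<longlonglongrightarrow> c' X"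
  shows "L2_tendsto \<Omega> (\<lambda>n X. c n X *\<^sub>R F n X) (\<lambda>X. c' X *\<^sub>R G X)"
proof -
  let ?M = "lebesgue_on \<Omega>"
  have FL: "\<And>n. F n \<in> L2_space \<Omega>" "G \<in> L2_space \<Omega>"
    and Flim: "(\<lambda>n. LINT X|?M. (norm (F n X - G X))\<^sup>2) \<longlonglongrightarrow> 0"
    using F by (auto simp: L2_tendsto_iff)
  have B0: "0 \<le> B" using bnd(2)[of undefined] by linarith
  have mul: "(\<lambda>X. a X *\<^sub>R H X) \<in> L2_space \<Omega>"
    if "a \<in> borel_measurable ?M" "\<And>X. \<bar>a X\<bar> \<le> C" "H \<in> L2_space \<Omega>" for a C and H :: "'a \<Rightarrow> 'b"
  proof (rule L2_spaceI)
    show "integrable ?M (\<lambda>X. C\<^sup>2 * (norm (H X))\<^sup>2)"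
      using L2_space_integrable[OF that(3)] by simp
    show "(norm (a X *\<^sub>R H X))\<^sup>2 \<le> C\<^sup>2 * (norm (H X))\<^sup>2" for X
      using power_mono[OF that(2) abs_ge_zero, of X 2] by (simp add: power_mult_distrib mult_right_mono)
  qed (use that L2_space_measurable[OF that(3)] in measurable)
  note L1 = mul[OF c(1) bnd(1) FL(1)] and L2 = mul[OF c(2) bnd(2) FL(2)]
  have i2: "integrable ?M (\<lambda>X. (c n X - c' X)\<^sup>2 * (norm (G X))\<^sup>2)" for n
  proof -
    have "\<bar>c n X - c' X\<bar> \<le> 2 * B" for X using bnd(1)[of n X] bnd(2)[of X] by linarith
    from L2_space_integrable[OF mul[OF _ this FL(2)]] c show ?thesis
      by (simp add: power_mult_distrib)
  qed
  have "(\<lambda>n. LINT X|?M. (c n X - c' X)\<^sup>2 * (norm (G X))\<^sup>2) \<longlonglongrightarrow> (LINT X|?M. 0)"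
  proof (rule integral_dominated_convergence[where w = "\<lambda>X. (2 * B)\<^sup>2 * (norm (G X))\<^sup>2"])
    show "integrable ?M (\<lambda>X. (2 * B)\<^sup>2 * (norm (G X))\<^sup>2)"
      using L2_space_integrable[OF FL(2)] by simp
    show "(\<lambda>X. (c n X - c' X)\<^sup>2 * (norm (G X))\<^sup>2) \<in> borel_measurable ?M" for n
      using i2 by simp
    show "AE X in ?M. norm ((c n X - c' X)\<^sup>2 * (norm (G X))\<^sup>2) \<le> (2 * B)\<^sup>2 * (norm (G X))\<^sup>2" for n
    proof (rule AE_I2)
      fix X
      have "\<bar>c n X - c' X\<bar> \<le> 2 * B" using bnd(1)[of n X] bnd(2)[of X] by linarith
      from power_mono[OF this abs_ge_zero, of 2]
      show "norm ((c n X - c' X)\<^sup>2 * (norm (G X))\<^sup>2) \<le> (2 * B)\<^sup>2 * (norm (G X))\<^sup>2"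
        by (simp add: mult_right_mono)
    qed
    show "AE X in ?M. (\<lambda>n. (c n X - c' X)\<^sup>2 * (norm (G X))\<^sup>2) \<longlonglongrightarrow> 0"
      using lim by eventually_elim (auto intro!: tendsto_eq_intros)
  qed simp
  then have lim2: "(\<lambda>n. LINT X|?M. (c n X - c' X)\<^sup>2 * (norm (G X))\<^sup>2) \<longlonglongrightarrow> 0" by simp
  have "(\<lambda>n. LINT X|?M. (norm (c n X *\<^sub>R F n X - c' X *\<^sub>R G X))\<^sup>2) \<longlonglongrightarrow> 0"
  proof (rule tendsto_sandwich[OF _ _ tendsto_const])
    show "\<forall>\<^sub>F n in sequentially. (LINT X|?M. (norm (c n X *\<^sub>R F n X - c' X *\<^sub>R G X))\<^sup>2)
      \<le> 2 * B\<^sup>2 * (LINT X|?M. (norm (F n X - G X))\<^sup>2) + 2 * (LINT X|?M. (c n X - c' X)\<^sup>2 * (norm (G X))\<^sup>2)"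
    proof (rule always_eventually, rule allI)
      fix n
      note i1 = L2_space_integrable[OF L2_space_diff[OF FL, of n]]
      have "(LINT X|?M. (norm (c n X *\<^sub>R F n X - c' X *\<^sub>R G X))\<^sup>2)
        \<le> (LINT X|?M. 2 * B\<^sup>2 * (norm (F n X - G X))\<^sup>2 + 2 * ((c n X - c' X)\<^sup>2 * (norm (G X))\<^sup>2))"
      proof (rule integral_mono)
        fix X
        have "(norm (c n X *\<^sub>R F n X - c' X *\<^sub>R G X))\<^sup>2
          = (norm (c n X *\<^sub>R (F n X - G X) + (c n X - c' X) *\<^sub>R G X))\<^sup>2"
          by (simp add: algebra_simps)
        also have "\<dots> \<le> 2 * (norm (c n X *\<^sub>R (F n X - G X)))\<^sup>2 + 2 * (norm ((c n X - c' X) *\<^sub>R G X))\<^sup>2"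
          by (rule norm_add_square_le)
        also have "\<dots> \<le> 2 * B\<^sup>2 * (norm (F n X - G X))\<^sup>2 + 2 * ((c n X - c' X)\<^sup>2 * (norm (G X))\<^sup>2)"
          using power_mono[OF bnd(1) abs_ge_zero, of n X 2]
          by (simp add: power_mult_distrib mult_right_mono)
        finally show "(norm (c n X *\<^sub>R F n X - c' X *\<^sub>R G X))\<^sup>2
          \<le> 2 * B\<^sup>2 * (norm (F n X - G X))\<^sup>2 + 2 * ((c n X - c' X)\<^sup>2 * (norm (G X))\<^sup>2)" .
      qed (use L2_space_integrable[OF L2_space_diff[OF L1 L2]] i1 i2 in auto)
      also have "\<dots> = 2 * B\<^sup>2 * (LINT X|?M. (norm (F n X - G X))\<^sup>2) + 2 * (LINT X|?M. (c n X - c' X)\<^sup>2 * (norm (G X))\<^sup>2)"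
        using i1 i2 by simp
      finally show "(LINT X|?M. (norm (c n X *\<^sub>R F n X - c' X *\<^sub>R G X))\<^sup>2) \<le> \<dots>" .
    qed
    show "(\<lambda>n. 2 * B\<^sup>2 * (LINT X|?M. (norm (F n X - G X))\<^sup>2) + 2 * (LINT X|?M. (c n X - c' X)\<^sup>2 * (norm (G X))\<^sup>2)) \<longlonglongrightarrow> 0"
      by (rule tendsto_eq_intros Flim lim2 refl | simp)+
  qed (simp add: integral_nonneg_AE)
  then show ?thesis using L1 L2 by (simp add: L2_tendsto_iff)
qed

lemma AE_fst_nonzero: "AE X :: 'm::finite point in lebesgue_on \<Omega>. fst X \<noteq> 0" if "open \<Omega>"
proof -
  have "negligible {X :: 'm point. (1, 0) \<bullet> X = 0}"
    by (rule negligible_hyperplane) (simp add: prod_eq_iff)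
  then have "AE X :: 'm point in lebesgue. X \<notin> {X. (1, 0) \<bullet> X = 0}"
    by (intro AE_not_in) (simp add: negligible_iff_null_sets)
  then have "AE X :: 'm point in lebesgue. fst X \<noteq> 0"
    by eventually_elim (auto simp: inner_prod_def)
  then show ?thesis
    using that by (subst AE_restrict_space_iff) (auto elim: eventually_mono)
qed

definition quad :: "real \<Rightarrow> 'm::finite point \<Rightarrow> 'm point \<Rightarrow> real" where
  "quad k Z X = (fst X - fst Z)\<^sup>2 + k * (norm (snd X - snd Z))\<^sup>2"

lemma quad_nonneg: "0 \<le> k \<Longrightarrow> 0 \<le> quad k Z X"
  by (simp add: quad_def)

lemma continuous_on_quad: "continuous_on UNIV (quad k Z)"
  unfolding quad_def[abs_def] by (intro continuous_intros)

text \<open>The Grushin operator applied to \<open>f \<circ> quad k Z\<close>, where \<open>f1\<close> and \<open>f2\<close> stand for the first two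
  derivatives of \<open>f\<close>.\<close>

definition grushin_quad ::
    "real \<Rightarrow> real \<Rightarrow> 'm::finite point \<Rightarrow> (real \<Rightarrow> real) \<Rightarrow> (real \<Rightarrow> real) \<Rightarrow> 'm point \<Rightarrow> real" where
  "grushin_quad lam k Z f1 f2 X =
     4 * f2 (quad k Z X) * ((fst X - fst Z)\<^sup>2 + \<bar>fst X\<bar> powr (2 * lam) * k\<^sup>2 * (norm (snd X - snd Z))\<^sup>2) +
     2 * f1 (quad k Z X) * (1 + real CARD('m) * k * \<bar>fst X\<bar> powr (2 * lam))"

lemma continuous_on_grushin_quad:
  fixes Z :: "'a::finite point"
  assumes "0 < lam" "continuous_on UNIV f1" "continuous_on UNIV f2"
  shows "continuous_on UNIV (grushin_quad lam k Z f1 f2)"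
proof -
  have "continuous_on UNIV (\<lambda>X. f1 (quad k Z X))" "continuous_on UNIV (\<lambda>X. f2 (quad k Z X))"
    by (rule continuous_on_compose2[OF assms(2) continuous_on_quad subset_UNIV]
        continuous_on_compose2[OF assms(3) continuous_on_quad subset_UNIV])+
  moreover have "continuous_on UNIV (\<lambda>X :: 'a point. \<bar>fst X\<bar> powr (2 * lam))"
    using assms(1) by (auto intro!: continuous_intros continuous_on_powr')
  ultimately show ?thesis
    unfolding grushin_quad_def[abs_def]
    by (intro continuous_on_add continuous_on_mult continuous_on_power continuous_on_norm continuous_on_diff
        continuous_on_fst continuous_on_snd continuous_on_id continuous_on_const)
qed

lemma quad_comp_grad:
  assumes "\<And>s. (f has_real_derivative f1 s) (at s)"
  shows "((\<lambda>X. f (quad k Z X)) has_derivative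
      (\<lambda>v. (2 * f1 (quad k Z X) * (fst X - fst Z), (2 * k * f1 (quad k Z X)) *\<^sub>R (snd X - snd Z)) \<bullet> v)) (at X)"
proof -
  have q: "(quad k Z has_derivative (\<lambda>v. 2 * (fst X - fst Z) * fst v + 2 * k * ((snd X - snd Z) \<bullet> snd v))) (at X)"
  proof -
    have 1: "((\<lambda>X. fst X - fst Z) has_derivative fst) (at X)"
      by (rule has_derivative_eq_rhs[OF has_derivative_diff[OF has_derivative_fst[OF has_derivative_ident] has_derivative_const]]) simp
    have 2: "((\<lambda>X. snd X - snd Z) has_derivative snd) (at X)"
      by (rule has_derivative_eq_rhs[OF has_derivative_diff[OF has_derivative_snd[OF has_derivative_ident] has_derivative_const]]) simp
    show ?thesis
      unfolding quad_def[abs_def] power2_norm_eq_inner unfolding power2_eq_square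
      by (rule has_derivative_eq_rhs[OF has_derivative_add[OF has_derivative_mult[OF 1 1]
            has_derivative_mult_right[OF has_derivative_inner[OF 2 2], of k]]])
         (simp add: fun_eq_iff inner_commute)
  qed
  have "(f has_derivative (\<lambda>h. f1 (quad k Z X) * h)) (at (quad k Z X))"
    using assms by (simp add: has_field_derivative_def)
  from has_derivative_compose[OF q this] show ?thesis
    by (simp add: inner_prod_def algebra_simps)
qed

lemma inner_prod_Basis:
  fixes V W :: "'m::finite point"
  shows "V \<bullet> W = (V \<bullet> (1, 0)) * (W \<bullet> (1, 0)) + (\<Sum>e\<in>Basis. (V \<bullet> (0, e)) * (W \<bullet> (0, e)))"
  by (simp add: inner_prod_def euclidean_inner[of "snd V" "snd W"])

section \<open>Uniqueness of quasi-gradients and the weak inequality\<close>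

context grushin_domain
begin

lemma quasi_limit_unique:
  assumes "converges \<phi> v V" "converges \<psi> v W"
  shows "AE X in lebesgue_on \<Omega>. V X = W X"
proof -
  have qg: "qgrad lam (\<lambda>X. \<phi> n X - \<psi> n X) = (\<lambda>X. qgrad lam (\<phi> n) X - qgrad lam (\<psi> n) X)" for n
    using assms qgrad_diff[of "\<phi> n" \<Omega> "\<psi> n" lam] by (auto simp: converges_def)
  have "converges (\<lambda>n X. \<phi> n X - \<psi> n X) (\<lambda>X. v X - v X) (\<lambda>X. V X - W X)"
    using assms L2_tendsto_diff[of \<Omega> \<phi> v \<psi> v] L2_tendsto_diff[of \<Omega> "\<lambda>n. qgrad lam (\<phi> n)" V "\<lambda>n. qgrad lam (\<psi> n)" W]
    by (simp add: converges_def qg C1_0_diff)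
  from qgrad_limit_zero[OF this[simplified]] show ?thesis by eventually_elim simp
qed

text \<open>The supersolution inequality in terms of the limits U and V of sqrt A grad along
  arbitrary sequences: it involves neither a choice nor the inverse of sqrt A.\<close>

definition weak_supersolution :: "('m point \<Rightarrow> 'm point) \<Rightarrow> bool" where
  "weak_supersolution U \<longleftrightarrow> (\<forall>\<psi> v V. converges \<psi> v V \<longrightarrow> (AE X in lebesgue_on \<Omega>. 0 \<le> v X) \<longrightarrow>
     0 \<le> (LINT X|lebesgue_on \<Omega>. U X \<bullet> V X))"

text \<open>Off the null set x = 0 the factors sqrt A and their inverses cancel, and by closability
  the chosen limit for v agrees almost everywhere with the limit V of any other sequence.\<close>

lemma supersolution_imp_weak:
  assumes u: "u \<in> H1_0 lam \<Omega>" and super: "supersolution lam \<Omega> u"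
  shows "\<exists>\<phi> U. converges \<phi> u U \<and> weak_supersolution U"
proof -
  let ?M = "lebesgue_on \<Omega>"
  \<comment> \<open>The same choice term as in \<open>quasi_grad\<close>, before the division by
    sqrt A.\<close>
  define S where "S v = (SOME V. \<exists>\<phi>. represents lam \<Omega> \<phi> v \<and>
      L2_tendsto \<Omega> (\<lambda>n X. grushin_sqrtA lam X (grad (\<phi> n) X)) V)" for v
  have S: "\<exists>\<phi>. converges \<phi> v (S v)" if v: "v \<in> H1_0 lam \<Omega>" for v
  proof -
    obtain \<phi> where \<phi>: "represents lam \<Omega> \<phi> v" using v by (auto simp: H1_0_def)
    then obtain V where "converges \<phi> v V" using represents_converges by blast
    then have "\<exists>V \<phi>. represents lam \<Omega> \<phi> v \<and> L2_tendsto \<Omega> (\<lambda>n X. grushin_sqrtA lam X (grad (\<phi> n) X)) V"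
      using \<phi> by (auto simp: converges_def qgrad_def[abs_def])
    from someI_ex[OF this] show ?thesis
      unfolding S_def[symmetric] by (auto simp: converges_def represents_def qgrad_def[abs_def])
  qed
  have qg: "quasi_grad lam \<Omega> v X = grushin_sqrtA_inv lam X (S v X)" for v X
    by (simp add: quasi_grad_def S_def Let_def)
  obtain \<phi> where \<phi>: "converges \<phi> u (S u)" using S[OF u] by blast
  have "weak_supersolution (S u)"
    unfolding weak_supersolution_def
  proof (intro allI impI)
    fix \<psi> v V assume \<psi>: "converges \<psi> v V" and v: "AE X in ?M. 0 \<le> v X"
    then have vH: "v \<in> H1_0 lam \<Omega>" using converges_represents by (auto simp: H1_0_def)
    obtain \<psi>' where \<psi>': "converges \<psi>' v (S v)" using S[OF vH] by blast
    have [measurable]: "S u \<in> borel_measurable ?M" "V \<in> borel_measurable ?M" "S v \<in> borel_measurable ?M"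
      using \<phi> \<psi> \<psi>' by (auto simp: converges_def L2_tendsto_iff L2_space_measurable)
    have [measurable]: "fst \<in> borel_measurable ?M"
      using open_\<Omega> by (intro continuous_imp_measurable_on_sets_lebesgue) (auto intro: continuous_intros)
    have [measurable]: "(\<lambda>X. fst (F X)) \<in> borel_measurable ?M" "(\<lambda>X. snd (F X)) \<in> borel_measurable ?M"
      if F: "F \<in> borel_measurable ?M" for F :: "'m point \<Rightarrow> 'm point"
      by (rule measurable_compose[OF F borel_measurable_continuous_onI], intro continuous_intros)+
    have "0 \<le> (LINT X|?M. grushin_A lam X (quasi_grad lam \<Omega> u X) \<bullet> quasi_grad lam \<Omega> v X)"
      using super vH v by (simp add: supersolution_def)
    also have "\<dots> = (LINT X|?M. S u X \<bullet> V X)"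
    proof (rule integral_cong_AE)
      show "AE X in ?M. grushin_A lam X (quasi_grad lam \<Omega> u X) \<bullet> quasi_grad lam \<Omega> v X = S u X \<bullet> V X"
        using AE_fst_nonzero[OF open_\<Omega>] quasi_limit_unique[OF \<psi>' \<psi>]
        by eventually_elim (simp add: qg grushin_A_inner grushin_sqrtA_inverse)
      show "(\<lambda>X. grushin_A lam X (quasi_grad lam \<Omega> u X) \<bullet> quasi_grad lam \<Omega> v X) \<in> borel_measurable ?M"
        unfolding qg grushin_A_def grushin_sqrtA_inv_def inner_prod_def fst_conv snd_conv by measurable
    qed measurable
    finally show "0 \<le> (LINT X|?M. S u X \<bullet> V X)" .
  qed
  with \<phi> show ?thesis by blast
qed

text \<open>Integrate by parts in one coordinate direction at a time and sum. Only \<zeta> has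
  compact support, so the identity also applies to barriers that do not vanish near the boundary of
  \<Omega>.\<close>

lemma quad_by_parts:
  assumes f: "\<And>s. (f has_real_derivative f1 s) (at s)" "\<And>s. (f1 has_real_derivative f2 s) (at s)"
    and cont: "continuous_on UNIV f2" and \<zeta>: "\<zeta> \<in> C1_0 \<Omega>"
  shows "(LINT X|lebesgue_on \<Omega>. qgrad lam \<zeta> X \<bullet> qgrad lam (\<lambda>X. f (quad k Z X)) X)
    = - (LINT X|lebesgue_on \<Omega>. \<zeta> X * grushin_quad lam k Z f1 f2 X)"
proof -
  let ?M = "lebesgue_on \<Omega>"
  let ?q = "quad k Z"
  \<comment> \<open>The coefficient of the square of the b-coordinate in
    \<open>quad k Z\<close>.\<close>
  define kb where "kb b = (if fst b = 0 then k else 1)" for b :: "'m point"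
  let ?w = "grushin_weight lam"
  have cont1: "continuous_on UNIV f1"
    using f(2) by (auto intro!: continuous_at_imp_continuous_on DERIV_isCont)
  note cq = continuous_on_compose2[OF cont1 continuous_on_quad] continuous_on_compose2[OF cont continuous_on_quad]
  have gr: "grad (\<lambda>X. f (?q X)) X = (2 * f1 (?q X) * (fst X - fst Z), (2 * k * f1 (?q X)) *\<^sub>R (snd X - snd Z))" for X
    by (rule grad_eqI[OF quad_comp_grad[OF f(1)]])
  \<comment> \<open>The first derivative of f o quad along b; \<open>g'\<close> is the second. The
    weight is kept apart since it is constant along b.\<close>
  define g where "g b X = 2 * kb b * f1 (?q X) * ((X - Z) \<bullet> b)" for b X
  define g' where "g' b X = 4 * (kb b)\<^sup>2 * f2 (?q X) * ((X - Z) \<bullet> b)\<^sup>2 + 2 * kb b * f1 (?q X)" for b X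
  have qb: "qgrad lam (\<lambda>X. f (?q X)) X \<bullet> b = ?w b X * g b X" if "b \<in> Basis" for b X
    unfolding qgrad_def grushin_sqrtA_inner_Basis[OF that] gr g_def
    using that by (auto simp: kb_def Basis_prod_def inner_prod_def)
  have gc: "continuous_on UNIV (g b)" "continuous_on UNIV (g' b)" for b
    unfolding g_def[abs_def] g'_def[abs_def] by (intro continuous_intros cq; simp)+
  have qd: "((\<lambda>t. ?q (X + t *\<^sub>R b)) has_real_derivative 2 * kb b * ((X - Z) \<bullet> b)) (at 0)" if "b \<in> Basis" for b X
    using that unfolding Basis_prod_def
  proof
    assume "b \<in> (\<lambda>u. (u, 0)) ` Basis"
    then have b: "b = (1, 0)" by auto
    show ?thesis unfolding b quad_def kb_def
      by (auto intro!: derivative_eq_intros simp: inner_prod_def)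
  next
    assume "b \<in> (\<lambda>v. (0, v)) ` Basis"
    then obtain e where b: "b = (0, e)" by auto
    show ?thesis unfolding b quad_def kb_def power2_norm_eq_inner
      by (auto intro!: derivative_eq_intros simp: has_field_derivative_def inner_prod_def inner_simps inner_commute algebra_simps)
  qed
  have gd: "((\<lambda>t. g b (X + t *\<^sub>R b)) has_real_derivative g' b X) (at 0)" if b: "b \<in> Basis" for b X
  proof -
    have 1: "((\<lambda>t. (X + t *\<^sub>R b - Z) \<bullet> b) has_real_derivative 1) (at 0)"
      using b by (auto intro!: derivative_eq_intros simp: has_field_derivative_def inner_simps)
    have 2: "((\<lambda>t. f1 (?q (X + t *\<^sub>R b))) has_real_derivative f2 (?q X) * (2 * kb b * ((X - Z) \<bullet> b))) (at 0)"
      using DERIV_chain2[of f1 "f2 (?q X)" "\<lambda>t. ?q (X + t *\<^sub>R b)" 0] f(2) qd[OF b] by simp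
    from DERIV_mult[OF DERIV_cmult[OF 2, of "2 * kb b"] 1] show ?thesis
      unfolding g_def g'_def by (simp add: power2_eq_square algebra_simps)
  qed
  have wg: "continuous_on UNIV (\<lambda>X. ?w b X * g b X)" "continuous_on UNIV (\<lambda>X. ?w b X * g' b X)" for b
    by (intro continuous_intros grushin_weight_continuous gc lam)+
  have part: "(LINT X|?M. (qgrad lam \<zeta> X \<bullet> b) * (qgrad lam (\<lambda>X. f (?q X)) X \<bullet> b))
      = - (LINT X|?M. \<zeta> X * ((?w b X)\<^sup>2 * g' b X))" if b: "b \<in> Basis" for b
  proof -
    have "((\<lambda>t. ?w b (X + t *\<^sub>R b) * g b (X + t *\<^sub>R b)) has_real_derivative ?w b X * g' b X) (at 0)" for X
      unfolding grushin_weight_shift[OF b] using gd[OF b] by (rule DERIV_cmult)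
    from qgrad_by_parts[OF \<zeta> b wg this] show ?thesis
      by (simp add: qb[OF b] power2_eq_square mult_ac)
  qed
  have cqg: "continuous_on UNIV (\<lambda>X. qgrad lam \<zeta> X \<bullet> b)" for b
    using qgrad_continuous[OF \<zeta>] by (intro continuous_intros)
  have int: "integrable ?M h" if "continuous_on UNIV h" for h :: "'m point \<Rightarrow> real"
    using L2_space_imp_integrable[OF continuous_L2_space[OF open_\<Omega> bounded_\<Omega> that] lmeasurable_\<Omega>] .
  have i1: "integrable ?M (\<lambda>X. (qgrad lam \<zeta> X \<bullet> b) * (qgrad lam (\<lambda>X. f (?q X)) X \<bullet> b))" if "b \<in> Basis" for b
    unfolding qb[OF that] by (intro int continuous_on_mult cqg wg)
  have i2: "integrable ?M (\<lambda>X. \<zeta> X * ((?w b X)\<^sup>2 * g' b X))" for b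
    by (intro int continuous_intros grushin_weight_continuous C1_0D(3)[OF \<zeta>] lam gc)
  have bas: "(1, 0) \<in> (Basis :: 'm point set)" "\<And>e. e \<in> Basis \<Longrightarrow> (0, e) \<in> (Basis :: 'm point set)"
    by (auto simp: Basis_prod_def)
  have "(LINT X|?M. qgrad lam \<zeta> X \<bullet> qgrad lam (\<lambda>X. f (?q X)) X)
    = (LINT X|?M. (qgrad lam \<zeta> X \<bullet> (1, 0)) * (qgrad lam (\<lambda>X. f (?q X)) X \<bullet> (1, 0))) +
      (\<Sum>e\<in>Basis. LINT X|?M. (qgrad lam \<zeta> X \<bullet> (0, e)) * (qgrad lam (\<lambda>X. f (?q X)) X \<bullet> (0, e)))"
  proof (rule trans[OF Bochner_Integration.integral_cong[OF refl inner_prod_Basis]])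
  qed (use i1 bas in \<open>simp add: Bochner_Integration.integral_add Bochner_Integration.integral_sum\<close>)
  also have "\<dots> = - ((LINT X|?M. \<zeta> X * ((?w (1, 0) X)\<^sup>2 * g' (1, 0) X)) +
      (\<Sum>e\<in>Basis. LINT X|?M. \<zeta> X * ((?w (0, e) X)\<^sup>2 * g' (0, e) X)))"
    using part bas by (simp add: sum_negf)
  also have "\<dots> = - (LINT X|?M. \<zeta> X * ((?w (1, 0) X)\<^sup>2 * g' (1, 0) X) + (\<Sum>e\<in>Basis. \<zeta> X * ((?w (0, e) X)\<^sup>2 * g' (0, e) X)))"
    using i2 by (simp add: Bochner_Integration.integral_add Bochner_Integration.integral_sum)
  also have "\<dots> = - (LINT X|?M. \<zeta> X * grushin_quad lam k Z f1 f2 X)"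
  proof -
    have "\<zeta> X * ((?w (1, 0) X)\<^sup>2 * g' (1, 0) X) + (\<Sum>e\<in>Basis. \<zeta> X * ((?w (0, e) X)\<^sup>2 * g' (0, e) X))
      = \<zeta> X * grushin_quad lam k Z f1 f2 X" for X
    proof -
      have n: "(norm (snd X - snd Z))\<^sup>2 = (\<Sum>e\<in>Basis. ((snd X - snd Z) \<bullet> e)\<^sup>2)"
        unfolding power2_norm_eq_inner by (subst euclidean_inner) (simp add: power2_eq_square)
      have p: "(\<bar>fst X\<bar> powr lam)\<^sup>2 = \<bar>fst X\<bar> powr (2 * lam)"
        by (simp add: power2_eq_square flip: powr_add)
      define a A F1 F2 where "a = \<bar>fst X\<bar> powr (2 * lam)" and "A = (fst X - fst Z)\<^sup>2"
        and "F1 = f1 (?q X)" and "F2 = f2 (?q X)"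
      have 1: "(?w (1, 0) X)\<^sup>2 * g' (1, 0) X = 4 * F2 * A + 2 * F1"
        by (simp add: grushin_weight_def g'_def kb_def F1_def F2_def A_def inner_prod_def)
      have 2: "(?w (0, e) X)\<^sup>2 * g' (0, e) X = a * (4 * k\<^sup>2 * F2) * ((snd X - snd Z) \<bullet> e)\<^sup>2 + a * (2 * k * F1)" for e
        by (simp add: grushin_weight_def g'_def kb_def F1_def F2_def a_def p inner_prod_def distrib_left mult.assoc)
      have 3: "(\<Sum>e\<in>Basis. (?w (0, e) X)\<^sup>2 * g' (0, e) X)
        = a * (4 * k\<^sup>2 * F2) * (norm (snd X - snd Z))\<^sup>2 + real CARD('m) * (a * (2 * k * F1))"
        unfolding 2 n by (simp only: sum.distrib sum_distrib_left[symmetric] sum_constant) simp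
      have "(?w (1, 0) X)\<^sup>2 * g' (1, 0) X + (\<Sum>e\<in>Basis. (?w (0, e) X)\<^sup>2 * g' (0, e) X)
        = grushin_quad lam k Z f1 f2 X"
        unfolding 1 3 grushin_quad_def a_def[symmetric] A_def[symmetric] F1_def[symmetric] F2_def[symmetric]
        by (simp add: algebra_simps)
      then show ?thesis
        by (simp only: sum_distrib_left[symmetric] distrib_left[symmetric])
    qed
    then show ?thesis by simp
  qed
  finally show ?thesis .
qed

end

section \<open>Comparison with subsolutions\<close>

context grushin_domain
begin

text \<open>Outside K and the support of f the difference h - f is at most 0, so the truncation
  vanishes there; this gives compact support in \<Omega> although h itself need not have it.\<close>

lemma smooth_pos_comp_C1_0:
  assumes h: "\<And>X. h differentiable (at X)" "continuous_on UNIV (grad h)"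
    and K: "compact K" "K \<subseteq> \<Omega>" "\<And>X. X \<notin> K \<Longrightarrow> h X \<le> 0" and f: "f \<in> C1_0 \<Omega>"
  shows "(\<lambda>X. smooth_pos (h X - f X)) \<in> C1_0 \<Omega>"
    and "qgrad lam (\<lambda>X. smooth_pos (h X - f X)) X = smooth_pos' (h X - f X) *\<^sub>R (qgrad lam h X - qgrad lam f X)"
proof -
  have hf: "(\<lambda>X. h X - f X) differentiable (at X)" for X
    using h(1) C1_0D(1)[OF f] by (intro differentiable_diff)
  have hc: "continuous_on UNIV h"
    using h(1) by (auto simp: continuous_on_eq_continuous_at intro: differentiable_imp_continuous_within)
  have D: "((\<lambda>X. smooth_pos (h X - f X)) has_derivative
      (\<lambda>v. (smooth_pos' (h X - f X) *\<^sub>R (grad h X - grad f X)) \<bullet> v)) (at X)" for X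
  proof -
    have "((\<lambda>X. h X - f X) has_derivative (\<lambda>v. (grad h X - grad f X) \<bullet> v)) (at X)"
      using has_derivative_grad[OF hf] grad_diff[OF h(1) C1_0D(1)[OF f]] by metis
    moreover have "(smooth_pos has_derivative (\<lambda>t. smooth_pos' (h X - f X) * t)) (at (h X - f X))"
      using smooth_pos_deriv by (simp add: has_field_derivative_def)
    ultimately show ?thesis
      using has_derivative_compose[of "\<lambda>X. h X - f X" "\<lambda>v. (grad h X - grad f X) \<bullet> v" X UNIV smooth_pos] by simp
  qed
  have gr: "grad (\<lambda>X. smooth_pos (h X - f X)) = (\<lambda>X. smooth_pos' (h X - f X) *\<^sub>R (grad h X - grad f X))"
    using grad_eqI[OF D] by auto
  show "qgrad lam (\<lambda>X. smooth_pos (h X - f X)) X = smooth_pos' (h X - f X) *\<^sub>R (qgrad lam h X - qgrad lam f X)"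
    by (simp add: qgrad_def gr grushin_sqrtA_diff grushin_sqrtA_scale)
  let ?F = "{X. f X \<noteq> 0}" and ?V = "{X. smooth_pos (h X - f X) \<noteq> 0}"
  have Fc: "compact (closure ?F)" "closure ?F \<subseteq> \<Omega>" using f by (auto simp: C1_0_def)
  have c: "compact (closure ?F \<union> K)" using Fc K by auto
  have "?V \<subseteq> closure ?F \<union> K"
    using K(3) closure_subset[of ?F] by (fastforce simp: smooth_pos_eq_0)
  then have s: "closure ?V \<subseteq> closure ?F \<union> K"
    using c by (intro closure_minimal compact_imp_closed)
  have "compact (closure ?V)"
    using compact_Int_closed[OF c closed_closure[of ?V]] s by (simp add: inf.absorb2)
  moreover have "closure ?V \<subseteq> \<Omega>" using s Fc K by blast
  moreover have "continuous_on UNIV (\<lambda>X. smooth_pos' (h X - f X))"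
    by (rule continuous_on_compose2[OF continuous_on_smooth_pos']) (auto intro!: continuous_intros hc C1_0D(3)[OF f])
  ultimately show "(\<lambda>X. smooth_pos (h X - f X)) \<in> C1_0 \<Omega>"
    using D h(2) C1_0D(2)[OF f] unfolding C1_0_def mem_Collect_eq gr
    by (intro conjI allI continuous_intros) (auto simp: differentiable_def)
qed

text \<open>The test function is a smoothed positive part of \<open>h - u\<close>; testing \<open>h\<close> and \<open>u\<close> against it makes its
  quasi-gradient vanish, and then \<open>L h > 0\<close> forces the test function itself to vanish.\<close>

lemma comparison_principle:
  assumes u: "converges \<phi> u U" and super: "weak_supersolution U"
    and h: "\<And>X. h differentiable (at X)" "continuous_on UNIV (grad h)" and Lh: "continuous_on UNIV Lh"
    and parts: "\<And>\<zeta>. \<zeta> \<in> C1_0 \<Omega> \<Longrightarrow>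
      (LINT X|lebesgue_on \<Omega>. qgrad lam \<zeta> X \<bullet> qgrad lam h X) = - (LINT X|lebesgue_on \<Omega>. \<zeta> X * Lh X)"
    and K: "compact K" "K \<subseteq> \<Omega>" "\<And>X. X \<notin> K \<Longrightarrow> h X \<le> 0"
    and pos: "AE X in lebesgue_on \<Omega>. u X < h X \<longrightarrow> 0 < Lh X"
  shows "AE X in lebesgue_on \<Omega>. h X \<le> u X"
proof -
  let ?M = "lebesgue_on \<Omega>"
  have \<phi>C: "\<And>n. \<phi> n \<in> C1_0 \<Omega>" and \<phi>u: "L2_tendsto \<Omega> \<phi> u" and \<phi>U: "L2_tendsto \<Omega> (\<lambda>n. qgrad lam (\<phi> n)) U"
    using u by (auto simp: converges_def)
  \<comment> \<open>Almost everywhere convergence is what the factor \<open>smooth_pos'\<close> in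
    the quasi-gradients of the test functions needs.\<close>
  obtain k :: "nat \<Rightarrow> nat" where k: "strict_mono k" and klim: "AE X in ?M. (\<lambda>n. \<phi> (k n) X) \<longlonglongrightarrow> u X"
    using L2_tendsto_AE_subseq[OF \<phi>u] .
  have hc: "continuous_on UNIV h"
    using h(1) by (auto simp: continuous_on_eq_continuous_at intro: differentiable_imp_continuous_within)
  have L2c: "f \<in> L2_space \<Omega>" if "continuous_on UNIV f" for f :: "'m point \<Rightarrow> 'b::euclidean_space"
    using that by (intro continuous_L2_space open_\<Omega> bounded_\<Omega>)
  have qhL: "qgrad lam h \<in> L2_space \<Omega>"
    unfolding qgrad_def[abs_def] using h(2) lam by (intro L2c continuous_on_grushin_sqrtA)
  have uL: "u \<in> L2_space \<Omega>" and UL: "U \<in> L2_space \<Omega>" using \<phi>u \<phi>U by (auto simp: L2_tendsto_iff)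
  have [measurable]: "u \<in> borel_measurable ?M" "h \<in> borel_measurable ?M"
    using L2_space_measurable[OF uL] L2_space_measurable[OF L2c[OF hc]] by auto
  have [measurable]: "smooth_pos \<in> borel_measurable borel" "smooth_pos' \<in> borel_measurable borel"
    using continuous_on_smooth_pos continuous_on_smooth_pos' by (auto intro: borel_measurable_continuous_onI)
  define v where "v n X = smooth_pos (h X - \<phi> (k n) X)" for n X
  define w where "w X = smooth_pos (h X - u X)" for X
  define s where "s X = smooth_pos' (h X - u X)" for X
  define V where "V X = s X *\<^sub>R (qgrad lam h X - U X)" for X
  have vC: "v n \<in> C1_0 \<Omega>" for n
    unfolding v_def using smooth_pos_comp_C1_0(1)[OF h K \<phi>C] .
  have vq: "qgrad lam (v n) = (\<lambda>X. smooth_pos' (h X - \<phi> (k n) X) *\<^sub>R (qgrad lam h X - qgrad lam (\<phi> (k n)) X))" for n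
    unfolding v_def using smooth_pos_comp_C1_0(2)[OF h K \<phi>C] by blast
  have wL: "w \<in> L2_space \<Omega>"
    by (rule bounded_measurable_L2_space[where B = 1])
       (auto simp: w_def[abs_def] smooth_pos_nonneg smooth_pos_le_1 lmeasurable_\<Omega>)
  have conv: "converges v w V"
    unfolding converges_def
  proof (intro conjI allI vC)
    show "L2_tendsto \<Omega> v w"
    proof (rule L2_tendsto_Lipschitz[OF L2c[OF C1_0D(3)[OF vC]] wL L2_tendsto_subseq[OF \<phi>u k]])
      show "norm (v n X - w X) \<le> 2 * norm (\<phi> (k n) X - u X)" for n X
        using smooth_pos_Lipschitz[of "h X - \<phi> (k n) X" "h X - u X"] by (simp add: v_def w_def abs_minus_commute)
    qed
    show "L2_tendsto \<Omega> (\<lambda>n. qgrad lam (v n)) V"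
      unfolding vq V_def
    proof (rule L2_tendsto_scaleR[where B = 2])
      show "L2_tendsto \<Omega> (\<lambda>n X. qgrad lam h X - qgrad lam (\<phi> (k n)) X) (\<lambda>X. qgrad lam h X - U X)"
        using L2_tendsto_diff[OF L2_tendsto_const[OF qhL] L2_tendsto_subseq[OF \<phi>U k]] by simp
      have [measurable]: "\<phi> n \<in> borel_measurable ?M" for n
        using L2_space_measurable[OF L2c[OF C1_0D(3)[OF \<phi>C]]] .
      show "(\<lambda>X. smooth_pos' (h X - \<phi> (k n) X)) \<in> borel_measurable ?M" for n by measurable
      show "s \<in> borel_measurable ?M" unfolding s_def[abs_def] by measurable
      show "AE X in ?M. (\<lambda>n. smooth_pos' (h X - \<phi> (k n) X)) \<longlonglongrightarrow> s X"
        using klim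
      proof eventually_elim
        case (elim X)
        have "isCont smooth_pos' (h X - u X)"
          using continuous_on_smooth_pos' by (simp add: continuous_on_eq_continuous_at)
        then show ?case
          unfolding s_def by (rule isCont_tendsto_compose) (intro tendsto_intros elim)
      qed
    qed (auto simp: s_def smooth_pos'_nonneg smooth_pos'_le_2)
  qed
  have VL: "V \<in> L2_space \<Omega>" using conv by (auto simp: converges_def L2_tendsto_iff)
  have UV: "0 \<le> (LINT X|?M. U X \<bullet> V X)"
    using super conv unfolding weak_supersolution_def by (auto simp: w_def smooth_pos_nonneg)
  \<comment> \<open>h need not have compact support, so the hypothesis \<open>parts\<close> is
    applied to the approximating test functions \<open>v n\<close> and then passed to the
    limit.\<close>
  have hV: "(LINT X|?M. V X \<bullet> qgrad lam h X) = - (LINT X|?M. w X * Lh X)"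
  proof -
    have "(\<lambda>n. LINT X|?M. qgrad lam (v n) X \<bullet> qgrad lam h X) \<longlonglongrightarrow> (LINT X|?M. V X \<bullet> qgrad lam h X)"
      using conv by (intro L2_tendsto_inner qhL) (simp add: converges_def)
    moreover have "(\<lambda>n. LINT X|?M. v n X * Lh X) \<longlonglongrightarrow> (LINT X|?M. w X * Lh X)"
      using conv L2_tendsto_inner[of \<Omega> v w Lh] L2c[OF Lh] by (simp add: converges_def)
    ultimately show ?thesis
      unfolding parts[OF vC] using LIMSEQ_unique tendsto_minus by blast
  qed
  have wLh: "AE X in ?M. 0 \<le> w X * Lh X"
    using pos
  proof eventually_elim
    case (elim X)
    show ?case
    proof (cases "u X < h X")
      case False
      then have "w X = 0" by (simp add: w_def smooth_pos_eq_0)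
      then show ?thesis by simp
    qed (use elim in \<open>simp add: w_def smooth_pos_nonneg\<close>)
  qed
  then have wLh0: "0 \<le> (LINT X|?M. w X * Lh X)" by (rule integral_nonneg_AE)
  have int: "integrable ?M (\<lambda>X. V X \<bullet> qgrad lam h X)" "integrable ?M (\<lambda>X. U X \<bullet> V X)" "integrable ?M (\<lambda>X. w X * Lh X)"
    using L2_inner_integrable[OF VL qhL] L2_inner_integrable[OF UL VL] L2_inner_integrable[OF wL L2c[OF Lh]] by simp_all
  \<comment> \<open>Pairing the test quasi-gradient with the difference of the two fields gives a
    nonnegative density, whose integral is nonpositive by \<open>wLh0\<close> and
    \<open>UV\<close>.\<close>
  have diff: "V X \<bullet> qgrad lam h X - U X \<bullet> V X = s X * (norm (qgrad lam h X - U X))\<^sup>2" for X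
    by (simp add: V_def power2_norm_eq_inner inner_simps inner_commute algebra_simps)
  have nn: "0 \<le> s X * (norm (qgrad lam h X - U X))\<^sup>2" for X
    by (simp add: s_def smooth_pos'_nonneg)
  have i: "integrable ?M (\<lambda>X. s X * (norm (qgrad lam h X - U X))\<^sup>2)"
    unfolding diff[symmetric] using int by simp
  have "(LINT X|?M. s X * (norm (qgrad lam h X - U X))\<^sup>2) = - (LINT X|?M. w X * Lh X) - (LINT X|?M. U X \<bullet> V X)"
    unfolding diff[symmetric] using int hV by simp
  then have "(LINT X|?M. s X * (norm (qgrad lam h X - U X))\<^sup>2) \<le> 0"
    using wLh0 UV by linarith
  then have "(LINT X|?M. s X * (norm (qgrad lam h X - U X))\<^sup>2) = 0"
    using nn by (intro antisym integral_nonneg_AE) auto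
  then have "AE X in ?M. s X * (norm (qgrad lam h X - U X))\<^sup>2 = 0"
    using integral_nonneg_eq_0_iff_AE[OF i] nn by auto
  then have "AE X in ?M. V X \<bullet> qgrad lam h X = 0"
    by eventually_elim (auto simp: V_def)
  then have "(LINT X|?M. V X \<bullet> qgrad lam h X) = 0" by (rule integral_eq_zero_AE)
  then have "(LINT X|?M. w X * Lh X) = 0" using hV by simp
  then have "AE X in ?M. w X * Lh X = 0"
    using integral_nonneg_eq_0_iff_AE[OF int(3)] wLh by auto
  with pos show ?thesis
    by eventually_elim (auto simp: w_def smooth_pos_eq_0 not_le[symmetric])
qed

end

section \<open>Spreading of positivity\<close>

lemma quad_one: "quad 1 Z X = (dist X Z)\<^sup>2"
  by (simp add: quad_def dist_prod_def dist_norm)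

text \<open>The weight vanishes only at x = 0, and there the x-difference to Z is nonzero;
  conversely, where the x-difference vanishes the weight is that of Z.\<close>

lemma grushin_form_pos:
  fixes X Z :: "'m::finite point"
  assumes "fst Z \<noteq> 0" "X \<noteq> Z"
  shows "0 < (fst X - fst Z)\<^sup>2 + \<bar>fst X\<bar> powr (2 * lam) * (norm (snd X - snd Z))\<^sup>2"
proof (cases "fst X = fst Z")
  case True
  then have "snd X \<noteq> snd Z" using assms(2) by (simp add: prod_eq_iff)
  with True assms(1) show ?thesis by simp
next
  case False
  then show ?thesis by (intro add_pos_nonneg) auto
qed

text \<open>Admissible curves are continuous. Lambda-connectedness enters the spreading argument in
  this form.\<close>

lemma Lambda_connected_imp_connected:
  assumes "Lambda_connected lam \<Omega>"
  shows "connected \<Omega>"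
  unfolding connected_iff_connected_component
proof (intro ballI)
  fix X Y assume "X \<in> \<Omega>" "Y \<in> \<Omega>"
  with assms obtain \<gamma> T where "0 \<le> T" "grushin_curve lam \<gamma> T" "\<gamma> ` {0..T} \<subseteq> \<Omega>" "\<gamma> 0 = X" "\<gamma> T = Y"
    unfolding Lambda_connected_def by blast
  moreover from this have "connected (\<gamma> ` {0..T})"
    by (intro connected_continuous_image) (auto simp: grushin_curve_def)
  ultimately show "connected_component \<Omega> X Y"
    unfolding connected_component_def by (intro exI[of _ "\<gamma> ` {0..T}"]) force
qed

context grushin_domain
begin

definition ess_positive_on :: "('m point \<Rightarrow> real) \<Rightarrow> 'm point set \<Rightarrow> bool" where
  "ess_positive_on u S \<longleftrightarrow> (\<exists>e>0. AE X in lebesgue_on \<Omega>. X \<in> S \<longrightarrow> e \<le> u X)"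

lemma ess_positive_on_subset: "ess_positive_on u S \<Longrightarrow> T \<subseteq> S \<Longrightarrow> ess_positive_on u T"
  unfolding ess_positive_on_def by (fast elim: eventually_mono)

lemma ess_positive_on_Union:
  assumes "finite I" "\<And>i. i \<in> I \<Longrightarrow> ess_positive_on u (S i)"
  shows "ess_positive_on u (\<Union>i\<in>I. S i)"
  using assms
proof (induction I rule: finite_induct)
  case empty
  then show ?case by (auto simp: ess_positive_on_def intro: exI[of _ 1])
next
  case (insert i I)
  then obtain d e where "0 < d" "AE X in lebesgue_on \<Omega>. X \<in> S i \<longrightarrow> d \<le> u X"
    "0 < e" "AE X in lebesgue_on \<Omega>. X \<in> (\<Union>i\<in>I. S i) \<longrightarrow> e \<le> u X"
  proof -
    have "ess_positive_on u (S i)" "ess_positive_on u (\<Union>i\<in>I. S i)" using insert by auto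
    then show ?thesis using that unfolding ess_positive_on_def by blast
  qed
  moreover from this(2,4) have "AE X in lebesgue_on \<Omega>. X \<in> (\<Union>i\<in>insert i I. S i) \<longrightarrow> min d e \<le> u X"
    by eventually_elim auto
  ultimately show ?case unfolding ess_positive_on_def by (intro exI[of _ "min d e"]) auto
qed

text \<open>For large \<open>a\<close> the barrier \<open>exp (- a |X - Z|\<^sup>2) - exp (- a R\<^sup>2)\<close> is a strict subsolution on an annulus around \<open>Z\<close>, because the spheres
  around a point off the hyperplane \<open>x = 0\<close> are nowhere characteristic.\<close>

lemma ess_positive_on_larger_ball:
  assumes u: "converges \<phi> u U" and super: "weak_supersolution U" and nonneg: "AE X in lebesgue_on \<Omega>. 0 \<le> u X"
    and Z: "fst Z \<noteq> 0" and R: "0 < \<rho>" "0 < R'" "R' < R" "cball Z R \<subseteq> \<Omega>" and pos: "ess_positive_on u (ball Z \<rho>)"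
  shows "ess_positive_on u (ball Z R')"
proof -
  let ?M = "lebesgue_on \<Omega>"
  obtain \<epsilon> where \<epsilon>: "0 < \<epsilon>" "AE X in ?M. X \<in> ball Z \<rho> \<longrightarrow> \<epsilon> \<le> u X"
    using pos by (auto simp: ess_positive_on_def)
  let ?a = "\<lambda>X :: 'm point. \<bar>fst X\<bar> powr (2 * lam)"
  \<comment> \<open>The form <A(X - Z), X - Z>. Together with \<open>N\<close> below, half of the
    operator applied to |X - Z|^2, it is all that enters \<open>grushin_quad\<close> for k =
    1.\<close>
  define B where "B X = (fst X - fst Z)\<^sup>2 + ?a X * (norm (snd X - snd Z))\<^sup>2" for X
  define D where "D = cball Z R - ball Z \<rho>"
  have D: "compact D" by (auto simp: D_def intro!: compact_diff)
  have ac: "continuous_on S ?a" for S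
    using lam by (auto intro!: continuous_intros continuous_on_powr')
  have Bc: "continuous_on S B" for S
    unfolding B_def[abs_def] by (intro continuous_intros ac)
  obtain c where c: "0 < c" "\<And>X. X \<in> D \<Longrightarrow> c \<le> B X"
  proof (cases "D = {}")
    case False
    then obtain Y where "Y \<in> D" "\<And>X. X \<in> D \<Longrightarrow> B Y \<le> B X"
      using continuous_attains_inf[OF D False Bc] by blast
    moreover have "0 < B Y" unfolding B_def using \<open>Y \<in> D\<close> R(1) by (intro grushin_form_pos Z) (auto simp: D_def)
    ultimately show ?thesis using that by blast
  qed (use that[of 1] in auto)
  define N where "N X = 1 + real CARD('m) * ?a X" for X
  have "compact (N ` D)" unfolding N_def[abs_def] by (intro compact_continuous_image D continuous_intros ac)
  then obtain M' where M': "\<And>X. X \<in> D \<Longrightarrow> N X \<le> M'"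
    using compact_imp_bounded bounded_imp_bdd_above unfolding bdd_above_def by (metis image_eqI)
  \<comment> \<open>The maximum with 1 keeps M positive when the annulus is empty.\<close>
  define M where "M = max M' 1"
  have M: "0 < M" "\<And>X. X \<in> D \<Longrightarrow> N X \<le> M" using M' by (auto simp: M_def intro: max.coboundedI1)
  \<comment> \<open>On the annulus 4 \<alpha> B is then at least 4 M, which beats the term 2 N
    coming from \<open>f1\<close>.\<close>
  define \<alpha> where "\<alpha> = M / c"
  have \<alpha>: "0 < \<alpha>" using M c by (simp add: \<alpha>_def)
  \<comment> \<open>The factor \<epsilon> keeps the barrier below \<epsilon>, hence below u on the
    inner ball; subtracting the value at R makes it nonpositive outside the outer one.\<close>
  define f where "f s = \<epsilon> * (exp (- \<alpha> * s) - exp (- \<alpha> * R\<^sup>2))" for s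
  define f1 where "f1 s = - \<epsilon> * \<alpha> * exp (- \<alpha> * s)" for s
  define f2 where "f2 s = \<epsilon> * \<alpha>\<^sup>2 * exp (- \<alpha> * s)" for s
  have df: "(f has_real_derivative f1 s) (at s)" "(f1 has_real_derivative f2 s) (at s)" for s
    unfolding f_def[abs_def] f1_def[abs_def] f2_def
    by (auto intro!: derivative_eq_intros simp: power2_eq_square)
  have fc: "continuous_on S f1" "continuous_on S f2" for S
    unfolding f1_def[abs_def] f2_def[abs_def] by (intro continuous_intros)+
  define h where "h X = f (quad 1 Z X)" for X
  define Lh where "Lh = grushin_quad lam 1 Z f1 f2"
  have Lpos: "0 < Lh X" if "X \<in> D" for X
  proof -
    have "M * 2 < 4 * \<alpha> * c" using M c by (simp add: \<alpha>_def)
    also have "\<dots> \<le> 4 * \<alpha> * B X" using c(2)[OF that] \<alpha> by simp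
    finally have "0 < \<epsilon> * \<alpha> * exp (- \<alpha> * quad 1 Z X) * (4 * \<alpha> * B X - 2 * N X)"
      using M(2)[OF that] \<epsilon> \<alpha> by (intro mult_pos_pos) auto
    also have "\<dots> = Lh X"
      by (simp add: Lh_def grushin_quad_def B_def N_def f1_def f2_def power2_eq_square algebra_simps)
    finally show ?thesis .
  qed
  have le: "AE X in ?M. h X \<le> u X"
  proof (rule comparison_principle[OF u super])
    note hD = quad_comp_grad[of f f1 1 Z, OF df(1)]
    show "h differentiable (at X)" for X
      unfolding h_def[abs_def] differentiable_def using hD by blast
    have "grad h = (\<lambda>X. (2 * f1 (quad 1 Z X) * (fst X - fst Z), (2 * 1 * f1 (quad 1 Z X)) *\<^sub>R (snd X - snd Z)))"
      unfolding h_def[abs_def] by (rule ext, rule grad_eqI, rule hD)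
    moreover have "continuous_on UNIV (\<lambda>X. f1 (quad 1 Z X))"
      by (rule continuous_on_compose2[OF fc(1) continuous_on_quad subset_UNIV])
    ultimately show "continuous_on UNIV (grad h)"
      by (auto intro!: continuous_intros)
    show "continuous_on UNIV Lh"
      unfolding Lh_def by (intro continuous_on_grushin_quad lam fc)
    show "(LINT X|?M. qgrad lam \<zeta> X \<bullet> qgrad lam h X) = - (LINT X|?M. \<zeta> X * Lh X)" if "\<zeta> \<in> C1_0 \<Omega>" for \<zeta>
      unfolding h_def[abs_def] Lh_def by (rule quad_by_parts[OF df fc(2) that])
    have hpos: "dist X Z < R" if "0 < h X" for X
    proof -
      have "exp (- \<alpha> * R\<^sup>2) < exp (- \<alpha> * (dist X Z)\<^sup>2)"
        using that \<epsilon>(1) by (simp add: h_def f_def quad_one zero_less_mult_iff)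
      then have "(dist X Z)\<^sup>2 < R\<^sup>2" using \<alpha> by simp
      then show ?thesis by (rule power_less_imp_less_base) (use R in simp)
    qed
    show "h X \<le> 0" if "X \<notin> cball Z R" for X
      using hpos[of X] that by (force simp: dist_commute)
    have hle: "h X \<le> \<epsilon>" for X
    proof -
      have "exp (- \<alpha> * quad 1 Z X) - exp (- \<alpha> * R\<^sup>2) \<le> 1"
        using \<alpha> quad_nonneg[of 1 Z X] by (smt (verit) exp_ge_zero exp_le_one_iff mult_nonneg_nonneg mult_minus_left)
      then show ?thesis using \<epsilon>(1) by (simp add: h_def f_def mult_left_le)
    qed
    show "AE X in ?M. u X < h X \<longrightarrow> 0 < Lh X"
      using nonneg \<epsilon>(2)
    proof eventually_elim
      case (elim X)
      show ?case
      proof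
        assume "u X < h X"
        then have "X \<notin> ball Z \<rho>" "dist X Z < R" using elim hle[of X] hpos[of X] by auto
        then show "0 < Lh X" by (intro Lpos) (auto simp: D_def dist_commute)
      qed
    qed
  qed (use R in auto)
  have low: "\<epsilon> * (exp (- \<alpha> * R'\<^sup>2) - exp (- \<alpha> * R\<^sup>2)) \<le> h X" if "X \<in> ball Z R'" for X
  proof -
    have "(dist X Z)\<^sup>2 \<le> R'\<^sup>2" using that by (intro power_mono) (auto simp: dist_commute)
    then show ?thesis using \<epsilon>(1) \<alpha> by (simp add: h_def f_def quad_one)
  qed
  have "AE X in ?M. X \<in> ball Z R' \<longrightarrow> \<epsilon> * (exp (- \<alpha> * R'\<^sup>2) - exp (- \<alpha> * R\<^sup>2)) \<le> u X"
    using le by eventually_elim (use low in \<open>blast intro: order_trans\<close>)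
  moreover have "0 < \<epsilon> * (exp (- \<alpha> * R'\<^sup>2) - exp (- \<alpha> * R\<^sup>2))"
    using \<epsilon>(1) \<alpha> R by (simp add: power_strict_mono)
  ultimately show ?thesis unfolding ess_positive_on_def by blast
qed

text \<open>For closedness, take a positivity point Y' close to Y. A tiny shift in the x-direction
  gives a centre off the hyperplane that is still inside the positivity ball of Y', and the enlarged
  ball about this centre reaches over Y.\<close>

lemma ess_positive_everywhere:
  assumes u: "converges \<phi> u U" and super: "weak_supersolution U" and nonneg: "AE X in lebesgue_on \<Omega>. 0 \<le> u X"
    and conn: "connected \<Omega>" and start: "X0 \<in> \<Omega>" "0 < r0" "ess_positive_on u (ball X0 r0)" and X: "X \<in> \<Omega>"
  shows "\<exists>r>0. ess_positive_on u (ball X r)"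
proof -
  define P where "P = {X \<in> \<Omega>. \<exists>r>0. ess_positive_on u (ball X r)}"
  have "open P"
    unfolding open_contains_ball
  proof
    fix Y assume "Y \<in> P"
    then obtain r where r: "0 < r" "ess_positive_on u (ball Y r)" and "Y \<in> \<Omega>" by (auto simp: P_def)
    obtain s where s: "0 < s" "ball Y s \<subseteq> \<Omega>" using open_\<Omega> \<open>Y \<in> \<Omega>\<close> by (meson openE)
    have "Y' \<in> P" if "Y' \<in> ball Y (min r s)" for Y'
    proof -
      have "ball Y' (r - dist Y Y') \<subseteq> ball Y r" by (simp add: ball_subset_ball_iff dist_commute)
      then show ?thesis
        using that s r ess_positive_on_subset unfolding P_def
        by (auto intro!: exI[of _ "r - dist Y Y'"])
    qed
    then show "\<exists>e>0. ball Y e \<subseteq> P" using r s by (intro exI[of _ "min r s"]) auto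
  qed
  moreover have "open (\<Omega> - P)"
    unfolding open_contains_ball
  proof
    fix Y assume Y: "Y \<in> \<Omega> - P"
    then obtain d where d: "0 < d" "cball Y (4 * d) \<subseteq> \<Omega>"
      using open_\<Omega> by (metis DiffD1 open_contains_cball times_divide_eq_right nonzero_mult_div_cancel_left zero_neq_numeral divide_pos_pos zero_less_numeral)
    have "Y' \<notin> P" if Y': "Y' \<in> ball Y (d / 2)" for Y'
    proof
      assume "Y' \<in> P"
      then obtain r where r: "0 < r" "ess_positive_on u (ball Y' r)" by (auto simp: P_def)
      define m where "m = min r (d / 2)"
      have m: "0 < m" "m \<le> r" "m \<le> d / 2" using r d by (auto simp: m_def)
      \<comment> \<open>At most one of m / 2 and m / 3 shifts Y' onto x = 0, and both are below
        m.\<close>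
      obtain t where t: "0 < t" "t < m" "fst Y' + t \<noteq> 0"
      proof (cases "fst Y' + m / 2 = 0")
        case True
        then show ?thesis using that[of "m / 3"] m by (simp add: field_simps)
      next
        case False
        then show ?thesis using that[of "m / 2"] m by simp
      qed
      define Z where "Z = Y' + (t, 0)"
      have dZ: "dist Z Y' = t" using t by (simp add: Z_def dist_norm)
      then have dZY: "dist Z Y < d" using Y' t m dist_triangle[of Z Y Y'] by (simp add: dist_commute)
      have "ball Z (m - t) \<subseteq> ball Y' r" using dZ m t by (simp add: ball_subset_ball_iff)
      then have "ess_positive_on u (ball Z (m - t))" using r ess_positive_on_subset by blast
      moreover have "fst Z \<noteq> 0" using t by (simp add: Z_def)
      \<comment> \<open>Z is less than d away from Y: radius 3 d about Z stays within radius 4 d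
        about Y, and radius 2 d about Z covers radius d about Y.\<close>
      moreover have "cball Z (3 * d) \<subseteq> \<Omega>"
        using d(2) dZY cball_subset_cball_iff[of Z "3 * d" Y "4 * d"] by auto
      ultimately have "ess_positive_on u (ball Z (2 * d))"
        using ess_positive_on_larger_ball[OF u super nonneg, of Z "m - t" "2 * d" "3 * d"] d(1) t(2) by simp
      moreover have "ball Y d \<subseteq> ball Z (2 * d)" using dZY by (simp add: ball_subset_ball_iff dist_commute)
      ultimately have "ess_positive_on u (ball Y d)" using ess_positive_on_subset by blast
      with Y d show False by (auto simp: P_def)
    qed
    moreover have "ball Y (d / 2) \<subseteq> \<Omega>" using d by (auto intro!: order_trans[OF _ d(2)])
    ultimately show "\<exists>e>0. ball Y e \<subseteq> \<Omega> - P" using d by (intro exI[of _ "d / 2"]) auto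
  qed
  ultimately have "P \<inter> \<Omega> = {} \<or> (\<Omega> - P) \<inter> \<Omega> = {}"
    using conn by (intro connectedD) (auto simp: P_def)
  moreover have "X0 \<in> P" using start by (auto simp: P_def)
  ultimately show ?thesis using X start by (auto simp: P_def)
qed

end

section \<open>A truncated fundamental solution\<close>

lemma continuous_antiderivative:
  fixes f :: "real \<Rightarrow> real"
  assumes "continuous_on UNIV f"
  shows "\<exists>F. F c = 0 \<and> (\<forall>s. (F has_real_derivative f s) (at s))"
proof -
  have "isCont f x" for x using assms by (simp add: continuous_on_eq_continuous_at)
  then obtain F where F: "\<And>s. (F has_vector_derivative f s) (at s)"
    using einterval_antiderivative[of "- \<infinity>" \<infinity> f] by auto
  have "((\<lambda>s. F s - F c) has_real_derivative f s) (at s)" for s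
    using F[of s] unfolding has_real_derivative_iff_has_vector_derivative[symmetric]
    by (auto intro!: derivative_eq_intros)
  then show ?thesis by (intro exI[of _ "\<lambda>s. F s - F c"]) auto
qed

lemma nondecreasing_of_deriv:
  fixes F F' :: "real \<Rightarrow> real"
  assumes "\<And>s. (F has_real_derivative F' s) (at s)" "\<And>s. 0 \<le> F' s" "a \<le> b"
  shows "F a \<le> F b"
  using DERIV_nonneg_imp_nondecreasing[OF assms(3)] assms(1,2) by blast

text \<open>With \<open>s = (r - \<rho>)\<^sup>+\<close> the derivative of the profile with respect to \<open>\<rho>\<^sup>2\<close> is \<open>- s\<^sup>2 / \<rho>\<^sup>N\<close> for \<open>\<rho> \<ge> d\<close>,
  as for the fundamental solution of the Laplacian up to the factor \<open>s\<^sup>2\<close>, whose decrease absorbs the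
  first-order variation of the coefficients.\<close>

lemma kernel_profile:
  fixes d r :: real and N :: nat
  assumes d: "0 < d" "d < r"
  obtains f f1 f2 :: "real \<Rightarrow> real" where
    "\<And>q. (f has_real_derivative f1 q) (at q)" "\<And>q. (f1 has_real_derivative f2 q) (at q)"
    "continuous_on UNIV f2" "\<And>q. 0 \<le> f q" "\<And>q. r\<^sup>2 \<le> q \<Longrightarrow> f q = 0"
    "\<And>q. f1 q \<le> 0" "\<And>q. 0 \<le> f2 q"
    "\<And>\<rho>. d \<le> \<rho> \<Longrightarrow> f1 (\<rho>\<^sup>2) = - ((max (r - \<rho>) 0)\<^sup>2 / \<rho> ^ N)"
    "\<And>\<rho>. d \<le> \<rho> \<Longrightarrow> f2 (\<rho>\<^sup>2) = max (r - \<rho>) 0 * (real N * max (r - \<rho>) 0 + 2 * \<rho>) / (2 * \<rho> ^ (N + 2))"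
    "\<And>q. 0 \<le> q \<Longrightarrow> - ((real N + 4) * r\<^sup>2 / (2 * d ^ N)) \<le> f1 q"
proof -
  define s where "s \<rho> = max (r - \<rho>) 0" for \<rho>
  \<comment> \<open>The derivative of \<open>- s^2 / \<rho>^N\<close> with respect to
    \<open>\<rho>^2\<close>, obtained as \<open>1 / (2 \<rho>)\<close> times the derivative in
    \<rho>.\<close>
  define H where "H \<rho> = s \<rho> * (real N * s \<rho> + 2 * \<rho>) / (2 * \<rho> ^ (N + 2))" for \<rho>
  \<comment> \<open>Clamping the argument at d freezes the second derivative near the pole, which
    removes the singularity and keeps \<open>f2\<close> continuous and nonnegative.\<close>
  define f2 where "f2 q = H (sqrt (max q (d\<^sup>2)))" for q
  have sq: "d \<le> sqrt (max q (d\<^sup>2))" for q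
    using d by (intro real_le_rsqrt) auto
  have f2c: "continuous_on UNIV f2"
  proof -
    have "sqrt (max q (d\<^sup>2)) ^ (N + 2) \<noteq> 0" for q
    proof -
      have "0 < sqrt (max q (d\<^sup>2))" using sq[of q] d by linarith
      then show ?thesis by simp
    qed
    then show ?thesis
      unfolding f2_def[abs_def] H_def s_def by (intro continuous_intros) auto
  qed
  \<comment> \<open>Both integration constants are fixed at \<open>r^2\<close>, where the truncation
    sets in, so that \<open>f1\<close> and then \<open>f\<close> vanish beyond it.\<close>
  obtain f1 where f1: "f1 (r\<^sup>2) = 0" "\<And>q. (f1 has_real_derivative f2 q) (at q)"
    using continuous_antiderivative[OF f2c] by blast
  have f1c: "continuous_on UNIV f1"
    using f1(2) by (auto intro!: continuous_at_imp_continuous_on DERIV_isCont)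
  obtain f where f: "f (r\<^sup>2) = 0" "\<And>q. (f has_real_derivative f1 q) (at q)"
    using continuous_antiderivative[OF f1c] by blast
  have f2_nonneg: "0 \<le> f2 q" for q
  proof -
    have "0 \<le> sqrt (max q (d\<^sup>2))" using sq[of q] d by linarith
    moreover have "0 \<le> s \<rho>" for \<rho> by (simp add: s_def)
    ultimately show ?thesis
      unfolding f2_def H_def
      by (intro divide_nonneg_nonneg mult_nonneg_nonneg add_nonneg_nonneg zero_le_power) auto
  qed
  have f1_mono: "f1 p \<le> f1 q" if "p \<le> q" for p q
    by (rule nondecreasing_of_deriv[OF f1(2) f2_nonneg that])
  have f2\<rho>: "f2 (\<rho>\<^sup>2) = H \<rho>" if "d \<le> \<rho>" for \<rho>
  proof -
    have "max (\<rho>\<^sup>2) (d\<^sup>2) = \<rho>\<^sup>2" using that d by (intro max_absorb1 power_mono) auto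
    then show ?thesis using that d by (simp add: f2_def)
  qed
  have f1\<rho>: "f1 (\<rho>\<^sup>2) = - ((s \<rho>)\<^sup>2 / \<rho> ^ N)" if \<rho>: "d \<le> \<rho>" for \<rho>
  proof -
    \<comment> \<open>D has zero derivative on [d, oo) and vanishes at r, which gives the closed
      form of \<open>f1\<close>.\<close>
    define D where "D \<rho> = f1 (\<rho>\<^sup>2) + (s \<rho>)\<^sup>2 / \<rho> ^ N" for \<rho>
    have Dd: "(D has_real_derivative 0) (at x)" if x: "d \<le> x" for x
    proof -
      have 1: "((\<lambda>x. f1 (x\<^sup>2)) has_real_derivative H x * (2 * x)) (at x)"
        using DERIV_chain2[where f = f1 and g = "\<lambda>x. x\<^sup>2" and x = x and s = UNIV, OF f1(2)] f2\<rho>[OF x]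
          DERIV_pow[of 2 x UNIV] by simp
      have 2: "((\<lambda>x. (s x)\<^sup>2) has_real_derivative - 2 * s x) (at x)"
      proof -
        have "((\<lambda>x. r - x) has_real_derivative - 1) (at x)" by (auto intro!: derivative_eq_intros)
        from DERIV_chain2[where f = "\<lambda>s. (max s 0)\<^sup>2" and g = "\<lambda>x. r - x", OF max_square_deriv this]
        show ?thesis unfolding s_def by simp
      qed
      have 3: "((\<lambda>x. x ^ N) has_real_derivative real N * x ^ (N - 1)) (at x)"
        using DERIV_pow[of N x UNIV] by simp
      have x0: "0 < x" using x d by simp
      have N1: "real N * x ^ (N - 1) = real N * x ^ N / x"
        using x0 by (cases N) (auto simp: field_simps)
      have "((\<lambda>x. (s x)\<^sup>2 / x ^ N) has_real_derivative
          (- 2 * s x * x ^ N - (s x)\<^sup>2 * (real N * x ^ N / x)) / (x ^ N * x ^ N)) (at x)"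
        using DERIV_divide[OF 2 3] x0 unfolding N1 by simp
      also have "(- 2 * s x * x ^ N - (s x)\<^sup>2 * (real N * x ^ N / x)) / (x ^ N * x ^ N) = - (H x * (2 * x))"
        using x0 by (simp add: H_def field_simps power2_eq_square)
      finally show ?thesis unfolding D_def[abs_def] using DERIV_add[OF 1] by fastforce
    qed
    have "D x = D y" if xy: "d \<le> x" "x < y" for x y
    proof -
      obtain z where "x < z" "z < y" "D y - D x = (y - x) * 0"
        using MVT2[OF xy(2), of D "\<lambda>_. 0"] Dd xy(1) by fastforce
      then show ?thesis by simp
    qed
    then have "D \<rho> = D r" using \<rho> d by (cases \<rho> r rule: linorder_cases) force+
    then show ?thesis using f1(1) by (simp add: D_def s_def)
  qed
  have f1_zero: "f1 q = 0" if "r\<^sup>2 \<le> q" for q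
  proof -
    have "r \<le> sqrt q" using that d by (simp add: real_le_rsqrt)
    moreover have "0 \<le> q" using that order_trans[OF zero_le_power2] by blast
    ultimately show ?thesis using f1\<rho>[of "sqrt q"] d by (simp add: s_def)
  qed
  have f1_nonpos: "f1 q \<le> 0" for q
    using f1_mono[of q "r\<^sup>2"] f1_zero[of q] f1(1) by (cases "q \<le> r\<^sup>2") auto
  have f_anti: "f q \<le> f p" if "p \<le> q" for p q
    using DERIV_nonpos_imp_nonincreasing[OF that, of f] f(2) f1_nonpos by blast
  have f_zero: "f q = 0" if "r\<^sup>2 \<le> q" for q
  proof (cases "q = r\<^sup>2")
    case False
    with that have lt: "r\<^sup>2 < q" by simp
    obtain z where "r\<^sup>2 < z" "f q - f (r\<^sup>2) = (q - r\<^sup>2) * f1 z"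
      using MVT2[OF lt, of f f1] f(2) by blast
    then show ?thesis using f1_zero[of z] f(1) by simp
  qed (simp add: f)
  have f_nonneg: "0 \<le> f q" for q
    using f_anti[of q "r\<^sup>2"] f_zero[of q] f(1) by (cases "q \<le> r\<^sup>2") auto
  have low: "- ((real N + 4) * r\<^sup>2 / (2 * d ^ N)) \<le> f1 q" if q: "0 \<le> q" for q
  proof -
    have sd: "0 \<le> s d" "s d \<le> r" using d by (auto simp: s_def)
    \<comment> \<open>Below \<open>d^2\<close> the clamped \<open>f2\<close> is the constant
      \<open>H d\<close>, so \<open>f1\<close> lies at most \<open>d^2 H d\<close> under its value
      at \<open>d^2\<close>.\<close>
    have fd: "f1 (d\<^sup>2) - d\<^sup>2 * H d \<le> f1 q"
    proof (cases "q < d\<^sup>2")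
      case True
      obtain z where z: "q < z" "z < d\<^sup>2" "f1 (d\<^sup>2) - f1 q = (d\<^sup>2 - q) * f2 z"
        using MVT2[OF True, of f1 f2] f1(2) by blast
      have "f2 z = H d" using z d by (simp add: f2_def max_def)
      moreover have "0 \<le> H d" using f2_nonneg[of "d\<^sup>2"] f2\<rho>[of d] by simp
      ultimately have "f1 (d\<^sup>2) - f1 q \<le> d\<^sup>2 * H d" using z q by (simp add: mult_right_mono)
      then show ?thesis by simp
    next
      case False
      moreover have "0 \<le> d\<^sup>2 * H d" using f2_nonneg[of "d\<^sup>2"] f2\<rho>[of d] by simp
      ultimately show ?thesis using f1_mono[of "d\<^sup>2" q] by simp
    qed
    have "f1 (d\<^sup>2) - d\<^sup>2 * H d = - (2 * (s d)\<^sup>2 + s d * (real N * s d + 2 * d)) / (2 * d ^ N)"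
      unfolding f1\<rho>[OF order_refl] H_def using d by (simp add: field_simps power2_eq_square)
    also have "\<dots> \<ge> - ((real N + 4) * r\<^sup>2 / (2 * d ^ N))"
    proof -
      have "(s d)\<^sup>2 \<le> r\<^sup>2" using sd by (intro power_mono)
      moreover have "s d * (real N * s d + 2 * d) \<le> r * (real N * r + 2 * r)"
        using sd d by (intro mult_mono add_mono mult_left_mono) auto
      ultimately have "2 * (s d)\<^sup>2 + s d * (real N * s d + 2 * d) \<le> (real N + 4) * r\<^sup>2"
        by (simp add: power2_eq_square algebra_simps)
      from divide_right_mono[OF this, of "2 * d ^ N"] show ?thesis
        using d by (simp only: minus_divide_left[symmetric] neg_le_iff_le) simp
    qed
    finally show ?thesis using fd by linarith
  qed
  show thesis
    by (rule that[OF f(2) f1(2) f2c f_nonneg f_zero f1_nonpos f2_nonneg _ _ low])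
       (use f1\<rho> f2\<rho> in \<open>auto simp: s_def H_def\<close>)
qed

text \<open>Relative Lipschitz continuity of the weight, by the mean value theorem on
  [|x0| / 2, 3 |x0| / 2]. One K serves all poles near x0, which is why a single kernel radius will
  work for all of them.\<close>

lemma powr_ratio_bound:
  fixes p x0 :: real
  assumes "0 < p" "x0 \<noteq> 0"
  shows "\<exists>K>0. \<forall>x y. \<bar>x - x0\<bar> \<le> \<bar>x0\<bar> / 2 \<longrightarrow> \<bar>y - x0\<bar> \<le> \<bar>x0\<bar> / 2 \<longrightarrow>
    \<bar>\<bar>x\<bar> powr p / \<bar>y\<bar> powr p - 1\<bar> \<le> K * \<bar>x - y\<bar>"
proof -
  define R where "R = \<bar>x0\<bar> / 2"
  have R: "0 < R" using assms by (simp add: R_def)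
  define L where "L = p * (3 * R) powr p / R"
  have L: "0 < L" using assms R by (simp add: L_def)
  have lip: "\<bar>s powr p - t powr p\<bar> \<le> L * \<bar>s - t\<bar>" if ts: "R \<le> t" "t < s" "s \<le> 3 * R" for s t
  proof -
    obtain z where z: "t < z" "z < s" "s powr p - t powr p = (s - t) * (p * z powr (p - 1))"
      using MVT2[OF ts(2), of "\<lambda>z. z powr p" "\<lambda>z. p * z powr (p - 1)"] ts R has_real_derivative_powr
      by fastforce
    \<comment> \<open>Bounding numerator and denominator separately avoids a distinction by the sign
      of p - 1.\<close>
    have "z powr (p - 1) = z powr p / z" using z ts R by (simp add: powr_diff)
    also have "\<dots> \<le> (3 * R) powr p / R" using z ts R assms by (intro frac_le powr_mono2) auto
    finally have "p * z powr (p - 1) \<le> p * ((3 * R) powr p / R)"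
      using assms by (intro mult_left_mono) auto
    then have "p * z powr (p - 1) \<le> L" by (simp add: L_def)
    then show ?thesis using z(3) ts z(1) R assms
      by (simp add: abs_mult mult.commute mult_left_mono)
  qed
  have lip': "\<bar>s powr p - t powr p\<bar> \<le> L * \<bar>s - t\<bar>" if "R \<le> t" "R \<le> s" "t \<le> 3 * R" "s \<le> 3 * R" for s t
    using lip[of t s] lip[of s t] that by (cases s t rule: linorder_cases) (auto simp: abs_minus_commute)
  have "\<bar>\<bar>x\<bar> powr p / \<bar>y\<bar> powr p - 1\<bar> \<le> (L / R powr p) * \<bar>x - y\<bar>"
    if "\<bar>x - x0\<bar> \<le> \<bar>x0\<bar> / 2" "\<bar>y - x0\<bar> \<le> \<bar>x0\<bar> / 2" for x y
  proof -
    have b: "R \<le> \<bar>x\<bar>" "\<bar>x\<bar> \<le> 3 * R" "R \<le> \<bar>y\<bar>" "\<bar>y\<bar> \<le> 3 * R"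
      using that unfolding R_def by linarith+
    have y: "0 < R powr p" "R powr p \<le> \<bar>y\<bar> powr p" using b R assms by (auto intro: powr_mono2)
    have "\<bar>\<bar>x\<bar> powr p / \<bar>y\<bar> powr p - 1\<bar> = \<bar>\<bar>x\<bar> powr p - \<bar>y\<bar> powr p\<bar> / \<bar>y\<bar> powr p"
    proof -
      have y0: "0 < \<bar>y\<bar> powr p" using y by linarith
      then have "\<bar>x\<bar> powr p / \<bar>y\<bar> powr p - 1 = (\<bar>x\<bar> powr p - \<bar>y\<bar> powr p) / \<bar>y\<bar> powr p"
        by (simp add: diff_divide_distrib)
      then show ?thesis using y0 by (simp only: abs_divide abs_of_pos)
    qed
    also have "\<dots> \<le> L * \<bar>x - y\<bar> / R powr p"
    proof (rule frac_le)
      show "\<bar>\<bar>x\<bar> powr p - \<bar>y\<bar> powr p\<bar> \<le> L * \<bar>x - y\<bar>"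
        using lip'[OF b(3,1,4,2)] L by (smt (verit) mult_left_mono)
    qed (use y L in auto)
    finally show ?thesis by simp
  qed
  moreover have "0 < L / R powr p" using L R by simp
  ultimately show ?thesis by blast
qed


lemma quad_le_dist:
  assumes "0 \<le> k"
  shows "quad k Z X \<le> (1 + k) * (dist X Z)\<^sup>2"
proof -
  have "(dist X Z)\<^sup>2 = (fst X - fst Z)\<^sup>2 + (norm (snd X - snd Z))\<^sup>2"
    using quad_one[of Z X] by (simp add: quad_def)
  then show ?thesis using assms by (simp add: quad_def algebra_simps)
qed

lemma dist_le_quad:
  assumes "0 < k" "inverse k \<le> b"
  shows "(dist X Z)\<^sup>2 \<le> (1 + b) * quad k Z X"
proof -
  have "(norm (snd X - snd Z))\<^sup>2 = inverse k * (k * (norm (snd X - snd Z))\<^sup>2)" using assms by simp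
  also have "\<dots> \<le> b * (k * (norm (snd X - snd Z))\<^sup>2)" using assms by (intro mult_right_mono) auto
  also have "\<dots> \<le> b * quad k Z X"
    using assms order_trans[OF _ assms(2), of 0] by (intro mult_left_mono) (auto simp: quad_def)
  finally have 1: "(norm (snd X - snd Z))\<^sup>2 \<le> b * quad k Z X" .
  have 2: "(fst X - fst Z)\<^sup>2 \<le> quad k Z X" using assms by (simp add: quad_def)
  have "(dist X Z)\<^sup>2 = (fst X - fst Z)\<^sup>2 + (norm (snd X - snd Z))\<^sup>2"
    using quad_one[of Z X] by (simp add: quad_def)
  with 1 2 show ?thesis by (simp add: algebra_simps)
qed

text \<open>The quadratic form \<open>quad k Z\<close> comes from freezing the coefficients at the pole \<open>Z\<close>.\<close>

lemma kernel_subsolution: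
  fixes lam :: real and X Z :: "'m::finite point" and f1 f2 :: "real \<Rightarrow> real"
  defines "N \<equiv> CARD('m) + 1" and "k \<equiv> inverse (\<bar>fst Z\<bar> powr (2 * lam))" and "\<rho> \<equiv> sqrt (quad (inverse (\<bar>fst Z\<bar> powr (2 * lam))) Z X)"
  assumes Z: "fst Z \<noteq> 0" and d: "0 < d" "d < r" and K: "0 < K" "2 * K * r * (1 + real N) \<le> 1"
    and ratio: "\<bar>fst X - fst Z\<bar> \<le> r \<Longrightarrow> \<bar>\<bar>fst X\<bar> powr (2 * lam) / \<bar>fst Z\<bar> powr (2 * lam) - 1\<bar> \<le> K * \<bar>fst X - fst Z\<bar>"
    and f: "\<And>q. f1 q \<le> 0" "\<And>q. 0 \<le> f2 q"
      "\<And>\<rho>. d \<le> \<rho> \<Longrightarrow> f1 (\<rho>\<^sup>2) = - ((max (r - \<rho>) 0)\<^sup>2 / \<rho> ^ N)"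
      "\<And>\<rho>. d \<le> \<rho> \<Longrightarrow> f2 (\<rho>\<^sup>2) = max (r - \<rho>) 0 * (real N * max (r - \<rho>) 0 + 2 * \<rho>) / (2 * \<rho> ^ (N + 2))"
      "\<And>q. 0 \<le> q \<Longrightarrow> - ((real N + 4) * r\<^sup>2 / (2 * d ^ N)) \<le> f1 q"
  shows "d \<le> \<rho> \<Longrightarrow> 0 \<le> grushin_quad lam k Z f1 f2 X"
    and "d \<le> \<rho> \<Longrightarrow> \<rho> \<le> r / 2 \<Longrightarrow> r / r ^ (N - 1) \<le> grushin_quad lam k Z f1 f2 X"
    and "\<rho> < d \<Longrightarrow> - (2 * real N * (real N + 4) * r\<^sup>2 / d ^ N) \<le> grushin_quad lam k Z f1 f2 X"
proof -
  define a where "a = \<bar>fst X\<bar> powr (2 * lam)"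
  define m where "m = real CARD('m)"
  have k: "0 < k" using Z by (simp add: k_def)
  have q: "quad k Z X = \<rho>\<^sup>2" using quad_nonneg[of k Z X] k by (simp add: \<rho>_def k_def)
  have \<rho>0: "0 \<le> \<rho>" using quad_nonneg[of k Z X] k by (simp add: \<rho>_def k_def)
  define B where "B = (fst X - fst Z)\<^sup>2 + a * k\<^sup>2 * (norm (snd X - snd Z))\<^sup>2"
  have L: "grushin_quad lam k Z f1 f2 X = 4 * f2 (\<rho>\<^sup>2) * B + 2 * f1 (\<rho>\<^sup>2) * (1 + m * (k * a))"
    by (simp add: grushin_quad_def q B_def a_def m_def mult.assoc)
  have N: "real N = m + 1" by (simp add: N_def m_def)
  have m0: "0 \<le> m" by (simp add: m_def)
  have x\<rho>: "\<bar>fst X - fst Z\<bar> \<le> \<rho>"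
  proof -
    have "(fst X - fst Z)\<^sup>2 \<le> \<rho>\<^sup>2" using k by (simp add: q[symmetric] quad_def)
    then show ?thesis using \<rho>0 by (simp add: abs_le_square_iff[symmetric])
  qed
  have B0: "0 \<le> B" by (simp add: B_def a_def)
  \<comment> \<open>For frozen coefficients k a would be 1 and B would be \<open>\<rho>^2\<close>.
    The deviation is measured by \<rho>, which dominates the x-distance to the pole.\<close>
  have near: "1 - K * \<rho> \<le> k * a" "k * a \<le> 1 + K * \<rho>" "(1 - K * \<rho>) * \<rho>\<^sup>2 \<le> B" if "\<rho> \<le> r"
  proof -
    have "\<bar>k * a - 1\<bar> \<le> K * \<bar>fst X - fst Z\<bar>"
      using ratio x\<rho> that by (simp add: k_def a_def divide_inverse mult.commute)
    also have "\<dots> \<le> K * \<rho>" using K x\<rho> by simp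
    finally show ka: "1 - K * \<rho> \<le> k * a" "k * a \<le> 1 + K * \<rho>" by auto
    have "(1 - K * \<rho>) * \<rho>\<^sup>2 = (1 - K * \<rho>) * (fst X - fst Z)\<^sup>2 + (1 - K * \<rho>) * (k * (norm (snd X - snd Z))\<^sup>2)"
      by (simp add: q[symmetric] quad_def algebra_simps)
    also have "\<dots> \<le> 1 * (fst X - fst Z)\<^sup>2 + (k * a) * (k * (norm (snd X - snd Z))\<^sup>2)"
      using ka(1) K \<rho>0 k by (intro add_mono mult_right_mono) auto
    also have "\<dots> = B" by (simp add: B_def power2_eq_square mult_ac)
    finally show "(1 - K * \<rho>) * \<rho>\<^sup>2 \<le> B" .
  qed
  have far: "2 * max (r - \<rho>) 0 * (\<rho> / \<rho> ^ N) \<le> grushin_quad lam k Z f1 f2 X" if \<rho>: "d \<le> \<rho>"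
  proof (cases "\<rho> \<le> r")
    case False
    then have "f1 (\<rho>\<^sup>2) = 0" "f2 (\<rho>\<^sup>2) = 0" using f(3,4)[OF \<rho>] by (simp_all add: max_def)
    with False show ?thesis by (simp add: L max_def)
  next
    case True
    define s where "s = max (r - \<rho>) 0"
    have s: "0 \<le> s" "s \<le> r" "s = r - \<rho>" using True \<rho> d by (auto simp: s_def)
    have \<rho>p: "0 < \<rho>" using \<rho> d by simp
    note f12 = f(3,4)[OF \<rho>, folded s_def]
    \<comment> \<open>With frozen coefficients the \<open>s^2\<close> terms cancel, as for a
      fundamental solution, and \<open>4 s \<rho> / \<rho>^N\<close> remains from differentiating
      the truncation factor. The smallness of K r lets the variation of the weight consume at most
      half of it.\<close>
    have "2 * s * (\<rho> / \<rho> ^ N) \<le> (2 * s * (\<rho> / \<rho> ^ N)) * (2 - 2 * K * \<rho> - K * (real N + m) * s)"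
    proof -
      have "2 * K * \<rho> + K * (real N + m) * s \<le> 2 * K * r + K * (2 * real N) * r"
        using K s True m0 N by (intro add_mono mult_mono) auto
      also have "\<dots> \<le> 1" using K(2) by (simp add: algebra_simps)
      finally have "1 \<le> 2 - 2 * K * \<rho> - K * (real N + m) * s" by simp
      moreover have "0 \<le> 2 * s * (\<rho> / \<rho> ^ N)" using s \<rho>p by simp
      ultimately show ?thesis by (metis mult.right_neutral mult_left_mono)
    qed
    also have "\<dots> = 4 * f2 (\<rho>\<^sup>2) * ((1 - K * \<rho>) * \<rho>\<^sup>2) + 2 * f1 (\<rho>\<^sup>2) * (1 + m * (1 + K * \<rho>))"
      unfolding f12 N using \<rho>p by (simp add: field_simps power2_eq_square)
    also have "\<dots> \<le> 4 * f2 (\<rho>\<^sup>2) * B + 2 * f1 (\<rho>\<^sup>2) * (1 + m * (k * a))"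
    proof (rule add_mono)
      show "4 * f2 (\<rho>\<^sup>2) * ((1 - K * \<rho>) * \<rho>\<^sup>2) \<le> 4 * f2 (\<rho>\<^sup>2) * B"
        using near(3)[OF True] f(2) by (intro mult_left_mono) auto
      show "2 * f1 (\<rho>\<^sup>2) * (1 + m * (1 + K * \<rho>)) \<le> 2 * f1 (\<rho>\<^sup>2) * (1 + m * (k * a))"
        using near(2)[OF True] f(1)[of "\<rho>\<^sup>2"] m0 by (intro mult_left_mono_neg add_left_mono mult_left_mono) auto
    qed
    finally show ?thesis by (simp add: L s_def)
  qed
  show "0 \<le> grushin_quad lam k Z f1 f2 X" if "d \<le> \<rho>"
    using order_trans[OF _ far[OF that]] \<rho>0 by simp
  show "r / r ^ (N - 1) \<le> grushin_quad lam k Z f1 f2 X" if \<rho>: "d \<le> \<rho>" "\<rho> \<le> r / 2"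
  proof -
    have \<rho>p: "0 < \<rho>" using \<rho> d by simp
    have "r / r ^ (N - 1) \<le> (2 * max (r - \<rho>) 0) / \<rho> ^ (N - 1)"
      using \<rho> \<rho>p d by (intro frac_le power_mono) auto
    also have "\<dots> = 2 * max (r - \<rho>) 0 * (\<rho> / \<rho> ^ N)"
      using \<rho>p by (simp add: N_def)
    finally show ?thesis using far[OF \<rho>(1)] by simp
  qed
  show "- (2 * real N * (real N + 4) * r\<^sup>2 / d ^ N) \<le> grushin_quad lam k Z f1 f2 X" if \<rho>: "\<rho> < d"
  proof -
    \<comment> \<open>In the core the nonnegative \<open>f2\<close> term is dropped; what is left is
      the lower bound on \<open>f1\<close> times a trace of at most 2 N.\<close>
    define C where "C = (real N + 4) * r\<^sup>2 / (2 * d ^ N)"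
    have C: "0 \<le> C" using d by (simp add: C_def)
    have "K * \<rho> \<le> K * r" using \<rho> d K by simp
    also have "\<dots> \<le> K * r * (2 * (1 + real N))" using K d mult_left_mono[of 1 "2 * (1 + real N)" "K * r"] by simp
    also have "\<dots> \<le> 1" using K(2) by (simp add: algebra_simps)
    finally have "k * a \<le> 2" using near(2) \<rho> d by simp
    then have ka: "1 + m * (k * a) \<le> 2 * real N" "0 \<le> 1 + m * (k * a)"
      using m0 k mult_left_mono[of "k * a" 2 m] by (auto simp: N a_def)
    have "- (2 * real N * (real N + 4) * r\<^sup>2 / d ^ N) = - (2 * C * (2 * real N))"
      by (simp add: C_def)
    also have "\<dots> \<le> - (2 * C * (1 + m * (k * a)))"
      using C ka mult_left_mono[of "1 + m * (k * a)" "2 * real N" "2 * C"] by simp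
    also have "\<dots> \<le> 2 * f1 (\<rho>\<^sup>2) * (1 + m * (k * a))"
    proof -
      have "- (2 * C) \<le> 2 * f1 (\<rho>\<^sup>2)" using f(5)[of "\<rho>\<^sup>2", folded C_def] by simp
      from mult_right_mono[OF this ka(2)] show ?thesis by simp
    qed
    also have "\<dots> \<le> grushin_quad lam k Z f1 f2 X"
      using f(2)[of "\<rho>\<^sup>2"] B0 by (simp add: L)
    finally show ?thesis .
  qed
qed

section \<open>Positivity on some ball\<close>

context grushin_domain
begin

text \<open>A fixed h is represented by the constant sequence. Moving the derivatives of the
  approximations of u onto h leaves an inequality in u alone, with no quasi-gradient.\<close>

lemma weak_supersolution_test:
  assumes super: "weak_supersolution U" and u: "converges \<phi> u U"
    and h: "h \<in> C1_0 \<Omega>" "\<And>X. 0 \<le> h X" and Lh: "continuous_on UNIV Lh"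
    and parts: "\<And>\<zeta>. \<zeta> \<in> C1_0 \<Omega> \<Longrightarrow>
      (LINT X|lebesgue_on \<Omega>. qgrad lam \<zeta> X \<bullet> qgrad lam h X) = - (LINT X|lebesgue_on \<Omega>. \<zeta> X * Lh X)"
  shows "(LINT X|lebesgue_on \<Omega>. u X * Lh X) \<le> 0"
proof -
  have LhL: "Lh \<in> L2_space \<Omega>" and hL: "h \<in> L2_space \<Omega>"
    using Lh C1_0D(3)[OF h(1)] by (auto intro: continuous_L2_space open_\<Omega> bounded_\<Omega>)
  have "converges (\<lambda>_. h) h (qgrad lam h)"
    using h(1) hL qgrad_L2 by (auto simp: converges_def intro: L2_tendsto_const)
  then have "0 \<le> (LINT X|lebesgue_on \<Omega>. U X \<bullet> qgrad lam h X)"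
    using super h(2) unfolding weak_supersolution_def by blast
  moreover have "(\<lambda>n. LINT X|lebesgue_on \<Omega>. qgrad lam (\<phi> n) X \<bullet> qgrad lam h X) \<longlonglongrightarrow> (LINT X|lebesgue_on \<Omega>. U X \<bullet> qgrad lam h X)"
    using u by (intro L2_tendsto_inner qgrad_L2 h) (simp add: converges_def)
  moreover have "(\<lambda>n. LINT X|lebesgue_on \<Omega>. \<phi> n X * Lh X) \<longlonglongrightarrow> (LINT X|lebesgue_on \<Omega>. u X * Lh X)"
    using u L2_tendsto_inner[of \<Omega> \<phi> u Lh] LhL by (simp add: converges_def)
  moreover have "(LINT X|lebesgue_on \<Omega>. qgrad lam (\<phi> n) X \<bullet> qgrad lam h X) = - (LINT X|lebesgue_on \<Omega>. \<phi> n X * Lh X)" for n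
    using u by (intro parts) (simp add: converges_def)
  ultimately have "0 \<le> - (LINT X|lebesgue_on \<Omega>. u X * Lh X)"
    by (metis (no_types, lifting) LIMSEQ_unique tendsto_minus ext)
  then show ?thesis by simp
qed

text \<open>Testing with the truncated fundamental solution with pole \<open>Z\<close>, regularised at scale \<open>d\<close>, bounds the
  mean of \<open>u\<close> over a ball of radius comparable to \<open>d\<close> around \<open>Z\<close> from below by the integral of \<open>u\<close> over a
  fixed ball.\<close>

lemma ess_positive_near:
  assumes u: "converges \<phi> u U" and super: "weak_supersolution U" and nonneg: "AE X in lebesgue_on \<Omega>. 0 \<le> u X"
    and Y: "Y \<in> \<Omega>" "fst Y \<noteq> 0" and nz: "\<And>e. 0 < e \<Longrightarrow> \<not> (AE X in lebesgue_on \<Omega>. X \<in> ball Y e \<longrightarrow> u X = 0)"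
  shows "\<exists>e>0. ess_positive_on u (ball Y e)"
proof -
  let ?M = "lebesgue_on \<Omega>"
  let ?a = "\<lambda>X :: 'm point. \<bar>fst X\<bar> powr (2 * lam)"
  define N where "N = CARD('m) + 1"
  obtain R0 where R0: "0 < R0" "cball Y R0 \<subseteq> \<Omega>" using open_\<Omega> Y(1) by (meson open_contains_cball)
  \<comment> \<open>Staying within |fst Y| / 2 of Y keeps the weight between positive constants and
    makes the ratio bound uniform in the pole.\<close>
  define R where "R = min R0 (\<bar>fst Y\<bar> / 2)"
  have R: "0 < R" "cball Y R \<subseteq> \<Omega>" "R \<le> \<bar>fst Y\<bar> / 2" using R0 Y(2) by (auto simp: R_def)
  obtain K where K: "0 < K" and ratio: "\<And>x y. \<bar>x - fst Y\<bar> \<le> R \<Longrightarrow> \<bar>y - fst Y\<bar> \<le> R \<Longrightarrow>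
      \<bar>\<bar>x\<bar> powr (2 * lam) / \<bar>y\<bar> powr (2 * lam) - 1\<bar> \<le> K * \<bar>x - y\<bar>"
    using powr_ratio_bound[of "2 * lam" "fst Y"] lam Y(2) R(3) by fastforce
  define a1 where "a1 = (2 * \<bar>fst Y\<bar>) powr (2 * lam)"
  define a0 where "a0 = (\<bar>fst Y\<bar> / 2) powr (2 * lam)"
  have a01: "0 < a0" "0 \<le> a1" using Y(2) by (auto simp: a0_def a1_def)
  have abnd: "a0 \<le> ?a Z" "?a Z \<le> a1" "fst Z \<noteq> 0" if "\<bar>fst Z - fst Y\<bar> \<le> R" for Z
  proof -
    have "\<bar>fst Y\<bar> / 2 \<le> \<bar>fst Z\<bar>" "\<bar>fst Z\<bar> \<le> 2 * \<bar>fst Y\<bar>" using that R(3) by auto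
    then show "a0 \<le> ?a Z" "?a Z \<le> a1" "fst Z \<noteq> 0"
      using lam Y(2) unfolding a0_def a1_def by (auto intro!: powr_mono2)
  qed
  define A where "A = sqrt (1 + a1)"
  define B where "B = sqrt (1 + inverse a0)"
  have AB: "0 < A" "0 < B" using a01 by (auto simp: A_def B_def add_pos_nonneg)
  \<comment> \<open>The first bound keeps the kernel support, within Euclidean distance A r of the
    pole, inside \<open>cball Y R\<close>, and also gives r <= R / 2; the second is the smallness
    condition of \<open>kernel_subsolution\<close>.\<close>
  define r where "r = min (R / (2 * (1 + A))) (1 / (2 * K * (1 + real N)))"
  have r: "0 < r" using R K AB by (auto simp: r_def)
  have rR: "r * (1 + A) \<le> R / 2"
  proof -
    have "r * (1 + A) \<le> R / (2 * (1 + A)) * (1 + A)" using AB by (intro mult_right_mono) (auto simp: r_def)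
    moreover have "R / (2 * (1 + A)) * (1 + A) = R / 2" using AB by (simp add: divide_simps add_nonneg_eq_0_iff)
    ultimately show ?thesis by (rule ord_le_eq_trans)
  qed
  have rK: "2 * K * r * (1 + real N) \<le> 1"
  proof -
    have "2 * K * r * (1 + real N) \<le> 2 * K * (1 / (2 * K * (1 + real N))) * (1 + real N)"
      using K by (intro mult_right_mono mult_left_mono) (auto simp: r_def)
    also have "\<dots> = 1"
    proof -
      have "2 * K * (1 + real N) \<noteq> 0" using K by (simp add: add_nonneg_eq_0_iff)
      then show ?thesis by simp
    qed
    finally show ?thesis .
  qed
  \<comment> \<open>For a pole and a point both in \<open>ball Y R1\<close>, \<rho> is at most r /
    2, where the kernel gains the constant c outside its core.\<close>
  define R1 where "R1 = min (R / 2) (r / (4 * B))"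
  have R1: "0 < R1" "R1 \<le> R / 2" "B * (2 * R1) \<le> r / 2"
  proof -
    have "B * (2 * R1) \<le> B * (2 * (r / (4 * B)))" using AB by (intro mult_left_mono) (auto simp: R1_def)
    then show "B * (2 * R1) \<le> r / 2" using AB by simp
  qed (use R r AB in \<open>auto simp: R1_def\<close>)
  have uL: "u \<in> L2_space \<Omega>" using u by (auto simp: converges_def L2_tendsto_iff)
  have ui: "integrable ?M u" using L2_space_imp_integrable[OF uL lmeasurable_\<Omega>] .
  have uS: "integrable ?M (\<lambda>X. u X * indicator S X)" if "S \<in> sets lebesgue" for S
  proof (rule Bochner_Integration.integrable_bound[OF ui])
    show "(\<lambda>X. u X * indicator S X) \<in> borel_measurable ?M"
      using that by (intro borel_measurable_times L2_space_measurable[OF uL]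
          measurable_restrict_space1[OF borel_measurable_indicator])
  qed (auto simp: indicator_def)
  define I where "I = (LINT X|?M. u X * indicator (ball Y R1) X)"
  have I: "0 < I"
  proof -
    have n: "AE X in ?M. 0 \<le> u X * indicator (ball Y R1) X" using nonneg by eventually_elim simp
    have "I \<noteq> 0"
    proof
      assume "I = 0"
      then have "AE X in ?M. u X * indicator (ball Y R1) X = 0"
        using integral_nonneg_eq_0_iff_AE[OF uS n] by (simp add: I_def)
      then have "AE X in ?M. X \<in> ball Y R1 \<longrightarrow> u X = 0" by eventually_elim (auto simp: indicator_def)
      with nz[OF R1(1)] show False by blast
    qed
    moreover have "0 \<le> I" unfolding I_def using n by (rule integral_nonneg_AE)
    ultimately show ?thesis by simp
  qed
  define c where "c = r / r ^ (N - 1)"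
  define C where "C = 2 * real N * (real N + 4) * r\<^sup>2"
  have cC: "0 < c" "0 \<le> C" using r by (auto simp: c_def C_def)
  have main: "c * I \<le> (c + C / d ^ N) * (LINT X|?M. u X * indicator (ball Z (A * d)) X)"
    if Z: "Z \<in> ball Y R1" and d: "0 < d" "d < r" for Z d
  proof -
    have ZR: "\<bar>fst Z - fst Y\<bar> \<le> R / 2" "dist Z Y < R / 2"
    proof -
      have "dist Z Y < R1" using Z by (simp add: dist_commute)
      moreover have "\<bar>fst Z - fst Y\<bar> \<le> dist Z Y" using dist_fst_le[of Z Y] by (simp add: dist_real_def)
      ultimately show "\<bar>fst Z - fst Y\<bar> \<le> R / 2" "dist Z Y < R / 2" using R1(2) by linarith+
    qed
    define k where "k = inverse (?a Z)"
    have Z0: "fst Z \<noteq> 0" "a0 \<le> ?a Z" "?a Z \<le> a1" using abnd[of Z] ZR R by auto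
    have k: "0 < k" "inverse k \<le> a1" "k \<le> inverse a0"
      using Z0 a01 by (auto simp: k_def intro: le_imp_inverse_le)
    define \<rho> where "\<rho> X = sqrt (quad k Z X)" for X
    have q\<rho>: "quad k Z X = (\<rho> X)\<^sup>2" "0 \<le> \<rho> X" for X using quad_nonneg[of k Z X] k by (auto simp: \<rho>_def)
    have d1: "dist X Z \<le> A * \<rho> X" for X
    proof (rule power2_le_imp_le)
      show "(dist X Z)\<^sup>2 \<le> (A * \<rho> X)\<^sup>2"
        using dist_le_quad[OF k(1,2), of X Z] a01 by (simp add: power_mult_distrib q\<rho>(1) A_def)
    qed (use AB q\<rho> in auto)
    have d2: "\<rho> X \<le> B * dist X Z" for X
    proof (rule power2_le_imp_le)
      have "(\<rho> X)\<^sup>2 \<le> (1 + k) * (dist X Z)\<^sup>2" using quad_le_dist[of k Z X] k by (simp add: q\<rho>)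
      also have "\<dots> \<le> (1 + inverse a0) * (dist X Z)\<^sup>2" using k by (intro mult_right_mono) auto
      finally show "(\<rho> X)\<^sup>2 \<le> (B * dist X Z)\<^sup>2" using a01 by (simp add: power_mult_distrib B_def)
    qed (use AB in auto)
    obtain f f1 f2 where f: "\<And>q. (f has_real_derivative f1 q) (at q)" "\<And>q. (f1 has_real_derivative f2 q) (at q)"
      and f2c: "continuous_on UNIV f2" and f0: "\<And>q. 0 \<le> f q" "\<And>q. r\<^sup>2 \<le> q \<Longrightarrow> f q = 0"
      and prof: "\<And>q. f1 q \<le> 0" "\<And>q. 0 \<le> f2 q"
        "\<And>\<rho>. d \<le> \<rho> \<Longrightarrow> f1 (\<rho>\<^sup>2) = - ((max (r - \<rho>) 0)\<^sup>2 / \<rho> ^ N)"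
        "\<And>\<rho>. d \<le> \<rho> \<Longrightarrow> f2 (\<rho>\<^sup>2) = max (r - \<rho>) 0 * (real N * max (r - \<rho>) 0 + 2 * \<rho>) / (2 * \<rho> ^ (N + 2))"
        "\<And>q. 0 \<le> q \<Longrightarrow> - ((real N + 4) * r\<^sup>2 / (2 * d ^ N)) \<le> f1 q"
    proof (rule kernel_profile[OF d, of N], goal_cases)
      case (1 f f1 f2)
      show thesis by (rule 1(1)[OF 1(2-)])
    qed
    have f1c: "continuous_on UNIV f1"
      using f(2) by (auto intro!: continuous_at_imp_continuous_on DERIV_isCont)
    define h where "h X = f (quad k Z X)" for X
    define Lh where "Lh = grushin_quad lam k Z f1 f2"
    have hC: "h \<in> C1_0 \<Omega>"
    proof -
      note hD = quad_comp_grad[of f f1 k Z, OF f(1)]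
      have "{X. h X \<noteq> 0} \<subseteq> cball Y R"
      proof
        fix X assume "X \<in> {X. h X \<noteq> 0}"
        then have "\<not> r\<^sup>2 \<le> quad k Z X" using f0(2)[of "quad k Z X"] by (auto simp: h_def)
        then have "(\<rho> X)\<^sup>2 < r\<^sup>2" by (simp add: q\<rho>(1))
        then have "\<rho> X < r" by (rule power_less_imp_less_base) (use r in simp)
        then have "dist X Z \<le> A * r" using d1[of X] mult_left_mono[of "\<rho> X" r A] AB by linarith
        also have "\<dots> \<le> R / 2" using rR r by (simp add: algebra_simps)
        finally show "X \<in> cball Y R"
          using ZR(2) dist_triangle[of X Y Z] by (simp add: dist_commute)
      qed
      then have s: "closure {X. h X \<noteq> 0} \<subseteq> cball Y R" by (intro closure_minimal) auto
      have "compact (closure {X. h X \<noteq> 0})"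
        using compact_Int_closed[OF compact_cball closed_closure[of "{X. h X \<noteq> 0}"], of Y R] s by (simp add: inf.absorb2)
      moreover have "grad h = (\<lambda>X. (2 * f1 (quad k Z X) * (fst X - fst Z), (2 * k * f1 (quad k Z X)) *\<^sub>R (snd X - snd Z)))"
        unfolding h_def[abs_def] by (rule ext, rule grad_eqI, rule hD)
      moreover have "continuous_on UNIV (\<lambda>X. f1 (quad k Z X))"
        by (rule continuous_on_compose2[OF f1c continuous_on_quad subset_UNIV])
      moreover have "h differentiable (at X)" for X
        unfolding h_def[abs_def] differentiable_def using hD by blast
      ultimately show ?thesis
        using s R(2) by (auto simp: C1_0_def intro!: continuous_intros)
    qed
    have Lhc: "continuous_on UNIV Lh" unfolding Lh_def by (intro continuous_on_grushin_quad lam f1c f2c)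
    have le0: "(LINT X|?M. u X * Lh X) \<le> 0"
    proof (rule weak_supersolution_test[OF super u hC _ Lhc])
      show "0 \<le> h X" for X by (simp add: h_def f0)
      show "(LINT X|?M. qgrad lam \<zeta> X \<bullet> qgrad lam h X) = - (LINT X|?M. \<zeta> X * Lh X)" if "\<zeta> \<in> C1_0 \<Omega>" for \<zeta>
        unfolding h_def[abs_def] Lh_def by (rule quad_by_parts[OF f f2c that])
    qed
    have rat: "\<bar>?a X / ?a Z - 1\<bar> \<le> K * \<bar>fst X - fst Z\<bar>" if "\<bar>fst X - fst Z\<bar> \<le> r" for X
    proof (rule ratio)
      have "r \<le> R / 2" using rR AB r mult_left_mono[of 1 "1 + A" r] by linarith
      then show "\<bar>fst X - fst Y\<bar> \<le> R" "\<bar>fst Z - fst Y\<bar> \<le> R" using that ZR(1) R by linarith+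
    qed
    note prems = Z0(1) d K rK[unfolded N_def] rat prof[unfolded N_def]
    have sub: "d \<le> \<rho> X \<Longrightarrow> 0 \<le> Lh X" "d \<le> \<rho> X \<Longrightarrow> \<rho> X \<le> r / 2 \<Longrightarrow> c \<le> Lh X"
      "\<rho> X < d \<Longrightarrow> - (C / d ^ N) \<le> Lh X" for X
      unfolding Lh_def k_def \<rho>_def c_def C_def N_def
      by (rule kernel_subsolution[OF prems]; assumption)+
    \<comment> \<open>The core \<rho> < d lies in \<open>ball Z (A * d)\<close>, where C / d^N pays
      for the regularised singularity and the extra c for the overlap with \<open>ball Y R1\<close>.
      Outside the core the kernel is a subsolution.\<close>
    have ptw: "c * indicator (ball Y R1) X - (c + C / d ^ N) * indicator (ball Z (A * d)) X \<le> Lh X" for X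
    proof (cases "\<rho> X < d")
      case True
      then have "dist X Z < A * d" using d1[of X] mult_strict_left_mono[OF True AB(1)] by linarith
      then have "c * indicator (ball Y R1) X - (c + C / d ^ N) * indicator (ball Z (A * d)) X \<le> - (C / d ^ N)"
        using cC by (simp add: dist_commute indicator_def)
      also have "\<dots> \<le> Lh X" using sub(3)[OF True] .
      finally show ?thesis .
    next
      case False
      have nn: "0 \<le> (c + C / d ^ N) * indicator (ball Z (A * d)) X" using cC d by simp
      show ?thesis
      proof (cases "X \<in> ball Y R1")
        case True
        then have "dist X Z < 2 * R1" using Z dist_triangle[of X Z Y] by (simp add: dist_commute)
        then have "\<rho> X \<le> r / 2" using d2[of X] R1(3) AB mult_left_mono[of "dist X Z" "2 * R1" B] by linarith
        then have "c \<le> Lh X" using sub(2)[of X] False by simp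
        then show ?thesis using nn True by simp
      next
        case out: False
        have "0 \<le> Lh X" using sub(1)[of X] False by simp
        then show ?thesis using nn out by simp
      qed
    qed
    have "c * I - (c + C / d ^ N) * (LINT X|?M. u X * indicator (ball Z (A * d)) X)
      = (LINT X|?M. c * (u X * indicator (ball Y R1) X) - (c + C / d ^ N) * (u X * indicator (ball Z (A * d)) X))"
      using uS[of "ball Y R1"] uS[of "ball Z (A * d)"] by (simp add: I_def)
    also have "\<dots> \<le> (LINT X|?M. u X * Lh X)"
    proof (rule integral_mono_AE)
      show "integrable ?M (\<lambda>X. c * (u X * indicator (ball Y R1) X) - (c + C / d ^ N) * (u X * indicator (ball Z (A * d)) X))"
        using uS[of "ball Y R1"] uS[of "ball Z (A * d)"] by simp
      show "integrable ?M (\<lambda>X. u X * Lh X)"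
        using L2_inner_integrable[OF uL continuous_L2_space[OF open_\<Omega> bounded_\<Omega> Lhc]] by simp
      show "AE X in ?M. c * (u X * indicator (ball Y R1) X) - (c + C / d ^ N) * (u X * indicator (ball Z (A * d)) X) \<le> u X * Lh X"
        using nonneg
      proof eventually_elim
        case (elim X)
        from mult_left_mono[OF ptw this, of X] show ?case by (simp add: algebra_simps)
      qed
    qed
    also note le0
    finally show ?thesis by simp
  qed
  define g where "g X = indicator \<Omega> X * u X" for X
  have gi: "integrable lebesgue g"
    using ui open_\<Omega> by (subst (asm) integrable_restrict_space) (auto simp: g_def[abs_def])
  define V where "V = unit_ball_vol (real DIM('m point)) * A ^ N"
  have V: "0 < V" using AB by (simp add: V_def)
  \<comment> \<open>Multiplying \<open>main\<close> by d^N, with d <= r and ball volume V d^N, gives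
    this lower bound for the averages: C / d^N scales exactly like the inverse volume, so neither Z
    nor d remains.\<close>
  define e where "e = c * I / (V * (c * r ^ N + C))"
  have den: "0 < c * r ^ N + C" using cC r by (simp add: add_pos_nonneg)
  have e: "0 < e" using cC I V den by (simp add: e_def)
  have "AE X in lebesgue. X \<in> ball Y R1 \<longrightarrow> e \<le> g X"
  proof (rule AE_ge_of_ball_averages[OF gi])
    fix Z \<delta> assume Z: "Z \<in> ball Y R1" and \<delta>: "0 < (\<delta>::real)"
    define d where "d = min (r / 2) (\<delta> / (2 * A))"
    have d: "0 < d" "d < r" "A * d < \<delta>"
    proof -
      have "A * d \<le> A * (\<delta> / (2 * A))" using AB by (intro mult_left_mono) (auto simp: d_def)
      then show "A * d < \<delta>" using AB \<delta> by simp
    qed (use r \<delta> AB in \<open>auto simp: d_def\<close>)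
    define J where "J = (LINT X:ball Z (A * d)|lebesgue. g X)"
    have J: "J = (LINT X|?M. u X * indicator (ball Z (A * d)) X)"
      using open_\<Omega> by (subst integral_restrict_space) (auto simp: J_def set_lebesgue_integral_def g_def mult_ac)
    have dN: "0 < d ^ N" "d ^ N \<le> r ^ N" using d by (auto intro: power_mono)
    have J0: "0 \<le> J" unfolding J
      by (rule integral_nonneg_AE) (use nonneg in eventually_elim, simp)
    have "c * I * d ^ N \<le> (c + C / d ^ N) * J * d ^ N"
      using main[OF Z d(1,2)] dN by (intro mult_right_mono) (auto simp: J)
    also have "\<dots> = (c * d ^ N + C) * J" using d by (simp add: field_simps)
    also have "\<dots> \<le> (c * r ^ N + C) * J" using dN J0 cC by (intro mult_right_mono add_mono mult_left_mono) auto
    finally have "c * I * d ^ N / (c * r ^ N + C) \<le> J" using den by (simp add: field_simps)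
    moreover have "e * measure lebesgue (ball Z (A * d)) = c * I * d ^ N / (c * r ^ N + C)"
    proof -
      have "measure lebesgue (ball Z (A * d)) = V * d ^ N"
        using AB d content_ball[of "A * d" Z] by (simp add: V_def N_def power_mult_distrib mult_ac)
      then show ?thesis using V by (simp add: e_def)
    qed
    ultimately have "e * measure lebesgue (ball Z (A * d)) \<le> (LINT X:ball Z (A * d)|lebesgue. g X)"
      by (simp add: J_def)
    then show "\<exists>d. 0 < d \<and> d < \<delta> \<and> e * measure lebesgue (ball Z d) \<le> (LINT X:ball Z d|lebesgue. g X)"
      using d AB by (intro exI[of _ "A * d"]) auto
  qed simp
  then have "AE X in lebesgue. X \<in> \<Omega> \<longrightarrow> X \<in> ball Y R1 \<longrightarrow> e \<le> u X"
    by eventually_elim (auto simp: g_def)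
  then have "AE X in ?M. X \<in> ball Y R1 \<longrightarrow> e \<le> u X"
    using open_\<Omega> by (subst AE_restrict_space_iff) auto
  then show ?thesis using e R1(1) unfolding ess_positive_on_def by blast
qed

text \<open>Otherwise every point of \<Omega> off the hyperplane has a ball on which u vanishes
  almost everywhere. Countably many such balls cover these points by Lindelof, and the hyperplane is
  null.\<close>

lemma ess_positive_somewhere:
  assumes u: "converges \<phi> u U" and super: "weak_supersolution U" and nonneg: "AE X in lebesgue_on \<Omega>. 0 \<le> u X"
    and nz: "\<not> (AE X in lebesgue_on \<Omega>. u X = 0)"
  shows "\<exists>Y\<in>\<Omega>. \<exists>e>0. ess_positive_on u (ball Y e)"
proof (rule ccontr)
  assume none: "\<not> ?thesis"
  have ex: "\<exists>e>0. AE X in lebesgue_on \<Omega>. X \<in> ball Y e \<longrightarrow> u X = 0" if "Y \<in> \<Omega> \<inter> {X. fst X \<noteq> 0}" for Y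
    using ess_positive_near[OF u super nonneg, of Y] none that by blast
  define F where "F = {B. \<exists>Y e. B = ball Y e \<and> (AE X in lebesgue_on \<Omega>. X \<in> B \<longrightarrow> u X = 0)}"
  obtain F' where F': "F' \<subseteq> F" "countable F'" "\<Union>F' = \<Union>F"
    using Lindelof[of F] by (auto simp: F_def)
  have "\<Omega> \<inter> {X. fst X \<noteq> 0} \<subseteq> \<Union>F'"
    unfolding F'(3)
  proof
    fix Y assume "Y \<in> \<Omega> \<inter> {X. fst X \<noteq> 0}"
    from ex[OF this] obtain e where "0 < e" "AE X in lebesgue_on \<Omega>. X \<in> ball Y e \<longrightarrow> u X = 0" by blast
    then have "ball Y e \<in> F" unfolding F_def by blast
    then show "Y \<in> \<Union>F" by (rule UnionI) (use \<open>0 < e\<close> in simp)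
  qed
  moreover have "AE X in lebesgue_on \<Omega>. \<forall>B\<in>F'. X \<in> B \<longrightarrow> u X = 0"
    using F' by (subst AE_ball_countable) (auto simp: F_def)
  ultimately have cov: "\<Omega> \<inter> {X. fst X \<noteq> 0} \<subseteq> \<Union>F'"
    and zero: "AE X in lebesgue_on \<Omega>. \<forall>B\<in>F'. X \<in> B \<longrightarrow> u X = 0" by blast+
  have "AE X in lebesgue_on \<Omega>. X \<in> \<Omega>"
    using AE_space[of "lebesgue_on \<Omega>"] by (simp add: space_restrict_space)
  then have "AE X in lebesgue_on \<Omega>. u X = 0"
    using AE_fst_nonzero[OF open_\<Omega>] zero
  proof eventually_elim
    case (elim X)
    then obtain B where "B \<in> F'" "X \<in> B" using cov by blast
    with elim show ?case by blast
  qed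
  with nz show False by blast
qed

end

section \<open>The essential infimum and the conclusion\<close>

lemma ess_inf_on_ge:
  assumes "S \<subseteq> \<Omega>" "open S" "open \<Omega>" "u \<in> borel_measurable (lebesgue_on \<Omega>)"
    and "AE X in lebesgue_on \<Omega>. X \<in> S \<longrightarrow> e \<le> u X"
  shows "ereal e \<le> ess_inf_on S u"
proof -
  have r: "restrict_space (lebesgue_on \<Omega>) S = lebesgue_on S"
    using assms(1-3) by (subst restrict_restrict_space) (auto simp: inf.absorb2)
  have "u \<in> borel_measurable (lebesgue_on S)"
    using measurable_restrict_space1[OF assms(4), of S] by (simp add: r)
  then have m: "(\<lambda>X. - ereal (u X)) \<in> borel_measurable (lebesgue_on S)" by simp
  have "AE X in lebesgue. X \<in> \<Omega> \<longrightarrow> X \<in> S \<longrightarrow> e \<le> u X"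
    using assms(3,5) by (subst (asm) AE_restrict_space_iff) auto
  then have "AE X in lebesgue. X \<in> S \<longrightarrow> - ereal (u X) \<le> - ereal e"
    by eventually_elim (use assms(1) in auto)
  then have "AE X in lebesgue_on S. - ereal (u X) \<le> - ereal e"
    using assms(2) by (subst AE_restrict_space_iff) auto
  with m have "esssup (lebesgue_on S) (\<lambda>X. - ereal (u X)) \<le> - ereal e" by (rule esssup_I)
  then show ?thesis
    unfolding ess_inf_on_def by (metis ereal_minus_le_minus ereal_uminus_uminus)
qed

theorem theorem2p6:
  fixes lam :: real
    and \<Omega> :: "(real \<times> (real ^ 'm)) set"
    and u :: "real \<times> (real ^ 'm) \<Rightarrow> real"
    and X\<^sub>0 :: "real \<times> (real ^ 'm)"
    and r :: real
  assumes "1 \<le> lam"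
    and "open \<Omega>" and "bounded \<Omega>" and "Lambda_connected lam \<Omega>"
    and "u \<in> H1_0 lam \<Omega>"
    and "AE X in lebesgue_on \<Omega>. 0 \<le> u X"
    and "supersolution lam \<Omega> u"
    and "0 < r" and "compactly_contained (ball X\<^sub>0 r) \<Omega>"
    and "ess_inf_on (ball X\<^sub>0 r) u = 0"
  shows "AE X in lebesgue_on \<Omega>. u X = 0"
proof (rule ccontr)
  assume nz: "\<not> ?thesis"
  interpret grushin_domain lam \<Omega> using assms(1-3) by unfold_locales auto
  obtain \<phi> U where u: "converges \<phi> u U" and super: "weak_supersolution U"
    using supersolution_imp_weak[OF assms(5,7)] by blast
  obtain Y s where Y: "Y \<in> \<Omega>" "0 < s" "ess_positive_on u (ball Y s)"
    using ess_positive_somewhere[OF u super assms(6) nz] by blast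
  have "\<exists>e>0. ess_positive_on u (ball X e)" if "X \<in> \<Omega>" for X
    using ess_positive_everywhere[OF u super assms(6) Lambda_connected_imp_connected[OF assms(4)] Y that] .
  then obtain e where e: "\<And>X. X \<in> \<Omega> \<Longrightarrow> 0 < e X \<and> ess_positive_on u (ball X (e X))" by metis
  let ?S = "closure (ball X\<^sub>0 r)"
  have S: "compact ?S" "?S \<subseteq> \<Omega>" using assms(9) by (auto simp: compactly_contained_def)
  \<comment> \<open>The local lower bounds are not uniform; a finite subcover of the compact closure
    reduces them to one positive constant.\<close>
  obtain I where I: "I \<subseteq> ?S" "finite I" "?S \<subseteq> (\<Union>X\<in>I. ball X (e X))"
  proof (rule compactE_image[OF S(1), of ?S "\<lambda>X. ball X (e X)"])
    show "?S \<subseteq> (\<Union>X\<in>?S. ball X (e X))"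
    proof
      fix X assume "X \<in> ?S"
      then show "X \<in> (\<Union>X\<in>?S. ball X (e X))" using e[of X] S(2) by (intro UN_I[of X]) auto
    qed
  qed auto
  have "ess_positive_on u (\<Union>X\<in>I. ball X (e X))"
    using I S e by (intro ess_positive_on_Union) auto
  then have "ess_positive_on u (ball X\<^sub>0 r)"
    using I(3) closure_subset by (rule_tac ess_positive_on_subset) blast+
  then obtain \<epsilon> where \<epsilon>: "0 < \<epsilon>" "AE X in lebesgue_on \<Omega>. X \<in> ball X\<^sub>0 r \<longrightarrow> \<epsilon> \<le> u X"
    by (auto simp: ess_positive_on_def)
  have "u \<in> borel_measurable (lebesgue_on \<Omega>)"
    using u by (auto simp: converges_def L2_tendsto_iff L2_space_measurable)
  with \<epsilon>(2) have "ereal \<epsilon> \<le> ess_inf_on (ball X\<^sub>0 r) u"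
    using S closure_subset[of "ball X\<^sub>0 r"] assms(2) by (intro ess_inf_on_ge) auto
  with \<epsilon>(1) assms(10) show False by simp
qed

end
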